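(* Assume (H1). Then almost surely the limit $X^\infty_t=\lim_{x\to\infty}X^x_{t\wedge\mathbb T^{(x)}_0}\in[0,\infty]$ exists for all $t\ge0$. The process $X^\infty$ is continuous (as a $[0,\infty]$-valued process), $X^\infty_0=\infty$, and $X^\infty_t<\infty$ for all $t>0$. For every $z\ge0$, $\mathbb T^{(\infty)}_z:=\inf\{t\ge0:X^\infty_t=z\}=\lim_{x\to\infty}\mathbb T^{(x)}_z$ a.s., and it has some finite exponential moments. Moreover, for all $0<s\le t\le\mathbb T^{(\infty)}_0$, $$X^\infty_t=X^\infty_s+B_t-B_s-\int_s^tq(X^\infty_u)\,du.$$
   Context: Let $q\in C^1([0,\infty))$, $B$ a standard Brownian motion, and for $x\ge0$ let $X^x$ be the strong solution of $dX^x_t=dB_t-q(X^x_t)dt$, $X^x_0=x$, stopped when it hits $0$ (all driven by the same $B$, so that a.s. $x\mapsto X^x_t$ is nondecreasing); $\mathbb T^{(x)}_z=\inf\{t\ge0:X^x_t=z\}$. $\gamma(y)=2\int_0^yq$. (H1): $\int_0^\infty e^{\gamma(y)}\int_y^\infty e^{-\gamma(\xi)}d\xi\,dy<\infty$. *)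

theory Defs
  imports "HOL-Probability.Probability"
begin

definition brownian_motion :: "'a measure \<Rightarrow> (real \<Rightarrow> 'a \<Rightarrow> real) \<Rightarrow> bool" where
  "brownian_motion M B \<longleftrightarrow>
     prob_space M \<and>
     (\<forall>t. B t \<in> borel_measurable M) \<and>
     (\<forall>\<omega>\<in>space M. B 0 \<omega> = 0 \<and> continuous_on {0..} (\<lambda>t. B t \<omega>)) \<and>
     (\<forall>s t. 0 \<le> s \<and> s < t \<longrightarrow>
        distributed M lborel (\<lambda>\<omega>. B t \<omega> - B s \<omega>) (normal_density 0 (sqrt (t - s)))) \<and>
     (\<forall>(ts::nat \<Rightarrow> real) n. 0 \<le> ts 0 \<and> (\<forall>i<n. ts i \<le> ts (Suc i)) \<longrightarrow>
        prob_space.indep_vars M (\<lambda>_. borel) (\<lambda>i \<omega>. B (ts (Suc i)) \<omega> - B (ts i) \<omega>) {..<n})"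

definition C1_on_nonneg :: "(real \<Rightarrow> real) \<Rightarrow> bool" where
  "C1_on_nonneg q \<longleftrightarrow> (\<exists>q'. continuous_on {0..} q' \<and>
      (\<forall>x\<ge>0. (q has_real_derivative q' x) (at x within {0..})))"

definition gam :: "(real \<Rightarrow> real) \<Rightarrow> real \<Rightarrow> real" where
  "gam q y = 2 * integral {0..y} q"

definition H1 :: "(real \<Rightarrow> real) \<Rightarrow> bool" where
  "H1 q \<longleftrightarrow>
     (\<integral>\<^sup>+ y. indicator {0..} y * ennreal (exp (gam q y)) *
        (\<integral>\<^sup>+ \<xi>. indicator {y..} \<xi> * ennreal (exp (- gam q \<xi>)) \<partial>lborel) \<partial>lborel) < \<infinity>"

text \<open>Hitting time inf{t \<ge> 0 : f t = z}, valued in [0,\<infinity>] (inf of empty set = \<infinity>).\<close>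
definition hit :: "(real \<Rightarrow> 'b) \<Rightarrow> 'b \<Rightarrow> ereal" where
  "hit f z = Inf {ereal t | t. 0 \<le> t \<and> f t = z}"

definition stopped_solution ::
    "(real \<Rightarrow> real) \<Rightarrow> (real \<Rightarrow> real) \<Rightarrow> real \<Rightarrow> (real \<Rightarrow> real) \<Rightarrow> bool" where
  "stopped_solution q b x X \<longleftrightarrow>
     X 0 = x \<and> continuous_on {0..} X \<and>
     (\<forall>t\<ge>0. (\<forall>u\<in>{0..t}. 0 < X u) \<longrightarrow>
        X t = x + b t - integral {0..t} (\<lambda>u. q (X u))) \<and>
     (\<forall>t\<ge>0. X t = 0 \<longrightarrow> (\<forall>u\<ge>t. X u = 0))"

end

theory Submission
  imports Defs
begin

text \<open>
  Let \<open>L f = f'' / 2 - q f'\<close>. By (H1) there is a bounded increasing \<open>U\<close> on the half-line with \<open>L U = -1\<close>,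
  and the scale function \<open>W\<close>, with \<open>L W = 0\<close>, tends to infinity. Up to additive constants, \<open>U\<close> is a
  Lyapunov function showing that the time to come down to \<open>z\<close> has exponential tails uniformly in the starting
  point, at a rate that tends to infinity with \<open>z\<close>; \<open>W\<close> shows that after coming down to \<open>z\<close> the process
  climbs to \<open>K\<close> with probability at most of order \<open>W z / W K\<close>, again uniformly in the starting point.

  No stochastic calculus is needed: because the noise is additive, the Euler scheme driven by the
  increments of \<open>B\<close> converges pathwise to the solution, it is a Markov chain with Gaussian innovations, and a
  Taylor expansion turns \<open>U\<close> and \<open>W\<close> into approximate supermartingales of this chain. Fatou's lemma
  transfers the bounds to the diffusion.

  Given these two facts the rest is pathwise. The solutions are bounded, hence equicontinuous, on each compact
  time interval in the open half-line, uniformly in the starting point; so their monotone limit is continuous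
  there, hitting times converge, and the integral equation passes to the limit by dominated convergence.
\<close>

section \<open>Potential and scale function\<close>

text \<open>The hypotheses say nothing about \<open>q\<close> below 0, and \<open>q\<close> need not
  be bounded or Lipschitz near infinity. Every estimate is therefore proved for paths confined to a
  compact strip, where clipping makes the drift bounded and globally Lipschitz. The strip can be
  removed afterwards because the bounds do not depend on it. For staying above \<open>z\<close>, put
  \<open>m = S - U (z / 2)\<close> with \<open>S\<close> the supremum of \<open>U\<close>: a shift
  of \<open>U\<close> takes values in \<open>{m..2 * m}\<close> wherever the path starts, which
  produces the prefactor 2 and, half of the drift being sacrificed to the discretisation, the rate
  \<open>1 / (4 * m)\<close>. Here \<open>m\<close> is at most \<open>S\<close>, so a positive rate
  survives as \<open>z\<close> tends to 0, which yields exponential moments for all levels. For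
  climbing, the bound starts from the value of \<open>W\<close> on arrival at the lower level, so
  the starting point drops out; the discretisation costs at most \<open>t\<close>, harmless against
  a large \<open>W K\<close>. Monotonicity turns bounds for single integer starting points into
  almost sure statements about all of them.\<close>

lemma C1_on_nonneg_continuous:
  assumes "C1_on_nonneg q"
  shows "continuous_on {0..} q"
proof -
  obtain q' where "\<And>x. x \<ge> 0 \<Longrightarrow> (q has_real_derivative q' x) (at x within {0..})"
    using assms unfolding C1_on_nonneg_def by blast
  then show ?thesis
    by (intro DERIV_continuous_on) auto
qed

lemma C1_on_nonneg_lipschitz:
  assumes "C1_on_nonneg q" "0 \<le> \<alpha>"
  shows "\<exists>L\<ge>0. \<forall>x\<in>{\<alpha>..\<beta>}. \<forall>y\<in>{\<alpha>..\<beta>}. \<bar>q x - q y\<bar> \<le> L * \<bar>x - y\<bar>"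
proof -
  obtain q' where q': "continuous_on {0..} q'"
    "\<And>x. x \<ge> 0 \<Longrightarrow> (q has_real_derivative q' x) (at x within {0..})"
    using assms unfolding C1_on_nonneg_def by blast
  have sub: "{\<alpha>..\<beta>} \<subseteq> {0..}" using assms(2) by auto
  have "compact (q' ` {\<alpha>..\<beta>})"
    by (rule compact_continuous_image[OF continuous_on_subset[OF q'(1) sub] compact_Icc])
  then have "bounded (q' ` {\<alpha>..\<beta>})" by (rule compact_imp_bounded)
  then have "\<exists>L. \<forall>y\<in>q' ` {\<alpha>..\<beta>}. norm y \<le> L" by (subst (asm) bounded_iff)
  then obtain L where L: "\<forall>y\<in>q' ` {\<alpha>..\<beta>}. norm y \<le> L" ..
  have "norm (q x - q y) \<le> (max L 0) * norm (x - y)" if "x \<in> {\<alpha>..\<beta>}" "y \<in> {\<alpha>..\<beta>}" for x y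
  proof (rule field_differentiable_bound[of "{\<alpha>..\<beta>}" q q'])
    fix z assume z: "z \<in> {\<alpha>..\<beta>}"
    then show "(q has_field_derivative q' z) (at z within {\<alpha>..\<beta>})"
      using DERIV_subset[OF q'(2) sub, of z] sub by auto
    show "norm (q' z) \<le> max L 0" using bspec[OF L imageI[OF z]] by auto
  qed (use that in auto)
  then show ?thesis by (intro exI[of _ "max L 0"]) auto
qed

lemma integral_has_real_derivative_at:
  fixes g :: "real \<Rightarrow> real"
  assumes "continuous_on {0..} g" "0 < x"
  shows "((\<lambda>y. integral {0..y} g) has_real_derivative g x) (at x)"
proof -
  have "continuous_on {0..x+1} g" by (rule continuous_on_subset[OF assms(1)]) auto
  then have "((\<lambda>y. integral {0..y} g) has_real_derivative g x) (at x within {0..x+1})"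
    using assms(2) by (intro integral_has_real_derivative) auto
  moreover have "at x within {0..x+1} = at x"
    using assms(2) by (intro at_within_interior) auto
  ultimately show ?thesis by simp
qed

lemma continuous_on_integral_nonneg:
  fixes g :: "real \<Rightarrow> real"
  assumes "continuous_on {0..} g"
  shows "continuous_on {0..} (\<lambda>y. integral {0..y} g)"
proof (rule continuous_on_subset)
  show "continuous_on (\<Union>n::nat. {0..<real n}) (\<lambda>y. integral {0..y} g)"
    unfolding continuous_on_eq_continuous_within
  proof
    fix x assume "x \<in> (\<Union>n::nat. {0..<real n})"
    then obtain n :: nat where x: "0 \<le> x" "x < real n" by auto
    have "g integrable_on {0..real n}"
      by (intro integrable_continuous_real continuous_on_subset[OF assms]) auto
    then have "continuous_on {0..real n} (\<lambda>y. integral {0..y} g)"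
      by (rule indefinite_integral_continuous_1)
    then have "continuous (at x within {0..real n}) (\<lambda>y. integral {0..y} g)"
      using x by (auto simp: continuous_on_eq_continuous_within)
    moreover have "at x within {0..real n} = at x within (\<Union>n::nat. {0..<real n})"
    proof (rule at_within_nhd[of _ "{..<real n}"])
      show "{0..real n} \<inter> {..<real n} - {x} = (\<Union>n. {0..<real n}) \<inter> {..<real n} - {x}"
        by auto
    qed (use x in auto)
    ultimately show "continuous (at x within (\<Union>n::nat. {0..<real n})) (\<lambda>y. integral {0..y} g)"
      by simp
  qed
  show "{0..} \<subseteq> (\<Union>n::nat. {0..<real n})"
  proof
    fix x :: real assume "x \<in> {0..}"
    moreover obtain n :: nat where "x < real n" using reals_Archimedean2 by blast
    ultimately show "x \<in> (\<Union>n::nat. {0..<real n})" by auto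
  qed
qed

lemma gam_continuous: "continuous_on {0..} q \<Longrightarrow> continuous_on {0..} (gam q)"
  unfolding gam_def by (intro continuous_intros continuous_on_integral_nonneg)

lemma gam_has_derivative:
  assumes "continuous_on {0..} q" "0 < x"
  shows "(gam q has_real_derivative 2 * q x) (at x)"
  unfolding gam_def by (intro DERIV_cmult integral_has_real_derivative_at assms)

text \<open>Bridge between two integrals: (H1) is stated with \<open>nn_integral\<close>, whereas
  \<open>gam\<close> and the functions built from it are Henstock-Kurzweil integrals, to which the
  fundamental theorem of calculus is applied.\<close>

lemma nn_integral_nonneg_interval:
  fixes g :: "real \<Rightarrow> real"
  assumes g: "continuous_on {a..b} g" and pos: "\<And>x. x \<in> {a..b} \<Longrightarrow> 0 \<le> g x"
  shows "(\<integral>\<^sup>+ x. indicator {a..b} x * ennreal (g x) \<partial>lborel) = ennreal (integral {a..b} g)"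
proof -
  have si: "set_integrable lborel {a..b} g"
    by (rule borel_integrable_atLeastAtMost') (rule g)
  have i: "(LINT x:{a..b}|lborel. g x) = integral {a..b} g"
    by (rule set_borel_integral_eq_integral(2)[OF si])
  have i2: "integrable lborel (\<lambda>x. indicator {a..b} x *\<^sub>R g x)"
    using si by (simp only: set_integrable_def)
  have "(\<integral>\<^sup>+ x. ennreal (indicator {a..b} x *\<^sub>R g x) \<partial>lborel) = ennreal (integral {a..b} g)"
    unfolding i[symmetric] set_lebesgue_integral_def
    by (rule nn_integral_eq_integral[OF i2]) (auto simp: indicator_def pos)
  also have "(\<lambda>x. ennreal (indicator {a..b} x *\<^sub>R g x)) = (\<lambda>x. indicator {a..b} x * ennreal (g x))"
    by (auto simp: indicator_def)
  finally show ?thesis .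
qed

text \<open>
  \<open>W\<close> is the scale function. The double integral in (H1) is half the total variation of \<open>U\<close>.
\<close>

lemma H1_potential:
  assumes q: "continuous_on {0..} q" and H1: "H1 q"
  shows "\<exists>U U' C. \<exists>W::real\<Rightarrow>real.
    (\<forall>x>0. (U has_real_derivative U' x) (at x)) \<and>
    (\<forall>x>0. (U' has_real_derivative 2 * q x * U' x - 2) (at x)) \<and>
    (\<forall>x>0. 0 < U' x \<and> 0 \<le> U x \<and> U x \<le> C) \<and>
    (\<forall>x>0. 0 < W x \<and> (W has_real_derivative exp (gam q x)) (at x)) \<and> filterlim W at_top at_top"
proof -
  let ?g = "gam q"
  have gc: "continuous_on {0..} ?g" by (rule gam_continuous[OF q])
  define J where "J y = (\<integral>\<^sup>+ \<xi>. indicator {y..} \<xi> * ennreal (exp (- ?g \<xi>)) \<partial>lborel)" for y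
  define E where "E y = integral {0..y} (\<lambda>x. exp (- ?g x))" for y
  have ec: "continuous_on {0..} (\<lambda>x. exp (- ?g x))" "continuous_on {0..} (\<lambda>x. exp (?g x))"
    by (intro continuous_intros gc)+
  have meas: "(\<lambda>x. indicator {y..} x * ennreal (exp (s * ?g x))) \<in> borel_measurable borel" if "y \<ge> 0" for y s :: real
  proof -
    have "continuous_on {y..} (\<lambda>x. exp (s * ?g x))"
      by (rule continuous_on_subset[of "{0..}"]) (use that gc in \<open>auto intro!: continuous_intros\<close>)
    then have "(\<lambda>x. indicator {y..} x *\<^sub>R exp (s * ?g x)) \<in> borel_measurable borel"
      by (intro borel_measurable_continuous_on_indicator) auto
    then have "(\<lambda>x. ennreal (indicator {y..} x *\<^sub>R exp (s * ?g x))) \<in> borel_measurable borel"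
      by measurable
    also have "(\<lambda>x. ennreal (indicator {y..} x *\<^sub>R exp (s * ?g x))) = (\<lambda>x. indicator {y..} x * ennreal (exp (s * ?g x)))"
      by (auto simp: indicator_def)
    finally show ?thesis .
  qed
  have split: "J 0 = ennreal (E y) + J y" if y: "y \<ge> 0" for y
  proof -
    have "J 0 = (\<integral>\<^sup>+ x. indicator {0..y} x * ennreal (exp (- ?g x)) + indicator {y..} x * ennreal (exp (- ?g x)) \<partial>lborel)"
      unfolding J_def using AE_lborel_singleton[of y] y
      by (intro nn_integral_cong_AE) (auto simp: indicator_def)
    also have "\<dots> = (\<integral>\<^sup>+ x. indicator {0..y} x * ennreal (exp (- ?g x)) \<partial>lborel) + J y"
      unfolding J_def
    proof (subst nn_integral_add)
      show "(\<lambda>x. indicator {y..} x * ennreal (exp (- ?g x))) \<in> borel_measurable lborel"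
        using meas[of y "-1"] y by simp
      have "(\<lambda>x. indicator {..y} x * (indicator {0..} x * ennreal (exp (- ?g x)))) \<in> borel_measurable lborel"
        using meas[of 0 "-1"] by simp
      then show "(\<lambda>x. indicator {0..y} x * ennreal (exp (- ?g x))) \<in> borel_measurable lborel"
        by (rule measurable_cong[THEN iffD1, rotated]) (auto simp: indicator_def)
    qed auto
    also have "(\<integral>\<^sup>+ x. indicator {0..y} x * ennreal (exp (- ?g x)) \<partial>lborel) = ennreal (E y)"
      unfolding E_def by (intro nn_integral_nonneg_interval continuous_on_subset[OF ec(1)]) auto
    finally show ?thesis .
  qed
  have H1': "(\<integral>\<^sup>+ y. indicator {0..} y * ennreal (exp (?g y)) * J y \<partial>lborel) < \<infinity>"
    using H1 unfolding H1_def J_def .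
  \<comment> \<open>If the tail integral were infinite at 0, it would be infinite at every
    \<open>y\<close>, since only the finite \<open>E y\<close> is split off. The integrand of (H1)
    would then be infinite on the whole half-line.\<close>
  have J0: "J 0 < \<infinity>"
  proof (rule ccontr)
    assume "\<not> J 0 < \<infinity>"
    then have "J 0 = \<infinity>" by (simp add: less_top[symmetric])
    then have inf: "J y = \<infinity>" if "y \<ge> 0" for y
      using split[OF that] by (auto simp: ennreal_add_eq_top)
    have "(\<integral>\<^sup>+ y. \<infinity> * indicator {0..} (y::real) \<partial>lborel) \<le> (\<integral>\<^sup>+ y. indicator {0..} y * ennreal (exp (?g y)) * J y \<partial>lborel)"
      by (intro nn_integral_mono) (auto simp: indicator_def inf ennreal_mult_top)
    moreover have "(\<integral>\<^sup>+ y. \<infinity> * indicator {0..} (y::real) \<partial>lborel) = \<infinity>"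
    proof (subst nn_integral_cmult_indicator)
      have "emeasure lborel {0..1::real} \<le> emeasure lborel {(0::real)..}" by (intro emeasure_mono) auto
      then show "\<infinity> * emeasure lborel {(0::real)..} = \<infinity>"
        by (auto simp: ennreal_top_mult)
    qed auto
    ultimately show False using H1' by (auto simp: top_unique)
  qed
  define A where "A = enn2real (J 0)"
  \<comment> \<open>\<open>I\<close> is the real-valued form of the tail integral \<open>J\<close>;
    written as \<open>A - E y\<close> it can be differentiated.\<close>
  define I where "I y = A - E y" for y
  have A: "J 0 = ennreal A" using J0 by (simp add: A_def)
  have E0: "E y \<ge> 0" for y unfolding E_def
    by (intro Henstock_Kurzweil_Integration.integral_nonneg integrable_continuous_real
        continuous_on_subset[OF ec(1)]) auto
  have J_I: "J y = ennreal (I y)" if "y \<ge> 0" for y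
  proof -
    have s: "ennreal A = ennreal (E y) + J y" using split[OF that] A by simp
    then have "J y < \<infinity>" by (metis ennreal_add_eq_top ennreal_neq_top infinity_ennreal_def less_top)
    then obtain r where r: "J y = ennreal r" "r \<ge> 0" by (metis ennreal_cases infinity_ennreal_def less_irrefl)
    then have "A = E y + r" using s E0 by (metis A_def add_nonneg_nonneg enn2real_nonneg ennreal_inj ennreal_plus)
    then show ?thesis using r I_def by simp
  qed
  have E_strict: "E x < E y" if "0 \<le> x" "x < y" for x y
  proof -
    have "E y = E x + integral {x..y} (\<lambda>x. exp (- ?g x))"
      unfolding E_def using that
      by (subst Henstock_Kurzweil_Integration.integral_combine)
        (auto intro!: integrable_continuous_real continuous_on_subset[OF ec(1)])
    moreover have "integral {x..y} (\<lambda>_. 0) < integral {x..y} (\<lambda>x. exp (- ?g x))"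
      using that by (intro integral_less_real) (auto intro!: continuous_on_subset[OF ec(1)])
    ultimately show ?thesis by simp
  qed
  have I_nn: "I y \<ge> 0" if "y \<ge> 0" for y
  proof (rule ccontr)
    assume a: "\<not> I y \<ge> 0"
    have "ennreal A = ennreal (E y) + J y" using split[OF that] A by simp
    then have "ennreal (E y) \<le> ennreal A" by (metis le_iff_add)
    then have "E y \<le> A" by (simp add: A_def E0 ennreal_le_iff)
    with a show False by (simp add: I_def)
  qed
  have I_pos: "I y > 0" if "y \<ge> 0" for y
    using I_nn[of "y+1"] E_strict[of y "y+1"] that by (simp add: I_def)
  have I_cont: "continuous_on {0..} I"
    unfolding I_def E_def by (intro continuous_intros continuous_on_integral_nonneg ec)
  \<comment> \<open>\<open>U x\<close> is the mean time in which the diffusion from \<open>x\<close>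
    hits 0, expressed through the scale density \<open>exp (gam q y)\<close> and the speed density
    \<open>2 * exp (- gam q y)\<close>. In this reading (H1) says that these means are bounded in
    \<open>x\<close>.\<close>
  define U' where "U' y = 2 * exp (?g y) * I y" for y
  define U where "U y = integral {0..y} U'" for y
  define W where "W y = integral {0..y} (\<lambda>x. exp (?g x))" for y
  have U'_cont: "continuous_on {0..} U'"
    unfolding U'_def by (intro continuous_intros ec I_cont)
  have "(U has_real_derivative U' x) (at x)" if "x > 0" for x
    unfolding U_def by (rule integral_has_real_derivative_at[OF U'_cont that])
  moreover have "(U' has_real_derivative 2 * q x * U' x - 2) (at x)" if x: "x > 0" for x
  proof -
    have "(I has_real_derivative 0 - exp (- ?g x)) (at x)"
      unfolding I_def E_def by (intro DERIV_diff DERIV_const integral_has_real_derivative_at ec x)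
    then have "(U' has_real_derivative 2 * (exp (?g x) * (2 * q x)) * I x + 2 * exp (?g x) * (0 - exp (- ?g x))) (at x)"
      unfolding U'_def using gam_has_derivative[OF q x]
      by (auto intro!: derivative_eq_intros)
    moreover have "2 * (exp (?g x) * (2 * q x)) * I x + 2 * exp (?g x) * (0 - exp (- ?g x)) = 2 * q x * U' x - 2"
      by (simp add: U'_def exp_minus field_simps)
    ultimately show ?thesis by simp
  qed
  moreover have "U' x > 0" if "x > 0" for x using I_pos[of x] that by (simp add: U'_def)
  moreover have "U x \<ge> 0" if "x > 0" for x
    unfolding U_def
    by (intro Henstock_Kurzweil_Integration.integral_nonneg integrable_continuous_real
        continuous_on_subset[OF U'_cont]) (auto simp: U'_def I_nn)
  moreover have "\<exists>C. \<forall>x>0. U x \<le> C"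
  proof -
    define h where "h = (\<integral>\<^sup>+ y. indicator {0..} y * ennreal (exp (?g y)) * J y \<partial>lborel)"
    have "U x \<le> 2 * enn2real h" if x: "x > 0" for x
    proof -
      have "ennreal (integral {0..x} (\<lambda>y. exp (?g y) * I y)) = (\<integral>\<^sup>+ y. indicator {0..x} y * ennreal (exp (?g y) * I y) \<partial>lborel)"
        by (rule nn_integral_nonneg_interval[symmetric])
          (auto intro!: continuous_intros continuous_on_subset[OF I_cont] continuous_on_subset[OF gc] mult_nonneg_nonneg I_nn)
      also have "\<dots> \<le> h" unfolding h_def
        by (intro nn_integral_mono) (auto simp: indicator_def J_I ennreal_mult' mult.commute I_nn)
      finally have "ennreal (integral {0..x} (\<lambda>y. exp (?g y) * I y)) \<le> h" .
      then have "integral {0..x} (\<lambda>y. exp (?g y) * I y) \<le> enn2real h"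
        using H1' unfolding h_def[symmetric]
        by (metis enn2real_mono enn2real_nonneg ennreal_enn2real_if ennreal_le_iff infinity_ennreal_def less_irrefl)
      moreover have "U x = 2 * integral {0..x} (\<lambda>y. exp (?g y) * I y)"
        unfolding U_def U'_def by (simp add: mult.assoc)
      ultimately show ?thesis by simp
    qed
    then show ?thesis by blast
  qed
  then obtain C where "\<And>x. x > 0 \<Longrightarrow> U x \<le> C" by auto
  moreover have "(W has_real_derivative exp (?g x)) (at x)" if "x > 0" for x
    unfolding W_def by (rule integral_has_real_derivative_at[OF ec(2) that])
  moreover have "W x > 0" if "x > 0" for x
  proof -
    have "integral {0..x} (\<lambda>_. 0) < W x" unfolding W_def
      using that by (intro integral_less_real) (auto intro!: continuous_on_subset[OF ec(2)])
    then show ?thesis by simp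
  qed
  \<comment> \<open>A number and its inverse add up to at least 2, so \<open>W x + E x\<close> is at
    least \<open>2 * x\<close>; as \<open>E x\<close> never exceeds \<open>A\<close>, the growth
    must come from \<open>W\<close>.\<close>
  moreover have "filterlim W at_top at_top"
  proof (rule filterlim_at_top_mono)
    show "filterlim (\<lambda>x::real. x) at_top at_top"
      by (rule filterlim_ident)
    show "\<forall>\<^sub>F x in at_top. x \<le> W x"
      using eventually_ge_at_top[of "0::real"] eventually_ge_at_top[of A]
    proof eventually_elim
      case (elim x)
      have i: "(\<lambda>y. exp (- ?g y)) integrable_on {0..x}" "(\<lambda>y. exp (?g y)) integrable_on {0..x}"
        by (intro integrable_continuous_real continuous_on_subset[OF ec(1)] continuous_on_subset[OF ec(2)]; auto)+
      have "integral {0..x} (\<lambda>_. 2::real) \<le> integral {0..x} (\<lambda>y. exp (?g y) + exp (- ?g y))"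
      proof (rule integral_le)
        fix y assume "y \<in> {0..x}"
        have "2 * exp (?g y) \<le> exp (?g y) * exp (?g y) + 1"
          using sum_squares_bound[of "exp (?g y)" 1] by (simp add: power2_eq_square)
        then show "2 \<le> exp (?g y) + exp (- ?g y)"
          by (simp add: exp_minus field_simps)
      qed (auto intro!: integrable_add i)
      also have "\<dots> = W x + E x" unfolding W_def E_def by (rule integral_add[OF i(2,1)])
      also have "\<dots> \<le> W x + A" using I_nn[OF elim(1)] by (simp add: I_def)
      finally show ?case using elim by simp
    qed
  qed
  ultimately show ?thesis
    by (intro exI[of _ U] exI[of _ U'] exI[of _ C] exI[of _ W] conjI allI impI) simp_all
qed

section \<open>Supermartingales along Euler chains\<close>

text \<open>The state type is left general so that a state can carry a finite memory besides a
  position.\<close>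

primrec chain :: "('s \<Rightarrow> real \<Rightarrow> 's) \<Rightarrow> 's \<Rightarrow> (nat \<Rightarrow> real) \<Rightarrow> nat \<Rightarrow> 's" where
  "chain \<Phi> s \<xi> 0 = s"
| "chain \<Phi> s \<xi> (Suc k) = \<Phi> (chain \<Phi> s \<xi> k) (\<xi> k)"

lemma chain_cong: "(\<And>i. i < k \<Longrightarrow> \<xi> i = \<xi>' i) \<Longrightarrow> chain \<Phi> s \<xi> k = chain \<Phi> s \<xi>' k"
  by (induction k) auto

lemma chain_measurable_PiM:
  assumes \<Phi>: "(\<lambda>(s, u). \<Phi> s u) \<in> S \<Otimes>\<^sub>M borel \<rightarrow>\<^sub>M S" and s: "s \<in> space S" and "j \<le> k"
  shows "(\<lambda>x. chain \<Phi> s x j) \<in> PiM {..<k} (\<lambda>_. borel) \<rightarrow>\<^sub>M S"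
  using \<open>j \<le> k\<close>
proof (induction j)
  case 0
  show ?case using s by simp
next
  case (Suc j)
  have "(\<lambda>x. (chain \<Phi> s x j, x j)) \<in> PiM {..<k} (\<lambda>_. borel) \<rightarrow>\<^sub>M S \<Otimes>\<^sub>M borel"
    using Suc by (intro measurable_Pair measurable_component_singleton) auto
  from measurable_compose[OF this \<Phi>] show ?case by simp
qed

text \<open>The state after \<open>k\<close> steps is a function of the first \<open>k\<close>
  innovations, hence independent of the next one; Fubini integrates that one out and
  \<open>step\<close> applies. This takes the place of conditional expectations. A time-dependent
  \<open>v\<close> leaves room for growth factors and error budgets, and values in
  \<open>ennreal\<close> avoid integrability questions and admit infinity.\<close>

lemma (in prob_space) chain_supermartingale:
  fixes v :: "nat \<Rightarrow> 's \<Rightarrow> ennreal" and \<xi> :: "nat \<Rightarrow> 'a \<Rightarrow> real"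
  assumes \<Phi>: "(\<lambda>(s, u). \<Phi> s u) \<in> S \<Otimes>\<^sub>M borel \<rightarrow>\<^sub>M S" and s: "s \<in> space S"
    and ind: "indep_vars (\<lambda>_. borel) \<xi> {..<n}"
    and distr: "\<And>k. k < n \<Longrightarrow> distr M borel (\<xi> k) = N"
    and v: "\<And>k. v k \<in> borel_measurable S"
    and step: "\<And>k s. k < n \<Longrightarrow> s \<in> space S \<Longrightarrow> (\<integral>\<^sup>+ u. v (Suc k) (\<Phi> s u) \<partial>N) \<le> v k s"
    and "k \<le> n"
  shows "(\<integral>\<^sup>+ \<omega>. v k (chain \<Phi> s (\<lambda>i. \<xi> i \<omega>) k) \<partial>M) \<le> v 0 s"
  using \<open>k \<le> n\<close>
proof (induction k)
  case 0
  then show ?case by (simp add: emeasure_space_1)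
next
  case (Suc k)
  have k: "k < n" using Suc by simp
  define P where "P = PiM {..<k} (\<lambda>_. borel :: real measure)"
  define R where "R \<omega> = restrict (\<lambda>i. \<xi> i \<omega>) {..<k}" for \<omega>
  \<comment> \<open>Independence is used for restrictions to disjoint index sets, so the next
    innovation is packaged as a function on the singleton \<open>{k}\<close>.\<close>
  define Q where "Q = PiM {k} (\<lambda>_. borel :: real measure)"
  define T where "T \<omega> = restrict (\<lambda>i. \<xi> i \<omega>) {k}" for \<omega>
  have ind': "indep_var P R Q T"
    unfolding P_def R_def Q_def T_def using k by (intro indep_var_restrict[OF ind]) auto
  note rv = indep_var_rv1[OF ind'] indep_var_rv2[OF ind']
  have pair: "distr M (P \<Otimes>\<^sub>M Q) (\<lambda>\<omega>. (R \<omega>, T \<omega>)) = distr M P R \<Otimes>\<^sub>M distr M Q T"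
    using ind' unfolding indep_var_distribution_eq by simp
  interpret T: prob_space "distr M Q T" by (rule prob_space_distr[OF rv(2)])
  have cm: "(\<lambda>x. chain \<Phi> s x k) \<in> P \<rightarrow>\<^sub>M S"
    unfolding P_def by (rule chain_measurable_PiM[OF \<Phi> s order_refl])
  have km: "(\<lambda>x. x k) \<in> borel_measurable Q"
    unfolding Q_def by (rule measurable_component_singleton) simp
  have chain_R: "chain \<Phi> s (R \<omega>) k = chain \<Phi> s (\<lambda>i. \<xi> i \<omega>) k" for \<omega>
    by (rule chain_cong) (simp add: R_def)
  have \<xi>: "\<xi> k \<in> borel_measurable M"
    using measurable_compose[OF rv(2) km] by (simp add: T_def)
  have "(\<lambda>p. (chain \<Phi> s (fst p) k, snd p k)) \<in> P \<Otimes>\<^sub>M Q \<rightarrow>\<^sub>M S \<Otimes>\<^sub>M borel"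
    by (intro measurable_Pair measurable_compose[OF measurable_fst cm] measurable_compose[OF measurable_snd km])
  from measurable_compose[OF measurable_compose[OF this \<Phi>] v[of "Suc k"]]
  have m: "(\<lambda>p. v (Suc k) (\<Phi> (chain \<Phi> s (fst p) k) (snd p k))) \<in> borel_measurable (P \<Otimes>\<^sub>M Q)"
    by simp
  have m1: "(\<lambda>u. v (Suc k) (\<Phi> s u)) \<in> borel_measurable borel" if "s \<in> space S" for s
    using measurable_compose[OF measurable_compose[OF measurable_Pair1'[OF that] \<Phi>] v[of "Suc k"]] by simp
  have "(\<integral>\<^sup>+ \<omega>. v (Suc k) (chain \<Phi> s (\<lambda>i. \<xi> i \<omega>) (Suc k)) \<partial>M)
      = (\<integral>\<^sup>+ \<omega>. v (Suc k) (\<Phi> (chain \<Phi> s (fst (R \<omega>, T \<omega>)) k) (snd (R \<omega>, T \<omega>) k)) \<partial>M)"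
    by (simp add: chain_R) (simp add: T_def)
  also have "\<dots> = (\<integral>\<^sup>+ p. v (Suc k) (\<Phi> (chain \<Phi> s (fst p) k) (snd p k)) \<partial>distr M (P \<Otimes>\<^sub>M Q) (\<lambda>\<omega>. (R \<omega>, T \<omega>)))"
    by (rule nn_integral_distr[symmetric]) (use rv m in auto)
  also have "\<dots> = (\<integral>\<^sup>+ x. \<integral>\<^sup>+ y. v (Suc k) (\<Phi> (chain \<Phi> s x k) (y k)) \<partial>distr M Q T \<partial>distr M P R)"
    unfolding pair by (subst T.nn_integral_fst[symmetric]) (use m in \<open>simp_all cong: measurable_cong_sets\<close>)
  also have "\<dots> \<le> (\<integral>\<^sup>+ x. v k (chain \<Phi> s x k) \<partial>distr M P R)"
  proof (intro nn_integral_mono)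
    fix x assume "x \<in> space (distr M P R)"
    then have c: "chain \<Phi> s x k \<in> space S" using measurable_space[OF cm] by simp
    have "(\<integral>\<^sup>+ y. v (Suc k) (\<Phi> (chain \<Phi> s x k) (y k)) \<partial>distr M Q T)
        = (\<integral>\<^sup>+ \<omega>. v (Suc k) (\<Phi> (chain \<Phi> s x k) (T \<omega> k)) \<partial>M)"
      using measurable_compose[OF km m1[OF c]] by (intro nn_integral_distr[OF rv(2)]) simp
    also have "\<dots> = (\<integral>\<^sup>+ u. v (Suc k) (\<Phi> (chain \<Phi> s x k) u) \<partial>distr M borel (\<xi> k))"
      using m1[OF c] by (subst nn_integral_distr[OF \<xi>]) (simp_all add: T_def)
    also have "\<dots> \<le> v k (chain \<Phi> s x k)"
      unfolding distr[OF k] by (rule step[OF k c])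
    finally show "(\<integral>\<^sup>+ y. v (Suc k) (\<Phi> (chain \<Phi> s x k) (y k)) \<partial>distr M Q T) \<le> v k (chain \<Phi> s x k)" .
  qed
  also have "\<dots> = (\<integral>\<^sup>+ \<omega>. v k (chain \<Phi> s (R \<omega>) k) \<partial>M)"
    using measurable_compose[OF cm v] by (intro nn_integral_distr[OF rv(1)]) simp
  also have "\<dots> \<le> v 0 s" unfolding chain_R by (rule Suc.IH) (use Suc in simp)
  finally show ?case .
qed

section \<open>Taylor expansion and the drift of one Euler step\<close>

abbreviation clip :: "real \<Rightarrow> real \<Rightarrow> real \<Rightarrow> real" where
  "clip c d z \<equiv> max c (min d z)"

text \<open>
  Clipping the argument makes it unnecessary to extend \<open>f\<close> smoothly beyond \<open>{c..d}\<close>: starting from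
  \<open>{a..b}\<close>, an increment that leaves \<open>{c..d}\<close> is bounded away from 0, so the fourth power absorbs
  every error there.
\<close>

lemma taylor_clip_bound:
  fixes f f' f'' :: "real \<Rightarrow> real"
  assumes ord: "c < a" "a \<le> b" "b < d" "0 < e"
    and f: "\<And>y. y \<in> {c..d} \<Longrightarrow> (f has_real_derivative f' y) (at y)"
    and f': "\<And>y. y \<in> {c..d} \<Longrightarrow> (f' has_real_derivative f'' y) (at y)"
    and f'': "continuous_on {c..d} f''"
    and nn: "\<And>y. y \<in> {c..d} \<Longrightarrow> 0 \<le> f y"
  shows "\<exists>C\<ge>0. \<forall>y\<in>{a..b}. \<forall>\<delta>. f (clip c d (y + \<delta>)) \<le> f y + f' y * \<delta> + (f'' y / 2 + e) * \<delta>^2 + C * \<delta>^4"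
proof -
  have bdd: "\<exists>F\<ge>0. \<forall>y\<in>{c..d}. \<bar>g y\<bar> \<le> F" if "continuous_on {c..d} g" for g :: "real \<Rightarrow> real"
  proof -
    have "bounded (g ` {c..d})"
      by (intro compact_imp_bounded compact_continuous_image that compact_Icc)
    then obtain F where "\<forall>y\<in>g ` {c..d}. norm y \<le> F" by (auto simp only: bounded_iff)
    then show ?thesis by (intro exI[of _ "max F 0"]) (auto simp: max_def)
  qed
  have cf: "continuous_on {c..d} f" "continuous_on {c..d} f'"
    by (intro continuous_at_imp_continuous_on ballI, erule DERIV_isCont[OF f] DERIV_isCont[OF f'])+
  obtain F0 F1 F2 where F: "F0 \<ge> 0" "F1 \<ge> 0" "F2 \<ge> 0"
    "\<forall>y\<in>{c..d}. \<bar>f y\<bar> \<le> F0" "\<forall>y\<in>{c..d}. \<bar>f' y\<bar> \<le> F1" "\<forall>y\<in>{c..d}. \<bar>f'' y\<bar> \<le> F2"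
    using bdd[OF cf(1)] bdd[OF cf(2)] bdd[OF f''] by blast
  have "uniformly_continuous_on {c..d} f''"
    by (rule compact_uniformly_continuous[OF f'' compact_Icc])
  then obtain \<eta> where \<eta>: "\<eta> > 0" "\<And>x y. x \<in> {c..d} \<Longrightarrow> y \<in> {c..d} \<Longrightarrow> \<bar>x - y\<bar> < \<eta> \<Longrightarrow> \<bar>f'' x - f'' y\<bar> < 2 * e"
    unfolding uniformly_continuous_on_def dist_real_def using ord(4)
    by (metis mult_pos_pos zero_less_numeral)
  \<comment> \<open>A step shorter than \<open>r\<close> from \<open>{a..b}\<close> stays in
    \<open>{c..d}\<close> and changes \<open>f''\<close> by less than \<open>2 * e\<close>. For
    longer steps \<open>\<bar>\<delta>\<bar> / r\<close> is at least 1, and the three summands of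
    \<open>C\<close> raise the powers 0, 1 and 2 of the increment to the fourth power.\<close>
  define r where "r = min \<eta> (min (a - c) (d - b))"
  have r: "0 < r" "r \<le> \<eta>" "r \<le> a - c" "r \<le> d - b" using \<eta> ord by (auto simp: r_def)
  define C where "C = F0 / r^4 + F1 / r^3 + F2 / r^2"
  show ?thesis
  proof (intro exI[of _ C] conjI ballI allI)
    show "0 \<le> C" using F r by (auto simp: C_def)
    fix y \<delta> assume y: "y \<in> {a..b}"
    then have yc: "y \<in> {c..d}" using ord by auto
    show "f (clip c d (y + \<delta>)) \<le> f y + f' y * \<delta> + (f'' y / 2 + e) * \<delta>^2 + C * \<delta>^4"
    proof (cases "\<bar>\<delta>\<bar> < r")
      case True
      have yd: "y + \<delta> \<in> {c..d}" using True r y by auto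
      have "\<exists>\<theta>. \<theta> \<in> {c..d} \<and> \<bar>\<theta> - y\<bar> < \<eta> \<and> f (y + \<delta>) = f y + f' y * \<delta> + f'' \<theta> / 2 * \<delta>^2"
      proof (cases "\<delta> = 0")
        case True
        then show ?thesis using yc \<eta> by (intro exI[of _ y]) auto
      next
        case False
        define df where "df = (\<lambda>m::nat. if m = 0 then f else if m = 1 then f' else f'')"
        have "\<exists>t. (if y + \<delta> < y then y + \<delta> < t \<and> t < y else y < t \<and> t < y + \<delta>) \<and>
            f (y + \<delta>) = (\<Sum>m<2. (df m y / fact m) * (y + \<delta> - y)^m) + (df 2 t / fact 2) * (y + \<delta> - y)^2"
          by (rule Taylor[where a=c and b=d]) (use False yc yd f f' in \<open>auto simp: df_def less_2_cases_iff\<close>)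
        then obtain t where t: "if y + \<delta> < y then y + \<delta> < t \<and> t < y else y < t \<and> t < y + \<delta>"
          "f (y + \<delta>) = (\<Sum>m<2. (df m y / fact m) * (y + \<delta> - y)^m) + (df 2 t / fact 2) * (y + \<delta> - y)^2" by blast
        show ?thesis
        proof (intro exI[of _ t] conjI)
          show "t \<in> {c..d}" using t(1) yc yd by (auto split: if_splits)
          show "\<bar>t - y\<bar> < \<eta>" using t(1) \<open>\<bar>\<delta>\<bar> < r\<close> r by (auto split: if_splits)
          show "f (y + \<delta>) = f y + f' y * \<delta> + f'' t / 2 * \<delta>^2"
            using t(2) by (simp add: df_def numeral_2_eq_2)
        qed
      qed
      then obtain \<theta> where \<theta>: "\<theta> \<in> {c..d}" "\<bar>\<theta> - y\<bar> < \<eta>" "f (y + \<delta>) = f y + f' y * \<delta> + f'' \<theta> / 2 * \<delta>^2" by blast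
      have "f'' \<theta> / 2 * \<delta>^2 \<le> (f'' y / 2 + e) * \<delta>^2"
        using \<eta>(2)[OF \<theta>(1) yc \<theta>(2)] by (intro mult_right_mono) auto
      moreover have "0 \<le> C * \<delta>^4" using \<open>0 \<le> C\<close> by auto
      moreover have "clip c d (y + \<delta>) = y + \<delta>" using yd by auto
      ultimately show ?thesis using \<theta>(3) by simp
    next
      case False
      then have d: "r \<le> \<bar>\<delta>\<bar>" by simp
      have "clip c d (y + \<delta>) \<in> {c..d}" using ord by auto
      then have 0: "f (clip c d (y + \<delta>)) \<le> F0" using F(4) by fastforce
      have "r^4 \<le> \<bar>\<delta>\<bar>^4" using d r by (intro power_mono) auto
      then have "F0 * r^4 \<le> F0 * \<delta>^4" using F(1) by (intro mult_left_mono) auto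
      then have 1: "F0 \<le> F0 / r^4 * \<delta>^4" using r by (simp add: field_simps)
      have "\<bar>\<delta>\<bar> * r^3 \<le> \<bar>\<delta>\<bar> * \<bar>\<delta>\<bar>^3" using d r by (intro mult_left_mono power_mono) auto
      also have "\<dots> = \<delta>^4" using power_Suc[of "\<bar>\<delta>\<bar>" 3] by simp
      finally have "F1 * (\<bar>\<delta>\<bar> * r^3) \<le> F1 * \<delta>^4" using F(2) by (intro mult_left_mono) auto
      then have "F1 * \<bar>\<delta>\<bar> \<le> F1 / r^3 * \<delta>^4" using r by (simp add: field_simps)
      moreover have "\<bar>f' y\<bar> * \<bar>\<delta>\<bar> \<le> F1 * \<bar>\<delta>\<bar>" using F(5) yc by (intro mult_right_mono) auto
      ultimately have 2: "- (f' y * \<delta>) \<le> F1 / r^3 * \<delta>^4"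
        using abs_ge_minus_self[of "f' y * \<delta>"] by (simp add: abs_mult)
      have "r^2 \<le> \<bar>\<delta>\<bar>^2" using d r by (intro power_mono) auto
      then have "\<delta>^2 * r^2 \<le> \<delta>^2 * \<delta>^2" by (intro mult_left_mono) auto
      also have "\<dots> = \<delta>^4" by (simp add: power_add[symmetric])
      finally have "F2 * (\<delta>^2 * r^2) \<le> F2 * \<delta>^4" using F(3) by (intro mult_left_mono) auto
      then have "F2 * \<delta>^2 \<le> F2 / r^2 * \<delta>^4" using r by (simp add: field_simps)
      moreover have "- (f'' y / 2) \<le> F2" using F(3) bspec[OF F(6) yc] by linarith
      then have "- (f'' y / 2) * \<delta>^2 \<le> F2 * \<delta>^2" by (intro mult_right_mono) auto
      moreover have "(f'' y / 2 + e) * \<delta>^2 = f'' y / 2 * \<delta>^2 + e * \<delta>^2" by (simp add: algebra_simps)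
      moreover have "0 \<le> e * \<delta>^2" using ord by simp
      ultimately have 3: "- ((f'' y / 2 + e) * \<delta>^2) \<le> F2 / r^2 * \<delta>^4" by simp
      have "C * \<delta>^4 = F0 / r^4 * \<delta>^4 + F1 / r^3 * \<delta>^4 + F2 / r^2 * \<delta>^4"
        by (simp add: C_def algebra_simps)
      then show ?thesis using 0 1 2 3 nn[OF yc] by linarith
    qed
  qed
qed

lemma normal_moments:
  assumes h: "0 < h"
  defines "N \<equiv> density lborel (normal_density 0 (sqrt h))"
  shows "prob_space N" "sets N = sets borel" "\<And>k. integrable N (\<lambda>u. u ^ k)"
    "(\<integral>u. u \<partial>N) = 0" "(\<integral>u. u ^ 2 \<partial>N) = h" "(\<integral>u. u ^ 4 \<partial>N) = 3 * h ^ 2"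
proof -
  have s: "0 < sqrt h" using h by simp
  show "prob_space N" unfolding N_def by (rule prob_space_normal_density[OF s])
  show "sets N = sets borel" by (simp add: N_def)
  show "integrable N (\<lambda>u. u ^ k)" for k
    unfolding N_def using integrable_normal_moment[OF s, of 0 k]
    by (subst integrable_density) (auto simp: normal_density_nonneg)
  have I: "(\<integral>u. u ^ k \<partial>N) = (\<integral>u. normal_density 0 (sqrt h) u * (u - 0) ^ k \<partial>lborel)" for k
    unfolding N_def by (subst integral_density) (auto simp: normal_density_nonneg)
  show "(\<integral>u. u \<partial>N) = 0"
    using I[of 1] integral_normal_moment_odd[OF s, of 0 0] by simp
  show "(\<integral>u. u ^ 2 \<partial>N) = h"
    using I[of 2] integral_normal_moment_even[OF s, of 0 1] h by simp
  show "(\<integral>u. u ^ 4 \<partial>N) = 3 * h ^ 2"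
    using I[of 4] integral_normal_moment_even[OF s, of 0 2] h
    by (simp add: fact_numeral power2_eq_square field_simps)
qed

text \<open>One Euler step acts like the generator: the noise has mean 0, variance \<open>h\<close>
  and fourth moment \<open>3 * h^2\<close>, so the Taylor bound averages to
  \<open>f + h * L f\<close> up to the slack and terms of order \<open>h^2\<close>. The threshold
  \<open>h0\<close> is uniform over \<open>{a..b}\<close>.\<close>

lemma euler_drift:
  fixes f f' f'' q :: "real \<Rightarrow> real"
  assumes ord: "c < a" "a \<le> b" "b < d" "0 < e"
    and f: "\<And>y. y \<in> {c..d} \<Longrightarrow> (f has_real_derivative f' y) (at y)"
    and f': "\<And>y. y \<in> {c..d} \<Longrightarrow> (f' has_real_derivative f'' y) (at y)"
    and f'': "continuous_on {c..d} f''"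
    and nn: "\<And>y. y \<in> {c..d} \<Longrightarrow> 0 \<le> f y"
    and q: "\<And>y. \<bar>q y\<bar> \<le> Q"
  shows "\<exists>h0>0. \<forall>h\<in>{0<..<h0}. \<forall>y\<in>{a..b}.
    (\<integral>\<^sup>+ u. ennreal (f (clip c d (y - h * q y + u))) \<partial>density lborel (normal_density 0 (sqrt h)))
      \<le> ennreal (f y + h * (f'' y / 2 - q y * f' y + e))"
proof -
  \<comment> \<open>Half of the slack pays for the Taylor remainder, the other half for the terms of
    order \<open>h^2\<close>.\<close>
  define e' where "e' = e / 2"
  have e': "0 < e'" using ord by (simp add: e'_def)
  obtain C where C: "C \<ge> 0" "\<And>y \<delta>. y \<in> {a..b} \<Longrightarrow>
      f (clip c d (y + \<delta>)) \<le> f y + f' y * \<delta> + (f'' y / 2 + e') * \<delta>^2 + C * \<delta>^4"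
    using taylor_clip_bound[OF ord(1-3) e' f f' f'' nn] by blast
  have "bounded (f'' ` {c..d})"
    by (intro compact_imp_bounded compact_continuous_image f'' compact_Icc)
  then obtain F where F: "\<forall>y\<in>f'' ` {c..d}. norm y \<le> F" by (auto simp only: bounded_iff)
  \<comment> \<open>\<open>K\<close> bounds the coefficient of \<open>h^2\<close>: the squared
    drift, the fourth moment of the noise (\<open>24 = 8 * 3\<close>), and the fourth power of the
    drift, where \<open>h^4\<close> is at most \<open>h^2\<close>. The 8 is the constant in
    \<open>(u - h * p)^4 \<le> 8 * (u^4 + (h * p)^4)\<close>.\<close>
  define K where "K = (\<bar>F\<bar> + e') * Q^2 + 24 * C + 8 * C * Q^4"
  have K: "K \<ge> 0" using C e' by (auto simp: K_def)
  define h0 where "h0 = min 1 (e' / (K + 1))"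
  show ?thesis
  proof (intro exI[of _ h0] conjI ballI)
    show "0 < h0" using e' K by (simp add: h0_def)
    fix h y assume h: "h \<in> {0<..<h0}" and y: "y \<in> {a..b}"
    have h0: "0 < h" "h \<le> 1" "h * K \<le> e'"
    proof -
      show "0 < h" "h \<le> 1" using h by (auto simp: h0_def)
      have "h \<le> e' / (K + 1)" using h by (simp add: h0_def)
      then have "h * (K + 1) \<le> e'" using K by (simp add: field_simps)
      then show "h * K \<le> e'" using \<open>0 < h\<close> by (simp add: algebra_simps)
    qed
    define N where "N = density lborel (normal_density 0 (sqrt h))"
    note N = normal_moments[OF h0(1), folded N_def]
    interpret N: prob_space N by (rule N(1))
    define p where "p = q y"
    have pQ: "p^2 \<le> Q^2" "p^4 \<le> Q^4"
    proof -
      have "\<bar>p\<bar>^2 \<le> Q^2" "\<bar>p\<bar>^4 \<le> Q^4" using q[of y] by (intro power_mono; simp add: p_def)+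
      then show "p^2 \<le> Q^2" "p^4 \<le> Q^4" by simp_all
    qed
    \<comment> \<open>A polynomial in \<open>u\<close>, so that its mean is computed from moments
      alone.\<close>
    define g where "g u = f y + f' y * (u - h * p) + (f'' y / 2 + e') * (u^2 - 2 * h * p * u + h^2 * p^2)
        + 8 * C * (u^4 + h^4 * p^4)" for u
    have ptw: "f (clip c d (y - h * q y + u)) \<le> g u" for u
    proof -
      have 4: "(u - h * p)^4 \<le> 8 * (u^4 + (h * p)^4)"
      proof -
        have "(u - h * p)^2 \<le> 2 * (u^2 + (h*p)^2)"
          using zero_le_power2[of "u + h * p"] by (simp add: power2_eq_square algebra_simps)
        then have "((u - h * p)^2)^2 \<le> (2 * (u^2 + (h*p)^2))^2" by (intro power_mono) auto
        also have "\<dots> \<le> 8 * ((u^2)^2 + ((h*p)^2)^2)"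
          using zero_le_power2[of "u^2 - (h * p)^2"] unfolding power2_eq_square[of "u^2 - (h*p)^2"]
            power2_eq_square[of "2 * (u^2 + (h*p)^2)"] power2_eq_square[of "u^2"] power2_eq_square[of "(h*p)^2"]
          by (simp add: algebra_simps)
        finally show ?thesis by (simp flip: power_mult)
      qed
      have "f (clip c d (y + (u - h * p))) \<le> f y + f' y * (u - h * p) + (f'' y / 2 + e') * (u - h * p)^2 + C * (u - h * p)^4"
        by (rule C(2)[OF y])
      also have "C * (u - h * p)^4 \<le> C * (8 * (u^4 + (h * p)^4))" by (rule mult_left_mono[OF 4 C(1)])
      also have "(u - h * p)^2 = u^2 - 2 * h * p * u + h^2 * p^2" by (simp add: power2_eq_square algebra_simps)
      finally show ?thesis by (simp add: g_def p_def power_mult_distrib algebra_simps)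
    qed
    have ig: "integrable N (\<lambda>u. u)" "integrable N (\<lambda>u. u^2)" "integrable N (\<lambda>u. u^4)"
      using N(3)[of 1] N(3)[of 2] N(3)[of 4] by simp_all
    have gi: "integrable N g" unfolding g_def
      by (intro Bochner_Integration.integrable_add Bochner_Integration.integrable_diff
          integrable_mult_right ig N.integrable_const)
    have nnclip: "0 \<le> f (clip c d z)" for z using ord by (intro nn) auto
    have "(\<integral>u. g u \<partial>N) = f y - f' y * (h * p) + (f'' y / 2 + e') * (h + h^2 * p^2)
        + 8 * C * (3 * h^2 + h^4 * p^4)"
      unfolding g_def using ig N(4-6) N.prob_space
      by (simp add: Bochner_Integration.integrable_add Bochner_Integration.integrable_diff algebra_simps)
    also have "\<dots> \<le> f y + h * (f'' y / 2 - q y * f' y + e)"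
    proof -
      have "y \<in> {c..d}" using y ord by auto
      then have "\<bar>f'' y\<bar> \<le> F" using F by auto
      then have "f'' y / 2 + e' \<le> \<bar>F\<bar> + e'" by auto
      then have "(f'' y / 2 + e') * (h^2 * p^2) \<le> (\<bar>F\<bar> + e') * (h^2 * Q^2)"
        using pQ e' by (intro mult_mono mult_left_mono) auto
      moreover have "8 * C * (3 * h^2 + h^4 * p^4) \<le> 8 * C * (3 * h^2 + h^2 * Q^4)"
        using pQ C h0 power_decreasing[of 2 4 h]
        by (intro mult_left_mono add_left_mono mult_mono) auto
      ultimately have "(f'' y / 2 + e') * (h^2 * p^2) + 8 * C * (3 * h^2 + h^4 * p^4) \<le> h * (h * K)"
        by (simp add: K_def power2_eq_square algebra_simps)
      also have "\<dots> \<le> h * e'" using h0 by (intro mult_left_mono) auto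
      finally show ?thesis by (simp add: e'_def p_def algebra_simps)
    qed
    finally have G: "(\<integral>u. g u \<partial>N) \<le> f y + h * (f'' y / 2 - q y * f' y + e)" .
    have "(\<integral>\<^sup>+ u. ennreal (f (clip c d (y - h * q y + u))) \<partial>N) \<le> (\<integral>\<^sup>+ u. ennreal (g u) \<partial>N)"
      by (intro nn_integral_mono ennreal_leI ptw)
    also have "\<dots> = ennreal (\<integral>u. g u \<partial>N)"
      using ptw nnclip by (intro nn_integral_eq_integral gi AE_I2) (meson order_trans)
    also have "\<dots> \<le> ennreal (f y + h * (f'' y / 2 - q y * f' y + e))"
      by (rule ennreal_leI[OF G])
    finally show "(\<integral>\<^sup>+ u. ennreal (f (clip c d (y - h * q y + u))) \<partial>density lborel (normal_density 0 (sqrt h)))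
      \<le> ennreal (f y + h * (f'' y / 2 - q y * f' y + e))"
      by (simp add: N_def)
  qed
qed

section \<open>Pathwise convergence of the Euler scheme\<close>

primrec euler :: "(real \<Rightarrow> real) \<Rightarrow> real \<Rightarrow> real \<Rightarrow> (nat \<Rightarrow> real) \<Rightarrow> nat \<Rightarrow> real" where
  "euler q h x \<xi> 0 = x"
| "euler q h x \<xi> (Suc k) = euler q h x \<xi> k - h * q (euler q h x \<xi> k) + \<xi> k"

text \<open>
  A finite memory of the path \<open>y\<close>, updated by \<open>J\<close>. The initial value \<open>y 0\<close> is not inspected.
\<close>

primrec stage :: "(nat \<Rightarrow> real \<Rightarrow> nat) \<Rightarrow> (nat \<Rightarrow> real) \<Rightarrow> nat \<Rightarrow> nat" where
  "stage J y 0 = 0"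
| "stage J y (Suc k) = J (stage J y k) (y (Suc k))"

text \<open>The memory depends on the whole past of the scheme; carried along as a component of the
  state, it becomes part of a Markov chain.\<close>

lemma chain_stage_euler:
  "chain (\<lambda>(i, y) u. (J i (y - h * q y + u), y - h * q y + u)) (0, x) \<xi> k
     = (stage J (euler q h x \<xi>) k, euler q h x \<xi> k)"
  by (induction k) auto

text \<open>The noise is the same in the solution and in the scheme, so it cancels in their
  difference; what remains is the drift error, controlled by the modulus of continuity of
  \<open>X\<close>. The equation is required only up to \<open>r\<close>, since a path may later
  leave the region where the clipped drift is the true one, while the grid still divides
  \<open>{0..t}\<close>.\<close>

lemma euler_converges:
  fixes q b X :: "real \<Rightarrow> real"
  assumes t: "0 < t" and r: "0 \<le> r" "r \<le> t" and X: "continuous_on {0..t} X" and b0: "b 0 = 0"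
    and eq: "\<And>u. u \<in> {0..r} \<Longrightarrow> X u = x + b u - integral {0..u} (\<lambda>v. q (X v))"
    and lip: "0 \<le> L" "\<And>y z. \<bar>q y - q z\<bar> \<le> L * \<bar>y - z\<bar>" and e: "0 < e"
  shows "\<exists>N. \<forall>n\<ge>N. \<forall>k\<le>n. real k * t / real n \<le> r \<longrightarrow>
    \<bar>X (real k * t / real n) - euler q (t / real n) x (\<lambda>i. b (real (Suc i) * t / real n) - b (real i * t / real n)) k\<bar> \<le> e"
proof -
  \<comment> \<open>The discrete Gronwall estimate multiplies the modulus \<open>w\<close> by at
    most \<open>exp (L * t)\<close>.\<close>
  define w where "w = e / exp (L * t)"
  have w: "0 < w" using e by (simp add: w_def)
  have "uniformly_continuous_on {0..t} X"
    by (rule compact_uniformly_continuous[OF X compact_Icc])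
  then obtain d where d: "d > 0" "\<And>u v. u \<in> {0..t} \<Longrightarrow> v \<in> {0..t} \<Longrightarrow> \<bar>u - v\<bar> < d \<Longrightarrow> \<bar>X u - X v\<bar> < w"
    unfolding uniformly_continuous_on_def dist_real_def using w by metis
  have "continuous_on UNIV q"
  proof (rule continuous_at_imp_continuous_on, intro ballI)
    fix y
    have "((\<lambda>z. L * \<bar>z - y\<bar>) \<longlongrightarrow> L * \<bar>y - y\<bar>) (at y)" by (intro tendsto_intros)
    then have "((\<lambda>z. q z - q y) \<longlongrightarrow> 0) (at y)"
      by (intro Lim_null_comparison[of "\<lambda>z. q z - q y" "\<lambda>z. L * \<bar>z - y\<bar>"]) (use lip in auto)
    then show "isCont q y" by (simp add: isCont_def LIM_zero_iff)
  qed
  then have qX: "continuous_on {0..t} (\<lambda>v. q (X v))"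
    by (rule continuous_on_compose2[OF _ X]) auto
  obtain N :: nat where N: "t / d < real N" using reals_Archimedean2 by blast
  have N0: "0 < real N" using N t d(1) by (smt (verit) divide_pos_pos)
  show ?thesis
  proof (intro exI[of _ N] allI impI)
    fix n k :: nat
    assume n: "N \<le> n" and k: "k \<le> n" "real k * t / real n \<le> r"
    define h where "h = t / real n"
    have n0: "0 < real n" using N0 n by linarith
    have h: "0 < h" "h < d"
    proof -
      show "0 < h" using t n0 by (simp add: h_def)
      have "t / d < real n" using N n by linarith
      then show "h < d" using n0 d(1) by (simp add: h_def field_simps)
    qed
    have nh: "real j * t / real n = real j * h" for j by (simp add: h_def)
    define Y where "Y = euler q h x (\<lambda>i. b (real (Suc i) * h) - b (real i * h))"
    \<comment> \<open>The right-hand side solves the error recursion: it starts at 0, and each step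
      multiplies it by \<open>1 + L * h\<close> and adds \<open>L * h * w\<close>.\<close>
    have "\<bar>X (real k * h) - Y k\<bar> \<le> ((1 + L * h)^k - 1) * w" if "real k * h \<le> r" for k
      using that
    proof (induction k)
      case 0
      have "X 0 = x" using eq[of 0] r b0 by simp
      then show ?case by (simp add: Y_def)
    next
      case (Suc k)
      define s where "s = real k * h"
      have s: "0 \<le> s" "real (Suc k) * h = s + h" using h by (auto simp: s_def algebra_simps)
      have sr: "s + h \<le> r" using Suc.prems s by simp
      have IH: "\<bar>X s - Y k\<bar> \<le> ((1 + L * h)^k - 1) * w"
        using Suc.IH sr h by (simp add: s_def)
      have int: "(\<lambda>v. q (X v)) integrable_on {0..s + h}"
        by (intro integrable_continuous_real continuous_on_subset[OF qX]) (use sr r in auto)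
      have "integral {0..s+h} (\<lambda>v. q (X v)) = integral {0..s} (\<lambda>v. q (X v)) + integral {s..s+h} (\<lambda>v. q (X v))"
        using Henstock_Kurzweil_Integration.integral_combine[OF _ _ int, of s] s h by simp
      then have X1: "X (s + h) = X s + b (s + h) - b s - integral {s..s+h} (\<lambda>v. q (X v))"
        using eq[of s] eq[of "s + h"] s sr h by simp
      have Y1: "Y (Suc k) = Y k - h * q (Y k) + (b (s + h) - b s)"
        using s(2) by (simp add: Y_def s_def)
      have cs: "continuous_on {s..s+h} (\<lambda>v. q (X v))"
        by (rule continuous_on_subset[OF qX]) (use s sr r in auto)
      have "norm (integral {s..s+h} (\<lambda>v. q (X v) - q (Y k))) \<le> (L * (w + \<bar>X s - Y k\<bar>)) * (s + h - s)"
      proof (rule integral_bound)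
        fix v assume v: "v \<in> {s..s+h}"
        have "\<bar>X v - X s\<bar> < w" using v s sr r h by (intro d(2)) auto
        then have "\<bar>X v - Y k\<bar> \<le> w + \<bar>X s - Y k\<bar>" by linarith
        then have "L * \<bar>X v - Y k\<bar> \<le> L * (w + \<bar>X s - Y k\<bar>)" using lip(1) by (intro mult_left_mono)
        then show "norm (q (X v) - q (Y k)) \<le> L * (w + \<bar>X s - Y k\<bar>)" using lip(2)[of "X v" "Y k"] by simp
      qed (use h in \<open>auto intro!: continuous_intros cs\<close>)
      moreover have "integral {s..s+h} (\<lambda>v. q (X v) - q (Y k)) = integral {s..s+h} (\<lambda>v. q (X v)) - h * q (Y k)"
        using h integrable_continuous_real[OF cs] by (subst integral_diff) auto
      ultimately have "\<bar>X (s + h) - Y (Suc k)\<bar> \<le> \<bar>X s - Y k\<bar> + (L * (w + \<bar>X s - Y k\<bar>)) * h"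
        using X1 Y1 by simp
      also have "\<dots> = (1 + L * h) * \<bar>X s - Y k\<bar> + L * h * w" by (simp add: algebra_simps)
      also have "\<dots> \<le> (1 + L * h) * (((1 + L * h)^k - 1) * w) + L * h * w"
        using lip(1) h IH by (intro add_right_mono mult_left_mono) auto
      also have "\<dots> = ((1 + L * h)^Suc k - 1) * w" by (simp add: algebra_simps)
      finally show ?case using s(2) by simp
    qed
    from this[of k] have 1: "\<bar>X (real k * h) - Y k\<bar> \<le> ((1 + L * h)^k - 1) * w" using k(2) nh by simp
    have "(1 + L * h)^k \<le> exp (L * h)^k" using lip(1) h by (intro power_mono) auto
    also have "\<dots> = exp (L * (real k * h))" by (simp add: exp_of_nat_mult[symmetric] algebra_simps)
    also have "\<dots> \<le> exp (L * t)" using k(2) r lip(1) nh by (auto intro!: mult_left_mono)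
    finally have "((1 + L * h)^k - 1) * w \<le> exp (L * t) * w" using w by (intro mult_right_mono) auto
    also have "\<dots> = e" by (simp add: w_def)
    finally show "\<bar>X (real k * t / real n) - euler q (t / real n) x (\<lambda>i. b (real (Suc i) * t / real n) - b (real i * t / real n)) k\<bar> \<le> e"
      using 1 unfolding nh h_def[symmetric] Y_def by linarith
  qed
qed

section \<open>Outer probability bounds\<close>

text \<open>
  \<open>M\<close> need not be complete, so path events that involve uncountably many times are only bounded
  through measurable supersets.
\<close>

definition (in prob_space) outer_le :: "('a \<Rightarrow> bool) \<Rightarrow> real \<Rightarrow> bool" where
  "outer_le P p \<longleftrightarrow> (\<exists>A\<in>events. prob A \<le> p \<and> (AE \<omega> in M. P \<omega> \<longrightarrow> \<omega> \<in> A))"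

context prob_space
begin

lemma outer_le_mono:
  assumes "outer_le P p" "AE \<omega> in M. Q \<omega> \<longrightarrow> P \<omega>" "p \<le> p'"
  shows "outer_le Q p'"
proof -
  obtain A where A: "A \<in> events" "prob A \<le> p" "AE \<omega> in M. P \<omega> \<longrightarrow> \<omega> \<in> A"
    using assms(1) unfolding outer_le_def by blast
  have "AE \<omega> in M. Q \<omega> \<longrightarrow> \<omega> \<in> A" using A(3) assms(2) by eventually_elim auto
  then show ?thesis unfolding outer_le_def using A assms(3) by (meson order_trans)
qed

text \<open>Fatou's lemma for events: the tail intersections of the covers increase, each has
  probability at most \<open>p\<close>, and continuity from below passes this on to their union,
  which covers \<open>Q\<close> almost surely. Every removal of a cutoff below is an
  instance.\<close>

lemma outer_le_liminf:
  fixes P :: "nat \<Rightarrow> 'a \<Rightarrow> bool"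
  assumes P: "\<And>n. n \<ge> N \<Longrightarrow> outer_le (P n) p"
    and Q: "AE \<omega> in M. Q \<omega> \<longrightarrow> (\<exists>m. \<forall>n\<ge>m. P n \<omega>)"
  shows "outer_le Q p"
proof -
  have "\<forall>n. \<exists>A. A \<in> events \<and> prob A \<le> p \<and> (AE \<omega> in M. P (n + N) \<omega> \<longrightarrow> \<omega> \<in> A)"
    using P unfolding outer_le_def by (metis le_add2)
  then obtain A where A: "\<And>n. A n \<in> events" "\<And>n. prob (A n) \<le> p"
      "\<And>n. AE \<omega> in M. P (n + N) \<omega> \<longrightarrow> \<omega> \<in> A n"
    by metis
  define B where "B m = (\<Inter>n\<in>{m..}. A n)" for m
  have B: "B m \<in> events" for m unfolding B_def using A(1) by (intro sets.countable_INT) auto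
  have inc: "incseq B" unfolding B_def incseq_def by (auto intro: order_trans)
  have "prob (B m) \<le> p" for m
  proof -
    have "prob (B m) \<le> prob (A m)" by (intro finite_measure_mono A(1)) (auto simp: B_def)
    then show ?thesis using A(2)[of m] by linarith
  qed
  moreover have "(\<lambda>m. prob (B m)) \<longlonglongrightarrow> prob (\<Union>m. B m)"
    using B by (intro finite_Lim_measure_incseq inc) auto
  ultimately have "prob (\<Union>m. B m) \<le> p" by (intro LIMSEQ_le_const2[of "\<lambda>m. prob (B m)"]) auto
  moreover have "AE \<omega> in M. \<forall>n. P (n + N) \<omega> \<longrightarrow> \<omega> \<in> A n"
    by (intro AE_all_countable[THEN iffD2] allI A(3))
  then have "AE \<omega> in M. Q \<omega> \<longrightarrow> \<omega> \<in> (\<Union>m. B m)"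
    using Q
  proof eventually_elim
    case (elim \<omega>)
    show ?case
    proof
      assume "Q \<omega>"
      then obtain m where "\<And>n. n \<ge> m \<Longrightarrow> P n \<omega>" using elim by blast
      then have "\<omega> \<in> B m" using elim by (auto simp: B_def)
      then show "\<omega> \<in> (\<Union>m. B m)" by blast
    qed
  qed
  ultimately show ?thesis unfolding outer_le_def using B by blast
qed

lemma outer_le_zero:
  assumes "\<And>p. p > 0 \<Longrightarrow> outer_le Q p"
  shows "AE \<omega> in M. \<not> Q \<omega>"
proof -
  have "\<forall>n::nat. \<exists>A. A \<in> events \<and> prob A \<le> inverse (real (Suc n)) \<and> (AE \<omega> in M. Q \<omega> \<longrightarrow> \<omega> \<in> A)"
    using assms unfolding outer_le_def
    by (metis inverse_positive_iff_positive of_nat_0_less_iff zero_less_Suc)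
  then obtain A where A: "\<And>n::nat. A n \<in> events" "\<And>n. prob (A n) \<le> inverse (real (Suc n))"
      "\<And>n. AE \<omega> in M. Q \<omega> \<longrightarrow> \<omega> \<in> A n"
    by metis
  have ev: "(\<Inter>n. A n) \<in> events" using A(1) by (intro sets.countable_INT) auto
  have "prob (\<Inter>n. A n) \<le> inverse (real (Suc n))" for n
    using A(2)[of n] finite_measure_mono[OF _ A(1)[of n], of "\<Inter>n. A n"] by fastforce
  then have "prob (\<Inter>n. A n) \<le> 0"
    by (intro LIMSEQ_le_const[OF LIMSEQ_inverse_real_of_nat]) auto
  then have "(\<Inter>n. A n) \<in> null_sets M" using ev
    by (auto simp: null_sets_def emeasure_eq_measure measure_le_0_iff)
  then have "AE \<omega> in M. \<omega> \<notin> (\<Inter>n. A n)" by (rule AE_not_in)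
  moreover have "AE \<omega> in M. \<forall>n. Q \<omega> \<longrightarrow> \<omega> \<in> A n"
    by (intro AE_all_countable[THEN iffD2] allI A(3))
  ultimately show ?thesis by eventually_elim auto
qed

end

section \<open>Brownian increments and stage probabilities\<close>

lemma brownian_increments:
  assumes BM: "brownian_motion M B" and t: "0 < t" and n: "0 < n"
  shows "prob_space.indep_vars M (\<lambda>_. borel) (\<lambda>i \<omega>. B (real (Suc i) * t / real n) \<omega> - B (real i * t / real n) \<omega>) {..<n}"
    and "distr M borel (\<lambda>\<omega>. B (real (Suc k) * t / real n) \<omega> - B (real k * t / real n) \<omega>)
      = density lborel (normal_density 0 (sqrt (t / real n)))"
proof -
  have "\<forall>(ts::nat \<Rightarrow> real) n. 0 \<le> ts 0 \<and> (\<forall>i<n. ts i \<le> ts (Suc i)) \<longrightarrow>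
        prob_space.indep_vars M (\<lambda>_. borel) (\<lambda>i \<omega>. B (ts (Suc i)) \<omega> - B (ts i) \<omega>) {..<n}"
    using BM unfolding brownian_motion_def by blast
  from this[rule_format, where ts="\<lambda>i. real i * t / real n"]
  show "prob_space.indep_vars M (\<lambda>_. borel) (\<lambda>i \<omega>. B (real (Suc i) * t / real n) \<omega> - B (real i * t / real n) \<omega>) {..<n}"
    using t n by (auto simp: field_simps)
  have "distributed M lborel (\<lambda>\<omega>. B (real (Suc k) * t / real n) \<omega> - B (real k * t / real n) \<omega>)
      (normal_density 0 (sqrt (real (Suc k) * t / real n - real k * t / real n)))"
  proof -
    have "\<forall>s t. 0 \<le> s \<and> s < t \<longrightarrow>
        distributed M lborel (\<lambda>\<omega>. B t \<omega> - B s \<omega>) (normal_density 0 (sqrt (t - s)))"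
      using BM unfolding brownian_motion_def by blast
    moreover have "0 \<le> real k * t / real n" "real k * t / real n < real (Suc k) * t / real n"
      using t n by (auto intro!: divide_strict_right_mono)
    ultimately show ?thesis by blast
  qed
  moreover have "real (Suc k) * t / real n - real k * t / real n = t / real n"
    by (simp add: add_divide_distrib distrib_right)
  ultimately have "distr M lborel (\<lambda>\<omega>. B (real (Suc k) * t / real n) \<omega> - B (real k * t / real n) \<omega>)
      = density lborel (normal_density 0 (sqrt (t / real n)))"
    by (simp only: distributed_distr_eq_density)
  moreover have "distr M borel Y = distr M lborel Y" for Y :: "'a \<Rightarrow> real"
    by (rule distr_cong) simp_all
  ultimately show "distr M borel (\<lambda>\<omega>. B (real (Suc k) * t / real n) \<omega> - B (real k * t / real n) \<omega>)
      = density lborel (normal_density 0 (sqrt (t / real n)))" by (simp only:)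
qed

text \<open>Markov's inequality at the last step: a supermartingale that starts with at most
  \<open>C\<close> and is at least \<open>c\<close> whenever the final stage is \<open>i\<close>
  bounds the probability of that stage by \<open>C / c\<close>. Since \<open>v\<close> may be chosen
  separately on each stage, it can encode stopping.\<close>

lemma euler_stage_prob:
  fixes q :: "real \<Rightarrow> real" and v :: "nat \<Rightarrow> nat \<Rightarrow> real \<Rightarrow> ennreal"
  assumes BM: "brownian_motion M B" and t: "0 < t" and n: "0 < n"
    and q: "q \<in> borel_measurable borel" and J: "\<And>i. J i \<in> borel \<rightarrow>\<^sub>M count_space UNIV"
    and v: "\<And>k i. v k i \<in> borel_measurable borel"
    and step: "\<And>k i y. k < n \<Longrightarrow>
      (\<integral>\<^sup>+ u. v (Suc k) (J i (y - t / real n * q y + u)) (y - t / real n * q y + u)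
         \<partial>density lborel (normal_density 0 (sqrt (t / real n)))) \<le> v k i y"
    and init: "v 0 0 x \<le> ennreal C" "0 \<le> C" and final: "\<And>y. ennreal c \<le> v n i y" "0 < c"
  defines "A \<equiv> {\<omega>\<in>space M. stage J (euler q (t / real n) x
      (\<lambda>i. B (real (Suc i) * t / real n) \<omega> - B (real i * t / real n) \<omega>)) n = i}"
  shows "A \<in> sets M \<and> measure M A \<le> C / c"
proof -
  interpret prob_space M using BM by (simp add: brownian_motion_def)
  define h where "h = t / real n"
  define \<xi> where "\<xi> i \<omega> = B (real (Suc i) * t / real n) \<omega> - B (real i * t / real n) \<omega>" for i \<omega>
  define S where "S = count_space (UNIV :: nat set) \<Otimes>\<^sub>M (borel :: real measure)"
  define \<Phi> where "\<Phi> = (\<lambda>(i, y) u. (J i (y - h * q y + u), y - h * q y + u))"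
  have [measurable]: "q \<in> borel_measurable borel" by (rule q)
  have J': "(\<lambda>(i, y). J i y) \<in> S \<rightarrow>\<^sub>M count_space UNIV"
    unfolding S_def by (rule measurable_pair_measure_countable1) (simp_all add: J)
  have y: "(\<lambda>z. snd (fst z) - h * q (snd (fst z)) + snd z) \<in> borel_measurable (S \<Otimes>\<^sub>M borel)"
    unfolding S_def by measurable
  have "(\<lambda>z. (fst (fst z), snd (fst z) - h * q (snd (fst z)) + snd z)) \<in> S \<Otimes>\<^sub>M borel \<rightarrow>\<^sub>M S"
    unfolding S_def by measurable
  from measurable_compose[OF this J']
  have "(\<lambda>z. J (fst (fst z)) (snd (fst z) - h * q (snd (fst z)) + snd z)) \<in> S \<Otimes>\<^sub>M borel \<rightarrow>\<^sub>M count_space UNIV"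
    by simp
  from measurable_Pair[OF this y]
  have \<Phi>: "(\<lambda>(s, u). \<Phi> s u) \<in> S \<Otimes>\<^sub>M borel \<rightarrow>\<^sub>M S"
    by (simp add: \<Phi>_def case_prod_unfold S_def)
  have s: "(0, x) \<in> space S" by (simp add: S_def space_pair_measure)
  have v': "(\<lambda>(i, y). v k i y) \<in> borel_measurable S" for k
    unfolding S_def by (rule measurable_pair_measure_countable1) (simp_all add: v)
  note inc = brownian_increments[OF BM t n]
  have chain: "chain \<Phi> (0, x) (\<lambda>i. \<xi> i \<omega>) n = (stage J (euler q h x (\<lambda>i. \<xi> i \<omega>)) n, euler q h x (\<lambda>i. \<xi> i \<omega>) n)" for \<omega>
    unfolding \<Phi>_def by (rule chain_stage_euler)
  have A: "A = {\<omega>\<in>space M. fst (chain \<Phi> (0, x) (\<lambda>i. \<xi> i \<omega>) n) = i}"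
    unfolding chain A_def by (simp add: \<xi>_def h_def)
  have ind: "indep_vars (\<lambda>_. borel) \<xi> {..<n}" using inc(1) by (simp add: \<xi>_def[abs_def])
  have "(\<lambda>\<omega>. restrict (\<lambda>i. \<xi> i \<omega>) {..<n}) \<in> M \<rightarrow>\<^sub>M PiM {..<n} (\<lambda>_. borel)"
    using ind unfolding indep_vars_def by (intro measurable_restrict) auto
  from measurable_compose[OF this chain_measurable_PiM[OF \<Phi> s order_refl]]
  have "(\<lambda>\<omega>. chain \<Phi> (0, x) (\<lambda>i. \<xi> i \<omega>) n) \<in> M \<rightarrow>\<^sub>M S"
    by (rule measurable_cong[THEN iffD1, rotated]) (rule chain_cong, simp)
  then have "(\<lambda>\<omega>. fst (chain \<Phi> (0, x) (\<lambda>i. \<xi> i \<omega>) n)) \<in> M \<rightarrow>\<^sub>M count_space UNIV"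
    unfolding S_def by (rule measurable_compose[OF _ measurable_fst])
  from measurable_sets[OF this, of "{i}"] have ev: "A \<in> sets M"
    unfolding A by (simp add: vimage_def Int_def conj_commute)
  then have "ennreal c * emeasure M A = (\<integral>\<^sup>+ \<omega>. ennreal c * indicator A \<omega> \<partial>M)"
    by (simp add: nn_integral_cmult_indicator)
  also have "\<dots> \<le> (\<integral>\<^sup>+ \<omega>. (\<lambda>(i, y). v n i y) (chain \<Phi> (0, x) (\<lambda>i. \<xi> i \<omega>) n) \<partial>M)"
    unfolding A by (intro nn_integral_mono) (auto simp: indicator_def case_prod_unfold final(1))
  also have "\<dots> \<le> (\<lambda>(i, y). v 0 i y) (0, x)"
  proof (rule chain_supermartingale[OF \<Phi> s ind _ v'])
    show "distr M borel (\<xi> k) = density lborel (normal_density 0 (sqrt h))" for k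
      using inc(2)[of k] by (simp add: \<xi>_def[abs_def] h_def)
    show "(\<integral>\<^sup>+ u. (\<lambda>(i, y). v (Suc k) i y) (\<Phi> s u) \<partial>density lborel (normal_density 0 (sqrt h)))
        \<le> (\<lambda>(i, y). v k i y) s" if "k < n" for k s
      using step[OF that, where y="snd s" and i="fst s"] by (simp add: \<Phi>_def h_def case_prod_unfold)
  qed simp
  also have "\<dots> \<le> ennreal C" using init(1) by simp
  finally have "ennreal (c * measure M A) \<le> ennreal C"
    using final(2) by (simp add: emeasure_eq_measure ennreal_mult)
  then have "c * measure M A \<le> C" using init(2) by (simp add: ennreal_le_iff)
  then show ?thesis using final(2) ev by (simp add: field_simps)
qed

section \<open>Staying and climbing probabilities\<close>

lemma mono_of_deriv:
  fixes f f' :: "real \<Rightarrow> real"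
  assumes "\<And>x. 0 < x \<Longrightarrow> (f has_real_derivative f' x) (at x)" "\<And>x. 0 < x \<Longrightarrow> 0 \<le> f' x"
    and "0 < x" "x \<le> y"
  shows "f x \<le> f y"
proof (rule DERIV_nonneg_imp_nondecreasing[OF assms(4)])
  fix w assume "x \<le> w" "w \<le> y"
  then show "\<exists>d. (f has_real_derivative d) (at w) \<and> 0 \<le> d"
    using assms(1)[of w] assms(2)[of w] assms(3) by (intro exI[of _ "f' w"]) auto
qed

text \<open>The scheme may jump out of the half-line, and \<open>euler_converges\<close> wants a
  global Lipschitz constant. Freezing \<open>q\<close> outside \<open>{c..d}\<close> serves both and
  does not affect a solution while it stays in \<open>{c..d}\<close>.\<close>

lemma clipped_drift:
  assumes C1: "C1_on_nonneg q" and cd: "0 \<le> c" "c \<le> d"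
  shows "\<exists>L Q. 0 \<le> L \<and> (\<forall>y z. \<bar>q (clip c d y) - q (clip c d z)\<bar> \<le> L * \<bar>y - z\<bar>) \<and> (\<forall>y. \<bar>q (clip c d y)\<bar> \<le> Q)"
    and "(\<lambda>y. q (clip c d y)) \<in> borel_measurable borel"
proof -
  have clip: "clip c d y \<in> {c..d}" "clip c d y \<in> {0..}" for y using cd by auto
  obtain L where L: "L \<ge> 0" "\<forall>x\<in>{c..d}. \<forall>y\<in>{c..d}. \<bar>q x - q y\<bar> \<le> L * \<bar>x - y\<bar>"
    using C1_on_nonneg_lipschitz[OF C1 cd(1)] by blast
  have "\<bar>q (clip c d y) - q (clip c d z)\<bar> \<le> L * \<bar>y - z\<bar>" for y z
  proof -
    have "\<bar>q (clip c d y) - q (clip c d z)\<bar> \<le> L * \<bar>clip c d y - clip c d z\<bar>"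
      using L(2) clip(1) by blast
    also have "\<dots> \<le> L * \<bar>y - z\<bar>" using L(1) by (intro mult_left_mono) auto
    finally show ?thesis .
  qed
  moreover have "\<bar>q (clip c d y)\<bar> \<le> \<bar>q c\<bar> + L * (d - c)" for y
  proof -
    have "c \<in> {c..d}" using cd by auto
    then have "\<bar>q (clip c d y) - q c\<bar> \<le> L * \<bar>clip c d y - c\<bar>"
      using L(2) clip(1)[of y] by blast
    also have "\<dots> \<le> L * (d - c)" using L(1) clip(1)[of y] by (intro mult_left_mono) auto
    finally show ?thesis by linarith
  qed
  ultimately show "\<exists>L Q. 0 \<le> L \<and> (\<forall>y z. \<bar>q (clip c d y) - q (clip c d z)\<bar> \<le> L * \<bar>y - z\<bar>) \<and> (\<forall>y. \<bar>q (clip c d y)\<bar> \<le> Q)"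
    using L(1) by blast
  have "continuous_on UNIV (\<lambda>y. q (clip c d y))"
    by (rule continuous_on_compose2[OF C1_on_nonneg_continuous[OF C1]])
      (use clip in \<open>auto intro!: continuous_intros\<close>)
  then show "(\<lambda>y. q (clip c d y)) \<in> borel_measurable borel"
    by (rule borel_measurable_continuous_onI)
qed

lemma clip_measurable:
  fixes f :: "real \<Rightarrow> real"
  assumes "continuous_on {c..d} f" "c \<le> d"
  shows "(\<lambda>y. f (clip c d y)) \<in> borel_measurable borel"
  by (intro borel_measurable_continuous_onI continuous_on_compose2[OF assms(1)])
    (use assms(2) in \<open>auto intro!: continuous_intros\<close>)

lemma stopped_solutionD:
  assumes "stopped_solution q b x X"
  shows "X 0 = x" "continuous_on {0..} X"
    "\<And>t. 0 \<le> t \<Longrightarrow> (\<And>u. u \<in> {0..t} \<Longrightarrow> 0 < X u) \<Longrightarrow> X t = x + b t - integral {0..t} (\<lambda>u. q (X u))"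
    "\<And>t u. 0 \<le> t \<Longrightarrow> X t = 0 \<Longrightarrow> t \<le> u \<Longrightarrow> X u = 0"
  using assms unfolding stopped_solution_def by blast+

lemma stopped_solution_clip:
  assumes sol: "stopped_solution q b x X" and cd: "0 < c" and u: "u \<in> {0..r}"
    and rng: "\<And>v. v \<in> {0..r} \<Longrightarrow> c \<le> X v \<and> X v \<le> d"
  shows "X u = x + b u - integral {0..u} (\<lambda>v. q (clip c d (X v)))"
proof -
  have rng': "c \<le> X v" "X v \<le> d" if "v \<in> {0..u}" for v using rng[of v] that u by auto
  have "X u = x + b u - integral {0..u} (\<lambda>v. q (X v))"
    by (rule stopped_solutionD(3)[OF sol]) (use u rng'(1) cd in \<open>auto intro: less_le_trans\<close>)
  also have "integral {0..u} (\<lambda>v. q (X v)) = integral {0..u} (\<lambda>v. q (clip c d (X v)))"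
  proof (rule integral_cong)
    fix v assume "v \<in> {0..u}"
    then have "clip c d (X v) = X v" using rng'[of v] by auto
    then show "q (X v) = q (clip c d (X v))" by simp
  qed
  finally show ?thesis .
qed

section \<open>Staying in a strip\<close>

lemma stage_stay:
  assumes "\<And>j. j \<le> n \<Longrightarrow> y j \<in> {a..b}"
  shows "stage (\<lambda>i y. if i = 0 \<and> y \<in> {a..b} then 0 else 1) y n = 0"
  using assms by (induction n) auto

text \<open>The function \<open>V\<close>, weighted by \<open>exp (k0 * real k * h)\<close>, is a
  supermartingale as long as the scheme stays in \<open>{a..b}\<close>. As \<open>V\<close> lies
  between \<open>m\<close> and \<open>2 * m\<close>, the bound contains neither \<open>K\<close> nor
  \<open>x\<close>, so the cutoff \<open>K\<close> can be removed later.\<close>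

lemma stay_probability:
  fixes U U' q :: "real \<Rightarrow> real"
  assumes BM: "brownian_motion M B" and C1: "C1_on_nonneg q"
    and U: "\<And>x. 0 < x \<Longrightarrow> (U has_real_derivative U' x) (at x)"
    and U': "\<And>x. 0 < x \<Longrightarrow> (U' has_real_derivative 2 * q x * U' x - 2) (at x)"
    and U'_pos: "\<And>x. 0 < x \<Longrightarrow> 0 < U' x" and S: "\<And>x. 0 < x \<Longrightarrow> U x < S"
    and z: "0 < z" and t: "0 < t"
    and sol: "AE \<omega> in M. stopped_solution q (\<lambda>t. B t \<omega>) x (\<lambda>t. X t \<omega>)"
  shows "prob_space.outer_le M (\<lambda>\<omega>. \<forall>u\<in>{0..t}. z \<le> X u \<omega> \<and> X u \<omega> \<le> K) (2 * exp (- t / (4 * (S - U (z / 2)))))"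
proof -
  interpret prob_space M using BM by (simp add: brownian_motion_def)
  define m where "m = S - U (z / 2)"
  have m: "0 < m" using S[of "z/2"] z by (simp add: m_def)
  show ?thesis
  proof (cases "z \<le> x \<and> x \<le> K")
    case False
    have "AE \<omega> in M. (\<forall>u\<in>{0..t}. z \<le> X u \<omega> \<and> X u \<omega> \<le> K) \<longrightarrow> \<omega> \<in> {}"
      using sol
    proof eventually_elim
      case (elim \<omega>)
      then have "X 0 \<omega> = x" by (simp add: stopped_solution_def)
      then show ?case using False t by force
    qed
    then show ?thesis unfolding outer_le_def by (intro bexI[of _ "{}"]) auto
  next
    case True
    \<comment> \<open>Two margins: a solution in \<open>{z..K}\<close> keeps the scheme in
      \<open>{a..b}\<close>, because they eventually differ by at most \<open>min (z / 4) 1\<close>;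
      and \<open>{c..d}\<close> surrounds \<open>{a..b}\<close> strictly, as the drift estimate
      demands.\<close>
    define a where "a = 3 * z / 4"
    define b where "b = K + 1"
    define c where "c = z / 2"
    define d where "d = K + 2"
    have ord: "0 < c" "c < a" "a < z" "z \<le> K" "a \<le> b" "b < d" "c \<le> d"
      using z True by (auto simp: a_def b_def c_def d_def)
    \<comment> \<open>\<open>L V = -1 \<le> - V / (2 * m)\<close> on \<open>{c..d}\<close>, whence exponential decay; half of the rate is given up to the discretisation error.\<close>
    define V where "V y = U y - U (z / 2) + m" for y
    define qc where "qc y = q (clip c d y)" for y
    obtain L Q where LQ: "0 \<le> L" "\<And>y z. \<bar>qc y - qc z\<bar> \<le> L * \<bar>y - z\<bar>" "\<And>y. \<bar>qc y\<bar> \<le> Q"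
      using clipped_drift(1)[OF C1 less_imp_le[OF ord(1)] ord(7)] unfolding qc_def by blast
    have qm: "qc \<in> borel_measurable borel"
      unfolding qc_def[abs_def] by (rule clipped_drift(2)[OF C1 less_imp_le[OF ord(1)] ord(7)])
    have mono: "U x \<le> U y" if "0 < x" "x \<le> y" for x y
      by (rule mono_of_deriv[OF U less_imp_le[OF U'_pos] that])
    have V: "m \<le> V y" "V y \<le> 2 * m" if "c \<le> y" for y
      using mono[of c y] S[of y] that ord(1) by (auto simp: V_def m_def c_def)
    have dV: "(V has_real_derivative U' y) (at y)" if "y \<in> {c..d}" for y
      unfolding V_def using U[of y] that ord(1) by (auto intro!: derivative_eq_intros)
    have dV': "(U' has_real_derivative 2 * q y * U' y - 2) (at y)" if "y \<in> {c..d}" for y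
      using U'[of y] that ord(1) by auto
    have cU': "continuous_on {c..d} U'"
      by (intro continuous_at_imp_continuous_on ballI) (erule DERIV_isCont[OF dV'])
    have cV: "continuous_on {c..d} V"
      by (intro continuous_at_imp_continuous_on ballI) (erule DERIV_isCont[OF dV])
    have cq: "continuous_on {c..d} q"
      by (rule continuous_on_subset[OF C1_on_nonneg_continuous[OF C1]]) (use ord in auto)
    have half: "(0::real) < 1/2" by simp
    have "\<exists>h0>0. \<forall>h\<in>{0<..<h0}. \<forall>y\<in>{a..b}.
      (\<integral>\<^sup>+ u. ennreal (V (clip c d (y - h * qc y + u))) \<partial>density lborel (normal_density 0 (sqrt h)))
      \<le> ennreal (V y + h * ((2 * q y * U' y - 2) / 2 - qc y * U' y + 1/2))"
    proof (rule euler_drift[OF ord(2,5,6) half dV dV' _ _ LQ(3)])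
      show "continuous_on {c..d} (\<lambda>y. 2 * q y * U' y - 2)" by (intro continuous_intros cq cU')
      show "0 \<le> V y" if "y \<in> {c..d}" for y using V(1)[of y] m that by auto
    qed
    then obtain h0 where h0: "0 < h0" "\<And>h y. 0 < h \<Longrightarrow> h < h0 \<Longrightarrow> y \<in> {a..b} \<Longrightarrow>
      (\<integral>\<^sup>+ u. ennreal (V (clip c d (y - h * qc y + u))) \<partial>density lborel (normal_density 0 (sqrt h)))
      \<le> ennreal (V y + h * ((2 * q y * U' y - 2) / 2 - qc y * U' y + 1/2))"
      by (metis greaterThanLessThan_iff)
    define J :: "nat \<Rightarrow> real \<Rightarrow> nat" where "J = (\<lambda>i y. if i = 0 \<and> y \<in> {a..b} then 0 else 1)"
    define k0 where "k0 = 1 / (4 * m)"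
    define p where "p = 2 * exp (- t / (4 * m))"
    define A where "A n = {\<omega>\<in>space M. stage J (euler qc (t / real n) x
        (\<lambda>i. B (real (Suc i) * t / real n) \<omega> - B (real i * t / real n) \<omega>)) n = 0}" for n
    obtain N :: nat where N: "t / h0 < real N" using reals_Archimedean2 by blast
    have N0: "0 < real N" using N t h0(1) by (smt (verit) divide_pos_pos)
    have An: "A n \<in> sets M \<and> measure M (A n) \<le> p" if n: "n \<ge> N" for n
    proof -
      have n0: "0 < n" using n N0 by simp
      define h where "h = t / real n"
      have h: "0 < h" "h < h0"
      proof -
        show "0 < h" using t n0 by (simp add: h_def)
        have "t / h0 < real n" using N n by linarith
        then show "h < h0" using n0 h0(1) by (simp add: h_def field_simps)
      qed
      \<comment> \<open>The value \<open>\<top>\<close> is never attained along the chain; it makes the one-step inequality hold at irrelevant states.\<close>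
      define v where "v k i y = (if i = 0 then if y \<in> {a..b} then ennreal (exp (k0 * real k * h) * V (clip c d y)) else \<top> else 0)"
        for k i :: nat and y
      have Vm: "(\<lambda>y. V (clip c d y)) \<in> borel_measurable borel"
        by (rule clip_measurable[OF cV ord(7)])
      have clipV: "0 \<le> V (clip c d y)" for y using V(1)[of "clip c d y"] m by auto
      \<comment> \<open>Initially \<open>V\<close> is at most \<open>2 * m\<close>; on stage 0 the
        final weighted value is at least \<open>exp (k0 * t) * m\<close>.\<close>
      have "A n \<in> sets M \<and> measure M (A n) \<le> (2 * m) / (exp (k0 * t) * m)"
        unfolding A_def
      proof (rule euler_stage_prob[where v=v, OF BM t n0 qm], goal_cases)
        case (1 i) show ?case unfolding J_def by measurable
      next
        case (2 k i)
        show ?case unfolding v_def using Vm by measurable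
      next
        case (3 k i y)
        show ?case
        proof (cases "i = 0 \<and> y \<in> {a..b}")
          case False
          then show ?thesis by (auto simp: v_def J_def)
        next
          case True
          then have yc: "c \<le> y" "clip c d y = y" using ord by (auto simp: max_def min_def)
          define E where "E = exp (k0 * real (Suc k) * h)"
          have "(\<integral>\<^sup>+ u. v (Suc k) (J i (y - h * qc y + u)) (y - h * qc y + u) \<partial>density lborel (normal_density 0 (sqrt h)))
            \<le> (\<integral>\<^sup>+ u. ennreal E * ennreal (V (clip c d (y - h * qc y + u))) \<partial>density lborel (normal_density 0 (sqrt h)))"
            using True by (intro nn_integral_mono) (auto simp: v_def J_def E_def clipV ennreal_mult)
          also have "\<dots> = ennreal E * (\<integral>\<^sup>+ u. ennreal (V (clip c d (y - h * qc y + u))) \<partial>density lborel (normal_density 0 (sqrt h)))"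
            using measurable_compose[OF _ Vm, of "\<lambda>u. y - h * qc y + u" borel]
            by (intro nn_integral_cmult) simp
          also have "\<dots> \<le> ennreal E * ennreal (V y + h * ((2 * q y * U' y - 2) / 2 - qc y * U' y + 1/2))"
            using True h by (intro mult_left_mono h0(2)) auto
          also have "V y + h * ((2 * q y * U' y - 2) / 2 - qc y * U' y + 1/2) = V y - h / 2"
            using yc by (simp add: qc_def field_simps)
          also have "ennreal E * ennreal (V y - h / 2) \<le> ennreal (exp (k0 * real k * h) * V y)"
          proof -
            have "V y * (k0 * h) \<le> (2 * m) * (k0 * h)"
              using V(2)[OF yc(1)] m h by (intro mult_right_mono) (auto simp: k0_def)
            also have "\<dots> = h / 2" using m by (simp add: k0_def)
            finally have "V y - h / 2 \<le> V y * (1 - k0 * h)" by (simp add: algebra_simps)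
            also have "\<dots> \<le> V y * exp (- (k0 * h))"
              using exp_ge_add_one_self[of "- (k0 * h)"] V(1)[OF yc(1)] m by (intro mult_left_mono) auto
            finally have "E * (V y - h / 2) \<le> E * (V y * exp (- (k0 * h)))"
              by (intro mult_left_mono) (auto simp: E_def)
            also have "\<dots> = exp (k0 * real k * h) * V y"
              by (simp add: E_def mult_exp_exp algebra_simps)
            finally have "ennreal (E * (V y - h / 2)) \<le> ennreal (exp (k0 * real k * h) * V y)"
              by (rule ennreal_leI)
            then show ?thesis by (simp add: ennreal_mult' E_def)
          qed
          finally show ?thesis using True yc by (simp add: v_def h_def)
        qed
      next
        case 4
        then show ?case using V(2)[of x] True ord by (auto simp: v_def a_def b_def max_def min_def intro!: ennreal_leI)
      next
        case 5 then show ?case using m by simp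
      next
        case (6 y)
        have e: "k0 * real n * h = k0 * t" using n0 by (simp add: h_def)
        have "exp (k0 * t) * m \<le> exp (k0 * t) * V (clip c d y)"
          using V(1)[of "clip c d y"] by (intro mult_left_mono) auto
        then show ?case unfolding v_def e by (auto intro: ennreal_leI)
      next
        case 7 then show ?case using m by simp
      qed
      moreover have "(2 * m) / (exp (k0 * t) * m) = p"
        using m by (simp add: p_def k0_def exp_minus field_simps)
      ultimately show ?thesis by simp
    qed
    have 1: "outer_le (\<lambda>\<omega>. \<omega> \<in> A n) p" if "n \<ge> N" for n
      using An[OF that] unfolding outer_le_def by (intro bexI[of _ "A n"] conjI AE_I2 impI) simp_all
    have "outer_le (\<lambda>\<omega>. \<forall>u\<in>{0..t}. z \<le> X u \<omega> \<and> X u \<omega> \<le> K) p"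
    proof (rule outer_le_liminf[where P="\<lambda>n \<omega>. \<omega> \<in> A n" and N=N, OF 1])
      show "AE \<omega> in M. (\<forall>u\<in>{0..t}. z \<le> X u \<omega> \<and> X u \<omega> \<le> K) \<longrightarrow> (\<exists>m. \<forall>n\<ge>m. \<omega> \<in> A n)"
        using sol AE_space
      proof eventually_elim
        case (elim \<omega>)
        show ?case
        proof
          assume ev: "\<forall>u\<in>{0..t}. z \<le> X u \<omega> \<and> X u \<omega> \<le> K"
          have Xc: "continuous_on {0..t} (\<lambda>u. X u \<omega>)"
            by (rule continuous_on_subset[OF stopped_solutionD(2)[OF elim(1)]]) auto
          have b0: "B 0 \<omega> = 0" using BM elim(2) by (simp add: brownian_motion_def)
          have eq: "X u \<omega> = x + B u \<omega> - integral {0..u} (\<lambda>v. qc (X v \<omega>))" if "u \<in> {0..t}" for u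
            unfolding qc_def
          proof (rule stopped_solution_clip[OF elim(1) ord(1) that])
            fix v assume "v \<in> {0..t}"
            from bspec[OF ev this] show "c \<le> X v \<omega> \<and> X v \<omega> \<le> d"
              using ord by (simp add: d_def)
          qed
          have e: "0 < min (z / 4) 1" using z by simp
          obtain m where m: "\<And>n k. n \<ge> m \<Longrightarrow> k \<le> n \<Longrightarrow> real k * t / real n \<le> t \<Longrightarrow>
            \<bar>X (real k * t / real n) \<omega> - euler qc (t / real n) x (\<lambda>i. B (real (Suc i) * t / real n) \<omega> - B (real i * t / real n) \<omega>) k\<bar> \<le> min (z / 4) 1"
            using euler_converges[OF t less_imp_le[OF t] order_refl Xc b0 eq LQ(1,2) e] by blast
          have "\<omega> \<in> A n" if n: "n \<ge> m" for n
          proof -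
            have "stage J (euler qc (t / real n) x (\<lambda>i. B (real (Suc i) * t / real n) \<omega> - B (real i * t / real n) \<omega>)) n = 0"
              unfolding J_def
            proof (rule stage_stay)
              fix j assume j: "j \<le> n"
              have jt: "real j * t / real n \<in> {0..t}" using j t
                by (cases "n = 0") (auto simp: field_simps)
              then have "z \<le> X (real j * t / real n) \<omega> \<and> X (real j * t / real n) \<omega> \<le> K" using ev by blast
              then show "euler qc (t / real n) x (\<lambda>i. B (real (Suc i) * t / real n) \<omega> - B (real i * t / real n) \<omega>) j \<in> {a..b}"
                using m[OF n j] jt unfolding a_def b_def atLeastAtMost_iff min.bounded_iff by linarith
            qed
            then show ?thesis using elim(2) by (simp add: A_def)
          qed
          then show "\<exists>m. \<forall>n\<ge>m. \<omega> \<in> A n" by blast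
        qed
      qed
    qed
    then show ?thesis by (simp add: p_def m_def)
  qed
qed

section \<open>Climbing after a descent\<close>

text \<open>
  Stage 0: never at or below \<open>z\<close> so far. Stage 1: has been at or below \<open>z\<close>. Stage 2: has afterwards
  reached \<open>K\<close>. Stage 3: has dropped below \<open>a\<close> before that.
\<close>

lemma stage_climb:
  fixes y :: "nat \<Rightarrow> real" and a z K :: real and J
  defines "J \<equiv> \<lambda>(i::nat) y. if i = 0 then if y < a then 3 else if y \<le> z then 1 else 0
      else if i = 1 then if y < a then 3 else if K \<le> y then 2 else 1 else i"
  assumes "z < K" "z < y 0" "k1 \<le> k2" "k2 \<le> n" "y k1 \<le> z" "K \<le> y k2" "\<And>j. j \<le> k2 \<Longrightarrow> a \<le> y j"
  shows "stage J y n = (2::nat)"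
proof -
  have 1: "stage J y j \<in> {0, 1, 2}" if "j \<le> k2" for j
    using that
  proof (induction j)
    case (Suc j)
    then show ?case using assms(8)[of "Suc j"] by (auto simp: J_def)
  qed simp
  \<comment> \<open>A low value at index 0 would go unnoticed by \<open>stage\<close>; starting
    above \<open>z\<close> makes \<open>k1\<close> positive.\<close>
  obtain k where k: "k1 = Suc k" using assms(3,6) by (cases k1) auto
  have 2: "stage J y j \<in> {1, 2}" if "k1 \<le> j" "j \<le> k2" for j
    using that
  proof (induction j rule: dec_induct)
    case base
    then show ?case using 1[of k] assms(2,6) assms(8)[of k1] by (auto simp: J_def k)
  next
    case (step j)
    then show ?case using assms(8)[of "Suc j"] by (auto simp: J_def)
  qed
  have "k1 \<noteq> k2" using assms(2,6,7) by auto
  then obtain l where l: "k2 = Suc l" "k1 \<le> l" using assms(4) by (cases k2) auto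
  then have 3: "stage J y k2 = 2" using 2[of l] assms(7) assms(8)[of k2] by (auto simp: J_def)
  show ?thesis
    using assms(5)
  proof (induction n rule: dec_induct)
    case base then show ?case by (rule 3)
  next
    case (step j) then show ?case by (simp add: J_def)
  qed
qed

text \<open>In stage 1 the harmonic function \<open>W\<close> yields the ratio. The starting point
  drops out because stage 0 carries the constant \<open>W (z + 1)\<close>, which dominates
  \<open>W\<close> at the moment stage 1 is entered. The summand \<open>t\<close> is the
  discretisation error, allowed at rate 1. The unit offsets of both levels absorb half a unit of
  scheme error and half a unit of rounding to the grid.\<close>

lemma climb_probability_bounded:
  fixes W q :: "real \<Rightarrow> real"
  assumes BM: "brownian_motion M B" and C1: "C1_on_nonneg q"
    and W: "\<And>x. 0 < x \<Longrightarrow> (W has_real_derivative exp (gam q x)) (at x)" and W_pos: "\<And>x. 0 < x \<Longrightarrow> 0 < W x"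
    and \<mu>: "0 < \<mu>" "\<mu> \<le> z" and zK: "z + 1 < K" "z + 1 < x" and t: "0 < t"
    and sol: "AE \<omega> in M. stopped_solution q (\<lambda>t. B t \<omega>) x (\<lambda>t. X t \<omega>)"
  shows "prob_space.outer_le M (\<lambda>\<omega>. \<exists>r1 r2. 0 \<le> r1 \<and> r1 \<le> r2 \<and> r2 \<le> t \<and> X r1 \<omega> \<le> z \<and> K + 1 \<le> X r2 \<omega> \<and>
      (\<forall>u\<in>{0..r2}. \<mu> \<le> X u \<omega> \<and> X u \<omega> \<le> m)) ((W (z + 1) + t) / W K)"
    (is "prob_space.outer_le M ?ev ?p")
proof -
  interpret prob_space M using BM by (simp add: brownian_motion_def)
  define a where "a = \<mu> / 2"
  define c where "c = \<mu> / 4"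
  define d where "d = K + 1"
  \<comment> \<open>Two different upper cutoffs: \<open>q\<close> is clipped at \<open>D\<close>,
    because before its descent the path may be as high as \<open>m\<close>; \<open>W\<close> is
    clipped at \<open>d\<close>, because only its values up to just above \<open>K\<close>
    matter.\<close>
  define D where "D = max m d"
  have ord: "0 < c" "c < a" "a \<le> K" "K < d" "c \<le> d" "c \<le> D" "0 < K" "d \<le> D" "m \<le> D" "c \<le> \<mu>"
    using \<mu> zK by (auto simp: a_def c_def d_def D_def le_max_iff_disj)
  define qc where "qc y = q (clip c D y)" for y
  obtain L Q where LQ: "0 \<le> L" "\<And>y z. \<bar>qc y - qc z\<bar> \<le> L * \<bar>y - z\<bar>" "\<And>y. \<bar>qc y\<bar> \<le> Q"
    using clipped_drift(1)[OF C1 less_imp_le[OF ord(1)] ord(6)] unfolding qc_def by blast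
  have qm: "qc \<in> borel_measurable borel"
    unfolding qc_def[abs_def] by (rule clipped_drift(2)[OF C1 less_imp_le[OF ord(1)] ord(6)])
  have q: "continuous_on {0..} q" by (rule C1_on_nonneg_continuous[OF C1])
  have mono: "W x \<le> W y" if "0 < x" "x \<le> y" for x y
    by (rule mono_of_deriv[OF W _ that]) auto
  define g where "g y = exp (gam q y)" for y
  have dW: "(W has_real_derivative g y) (at y)" if "y \<in> {c..d}" for y
    unfolding g_def using W[of y] that ord(1) by auto
  have dg: "(g has_real_derivative g y * (2 * q y)) (at y)" if "y \<in> {c..d}" for y
    unfolding g_def using gam_has_derivative[OF q, of y] that ord(1) by (auto intro!: derivative_eq_intros)
  have cg: "continuous_on {c..d} g"
    by (intro continuous_at_imp_continuous_on ballI) (erule DERIV_isCont[OF dg])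
  have cW: "continuous_on {c..d} W"
    by (intro continuous_at_imp_continuous_on ballI) (erule DERIV_isCont[OF dW])
  have cq: "continuous_on {c..d} q"
    by (rule continuous_on_subset[OF q]) (use ord in auto)
  have one: "(0::real) < 1" by simp
  have "\<exists>h0>0. \<forall>h\<in>{0<..<h0}. \<forall>y\<in>{a..K}.
    (\<integral>\<^sup>+ u. ennreal (W (clip c d (y - h * qc y + u))) \<partial>density lborel (normal_density 0 (sqrt h)))
    \<le> ennreal (W y + h * ((g y * (2 * q y)) / 2 - qc y * g y + 1))"
  proof (rule euler_drift[OF ord(2,3,4) one dW dg _ _ LQ(3)])
    show "continuous_on {c..d} (\<lambda>y. g y * (2 * q y))" by (intro continuous_intros cq cg)
    show "0 \<le> W y" if "y \<in> {c..d}" for y using W_pos[of y] that ord(1) by auto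
  qed
  then obtain h0 where h0: "0 < h0" "\<And>h y. 0 < h \<Longrightarrow> h < h0 \<Longrightarrow> y \<in> {a..K} \<Longrightarrow>
    (\<integral>\<^sup>+ u. ennreal (W (clip c d (y - h * qc y + u))) \<partial>density lborel (normal_density 0 (sqrt h)))
    \<le> ennreal (W y + h * ((g y * (2 * q y)) / 2 - qc y * g y + 1))"
    by (metis greaterThanLessThan_iff)
  define J :: "nat \<Rightarrow> real \<Rightarrow> nat" where "J = (\<lambda>i y. if i = 0 then if y < a then 3 else if y \<le> z + 1 then 1 else 0
      else if i = 1 then if y < a then 3 else if K \<le> y then 2 else 1 else i)"
  define A where "A n = {\<omega>\<in>space M. stage J (euler qc (t / real n) x
      (\<lambda>i. B (real (Suc i) * t / real n) \<omega> - B (real i * t / real n) \<omega>)) n = 2}" for n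
  obtain N :: nat where N: "t / h0 < real N" using reals_Archimedean2 by blast
  have N0: "0 < real N" using N t h0(1) by (smt (verit) divide_pos_pos)
  have An: "A n \<in> sets M \<and> measure M (A n) \<le> ?p" if n: "n \<ge> N" for n
  proof -
    have n0: "0 < n" using n N0 by simp
    define h where "h = t / real n"
    have h: "0 < h" "h < h0"
    proof -
      show "0 < h" using t n0 by (simp add: h_def)
      have "t / h0 < real n" using N n by linarith
      then show "h < h0" using n0 h0(1) by (simp add: h_def field_simps)
    qed
    \<comment> \<open>The term \<open>(real n - real k) * h\<close> is the error budget left after
      \<open>k\<close> steps. Stage 2 is frozen at \<open>W K\<close>, all later stages at 0. In
      stage 1 the scheme never leaves \<open>{a..K}\<close>, so infinity is not attained there and
      only makes the one-step inequality trivial.\<close>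
    define v where "v k i y = (if i = 0 then ennreal (W (z + 1) + (real n - real k) * h)
        else if i = 1 then if y \<in> {a..K} then ennreal (W (clip c d y) + (real n - real k) * h) else \<top>
        else if i = 2 then ennreal (W K) else 0)" for k i :: nat and y
    have Wm: "(\<lambda>y. W (clip c d y)) \<in> borel_measurable borel"
      by (rule clip_measurable[OF cW ord(5)])
    have clipW: "0 \<le> W (clip c d y)" for y
      using W_pos[of "clip c d y"] ord(1) by (simp add: less_max_iff_disj less_imp_le)
    interpret G: prob_space "density lborel (normal_density 0 (sqrt h))"
      by (rule normal_moments(1)[OF h(1)])
    have G1: "emeasure (density lborel (normal_density 0 (sqrt h))) UNIV = 1"
      using G.emeasure_space_1 by simp
    show ?thesis
      unfolding A_def
    proof (rule euler_stage_prob[where v=v, OF BM t n0 qm], goal_cases)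
      case (1 i) show ?case unfolding J_def by measurable
    next
      case (2 k i)
      show ?case unfolding v_def using Wm by measurable
    next
      case (3 k i y)
      let ?N = "density lborel (normal_density 0 (sqrt h))"
      have kn: "0 \<le> (real n - real (Suc k)) * h" using 3 h by simp
      have kn': "(real n - real k) * h = (real n - real (Suc k)) * h + h" by (simp add: algebra_simps)
      consider "i = 0" | "i = 1" "y \<in> {a..K}" | "i = 1" "y \<notin> {a..K}" | "i = 2" | "i > 2" by linarith
      then show ?case
      proof cases
        case 1
        have "v (Suc k) (J i y') y' \<le> ennreal (W (z + 1) + (real n - real (Suc k)) * h)" for y'
        proof -
          have "W (clip c d y') \<le> W (z + 1)" if "a \<le> y'" "y' \<le> z + 1"
            using that ord zK by (intro mono) auto
          then show ?thesis using 1 ord zK by (auto simp: v_def J_def intro!: ennreal_leI)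
        qed
        then have "(\<integral>\<^sup>+ u. v (Suc k) (J i (y - h * qc y + u)) (y - h * qc y + u) \<partial>?N)
            \<le> (\<integral>\<^sup>+ u. ennreal (W (z + 1) + (real n - real (Suc k)) * h) \<partial>?N)"
          by (intro nn_integral_mono) auto
        also have "\<dots> = ennreal (W (z + 1) + (real n - real (Suc k)) * h)"
          by (simp add: G1)
        also have "\<dots> \<le> v k i y" using 1 h kn' by (auto simp: v_def intro!: ennreal_leI)
        finally show ?thesis by (simp add: h_def)
      next
        case 2
        then have yc: "clip c d y = y" "clip c D y = y" using ord by (auto simp: max_def min_def)
        \<comment> \<open>Stopping only lowers the value: from \<open>K\<close> on,
          \<open>W K\<close> is at most \<open>W\<close> of the clipped position, and below
          \<open>a\<close> the value is 0. Hence the drift estimate for \<open>W\<close>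
          suffices.\<close>
        have le: "v (Suc k) (J i y') y' \<le> ennreal (W (clip c d y')) + ennreal ((real n - real (Suc k)) * h)" for y'
        proof -
          have "W K \<le> W (clip c d y')" if "K \<le> y'" using that ord by (intro mono) auto
          moreover have "ennreal (W (clip c d y')) \<le> ennreal (W (clip c d y')) + ennreal ((real n - real (Suc k)) * h)"
            by simp
          ultimately have "ennreal (W K) \<le> ennreal (W (clip c d y')) + ennreal ((real n - real (Suc k)) * h)" if "K \<le> y'"
            using that by (meson ennreal_leI order_trans)
          then show ?thesis using 2 ord clipW[of y'] kn by (auto simp: v_def J_def ennreal_plus)
        qed
        have "(\<integral>\<^sup>+ u. v (Suc k) (J i (y - h * qc y + u)) (y - h * qc y + u) \<partial>?N)
            \<le> (\<integral>\<^sup>+ u. ennreal (W (clip c d (y - h * qc y + u))) + ennreal ((real n - real (Suc k)) * h) \<partial>?N)"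
          by (intro nn_integral_mono le)
        also have "\<dots> = (\<integral>\<^sup>+ u. ennreal (W (clip c d (y - h * qc y + u))) \<partial>?N) + ennreal ((real n - real (Suc k)) * h)"
          using measurable_compose[OF _ Wm, of "\<lambda>u. y - h * qc y + u" borel]
          by (subst nn_integral_add) (simp_all add: G1)
        also have "\<dots> \<le> ennreal (W y + h * ((g y * (2 * q y)) / 2 - qc y * g y + 1)) + ennreal ((real n - real (Suc k)) * h)"
          using 2 h by (intro add_right_mono h0(2)) auto
        also have "W y + h * ((g y * (2 * q y)) / 2 - qc y * g y + 1) = W y + h"
          using yc by (simp add: qc_def)
        also have "ennreal (W y + h) + ennreal ((real n - real (Suc k)) * h) = v k i y"
          using 2 clipW[of y] yc h kn kn' by (simp add: v_def ennreal_plus[symmetric] add.assoc add.commute del: ennreal_plus)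
        finally show ?thesis by (simp add: h_def)
      next
        case 3
        then have "v k i y = \<top>" by (auto simp: v_def)
        then show ?thesis by (simp only: top_greatest)
      next
        case 4
        then have "v (Suc k) (J i y') y' = ennreal (W K)" "v k i y = ennreal (W K)" for y'
          by (simp_all add: v_def J_def)
        then show ?thesis by (simp add: G1 flip: h_def)
      next
        case 5
        then have "v (Suc k) (J i y') y' = 0" for y'
          by (simp add: v_def J_def)
        then show ?thesis by simp
      qed
    next
      case 4
      show ?case using n0 by (simp add: v_def h_def)
    next
      case 5 show ?case using W_pos[of "z + 1"] \<mu> t by simp
    next
      case (6 y)
      show ?case by (simp add: v_def)
    next
      case 7 show ?case by (rule W_pos[OF ord(7)])
    qed
  qed
  have 1: "outer_le (\<lambda>\<omega>. \<omega> \<in> A n) ?p" if "n \<ge> N" for n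
    using An[OF that] unfolding outer_le_def by (intro bexI[of _ "A n"] conjI AE_I2 impI) simp_all
  show ?thesis
  proof (rule outer_le_liminf[where P="\<lambda>n \<omega>. \<omega> \<in> A n" and N=N, OF 1])
    show "AE \<omega> in M. ?ev \<omega> \<longrightarrow> (\<exists>m. \<forall>n\<ge>m. \<omega> \<in> A n)"
      using sol AE_space
    proof eventually_elim
      case (elim \<omega>)
      show ?case
      proof
        assume "?ev \<omega>"
        then obtain r1 r2 where r: "0 \<le> r1" "r1 \<le> r2" "r2 \<le> t" "X r1 \<omega> \<le> z" "K + 1 \<le> X r2 \<omega>"
          and rng: "\<And>u. u \<in> {0..r2} \<Longrightarrow> \<mu> \<le> X u \<omega> \<and> X u \<omega> \<le> m" by blast
        have Xc: "continuous_on {0..t} (\<lambda>u. X u \<omega>)"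
          by (rule continuous_on_subset[OF stopped_solutionD(2)[OF elim(1)]]) auto
        have b0: "B 0 \<omega> = 0" using BM elim(2) by (simp add: brownian_motion_def)
        have eq: "X u \<omega> = x + B u \<omega> - integral {0..u} (\<lambda>v. qc (X v \<omega>))" if "u \<in> {0..r2}" for u
          unfolding qc_def
        proof (rule stopped_solution_clip[OF elim(1) ord(1) that])
          fix v assume "v \<in> {0..r2}"
          then show "c \<le> X v \<omega> \<and> X v \<omega> \<le> D" using rng[of v] ord by linarith
        qed
        have e: "0 < min (\<mu> / 2) (1 / 2)" using \<mu> by simp
        have r2: "0 \<le> r2" using r by simp
        define Y where "Y n = euler qc (t / real n) x (\<lambda>i. B (real (Suc i) * t / real n) \<omega> - B (real i * t / real n) \<omega>)" for n
        obtain N1 where N1: "\<And>n k. n \<ge> N1 \<Longrightarrow> k \<le> n \<Longrightarrow> real k * t / real n \<le> r2 \<Longrightarrow>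
          \<bar>X (real k * t / real n) \<omega> - Y n k\<bar> \<le> min (\<mu> / 2) (1 / 2)"
          using euler_converges[OF t r2 r(3) Xc b0 eq LQ(1,2) e] unfolding Y_def by blast
        have "uniformly_continuous_on {0..t} (\<lambda>u. X u \<omega>)"
          by (rule compact_uniformly_continuous[OF Xc compact_Icc])
        then have "\<exists>\<delta>>0. \<forall>u\<in>{0..t}. \<forall>v\<in>{0..t}. dist v u < \<delta> \<longrightarrow> dist (X v \<omega>) (X u \<omega>) < 1 / 2"
          unfolding uniformly_continuous_on_def by (meson half_gt_zero_iff zero_less_one)
        then obtain \<delta> where \<delta>: "\<delta> > 0" "\<And>u v. u \<in> {0..t} \<Longrightarrow> v \<in> {0..t} \<Longrightarrow> \<bar>v - u\<bar> < \<delta> \<Longrightarrow> \<bar>X v \<omega> - X u \<omega>\<bar> < 1 / 2"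
          unfolding dist_real_def by blast
        obtain N2 :: nat where N2: "t / \<delta> < real N2" using reals_Archimedean2 by blast
        have N20: "0 < real N2" using N2 t \<delta>(1) by (smt (verit) divide_pos_pos)
        have "\<omega> \<in> A n" if n: "n \<ge> max N1 N2" for n
        proof -
          define h where "h = t / real n"
          have n0: "0 < real n" using n N20 by linarith
          have h: "0 < h" "h < \<delta>"
          proof -
            show "0 < h" using t n0 by (simp add: h_def)
            have "t / \<delta> < real n" using N2 n by linarith
            then show "h < \<delta>" using n0 \<delta>(1) by (simp add: h_def field_simps)
          qed
          have nh: "real j * t / real n = real j * h" for j by (simp add: h_def)
          \<comment> \<open>Times are rounded down to the grid, so that the grid times for
            \<open>r1\<close> and \<open>r2\<close> do not exceed \<open>r2\<close>, up to which the
            equation is known.\<close>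
          define k where "k r = nat \<lfloor>r / h\<rfloor>" for r
          have k: "real (k r) * h \<le> r" "\<bar>real (k r) * h - r\<bar> < \<delta>" "k r \<le> n" if "0 \<le> r" "r \<le> t" for r
          proof -
            have "0 \<le> r / h" using that h by simp
            then have kr: "real (k r) = of_int \<lfloor>r / h\<rfloor>" by (simp add: k_def)
            then have "real (k r) \<le> r / h" "r / h < real (k r) + 1" by linarith+
            then show 1: "real (k r) * h \<le> r" and "\<bar>real (k r) * h - r\<bar> < \<delta>"
              using h by (auto simp: field_simps)
            have "real (k r) \<le> r / h" using 1 h by (simp add: field_simps)
            also have "\<dots> \<le> t / h" using that h by (intro divide_right_mono) auto
            also have "\<dots> = real n" using n0 t by (simp add: h_def)
            finally show "k r \<le> n" by simp
          qed
          have kr: "k r1 \<le> k r2" unfolding k_def using r h by (intro nat_mono floor_mono divide_right_mono) auto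
          have near: "\<bar>X (real j * h) \<omega> - Y n j\<bar> \<le> min (\<mu> / 2) (1 / 2)" if "j \<le> k r2" for j
          proof -
            have "real j * h \<le> real (k r2) * h" using that h by (intro mult_right_mono) auto
            then have "real j * h \<le> r2" using k(1)[of r2] r by linarith
            then show ?thesis using N1[of n j] n that k(3)[of r2] r unfolding nh by auto
          qed
          have Xk: "\<bar>X (real (k r) * h) \<omega> - X r \<omega>\<bar> < 1 / 2" if "0 \<le> r" "r \<le> t" for r
            using that k[OF that] h by (intro \<delta>(2)) auto
          have "stage J (Y n) n = 2"
            unfolding J_def
          proof (rule stage_climb)
            show "z + 1 < K" by (rule zK(1))
            show "z + 1 < Y n 0" using zK by (simp add: Y_def)
            show "k r1 \<le> k r2" by (rule kr)
            show "k r2 \<le> n" using k(3)[of r2] r by simp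
            show "Y n (k r1) \<le> z + 1" using near[OF kr] Xk[of r1] r unfolding min.bounded_iff by linarith
            show "K \<le> Y n (k r2)" using near[OF order_refl] Xk[of r2] r unfolding min.bounded_iff by linarith
            fix j assume j: "j \<le> k r2"
            have "real j * h \<le> real (k r2) * h" using j h by (intro mult_right_mono) auto
            then have "real j * h \<le> r2" using k(1)[of r2] r by linarith
            then have "real j * h \<in> {0..r2}" using h by simp
            then show "a \<le> Y n j" using rng[of "real j * h"] near[OF j] unfolding a_def min.bounded_iff by linarith
          qed
          then show ?thesis using elim(2) by (simp add: A_def Y_def)
        qed
        then show "\<exists>m. \<forall>n\<ge>m. \<omega> \<in> A n" by blast
      qed
    qed
  qed
qed

section \<open>Pathwise limit\<close>

lemma hit_le: "0 \<le> t \<Longrightarrow> f t = z \<Longrightarrow> hit f z \<le> ereal t"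
  unfolding hit_def by (rule Inf_lower) blast

lemma hit_nonneg: "0 \<le> hit f z"
  unfolding hit_def by (rule Inf_greatest) auto

text \<open>The level set of a continuous path is closed and so contains its infimum. The value type
  is general because both the real solutions and their extended real limit are treated.\<close>

lemma hit_attained:
  fixes f :: "real \<Rightarrow> 'b::t1_space"
  assumes f: "continuous_on {0..} f" and "hit f z \<noteq> \<infinity>"
  obtains \<tau> where "0 \<le> \<tau>" "hit f z = ereal \<tau>" "f \<tau> = z" "\<And>u. 0 \<le> u \<Longrightarrow> u < \<tau> \<Longrightarrow> f u \<noteq> z"
proof -
  define S where "S = {t\<in>{0..}. f t = z}"
  have cl: "closed S" unfolding S_def by (rule continuous_closed_preimage_constant[OF f]) simp
  have ne: "S \<noteq> {}"
  proof
    assume "S = {}"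
    then have e: "{ereal t | t. 0 \<le> t \<and> f t = z} = {}" by (auto simp: S_def)
    have "hit f z = \<infinity>" unfolding hit_def e by (simp add: top_ereal_def)
    then show False using assms(2) by simp
  qed
  have bdd: "bdd_below S" unfolding S_def by (intro bdd_belowI[of _ 0]) auto
  define \<tau> where "\<tau> = Inf S"
  have mem: "\<tau> \<in> S" unfolding \<tau>_def by (rule closed_contains_Inf[OF ne bdd cl])
  have low: "\<tau> \<le> t" if "t \<in> S" for t unfolding \<tau>_def by (rule cInf_lower[OF that bdd])
  show thesis
  proof (rule that)
    show "0 \<le> \<tau>" "f \<tau> = z" using mem by (auto simp: S_def)
    then have "hit f z \<le> ereal \<tau>" by (rule hit_le)
    moreover have "ereal \<tau> \<le> hit f z" unfolding hit_def
      by (rule Inf_greatest) (use low in \<open>auto simp: S_def\<close>)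
    ultimately show "hit f z = ereal \<tau>" by (rule antisym)
    fix u assume "0 \<le> u" "u < \<tau>"
    then show "f u \<noteq> z" using low[of u] by (auto simp: S_def)
  qed
qed

text \<open>The integral equations are first obtained strictly before absorption; continuity of both
  sides carries them to the absorption time itself.\<close>

lemma agree_at_endpoint:
  fixes f g :: "real \<Rightarrow> real"
  assumes "continuous_on {s..v} f" "continuous_on {s..v} g" "s < v"
    and "\<And>u. u \<in> {s..<v} \<Longrightarrow> f u = g u"
  shows "f v = g v"
proof -
  have c: "closure {s..<v} = {s..v}" using assms(3) by simp
  have "f v - g v = 0"
  proof (rule continuous_constant_on_closure[where S="{s..<v}" and f="\<lambda>u. f u - g u"])
    show "continuous_on (closure {s..<v}) (\<lambda>u. f u - g u)"
      unfolding c by (intro continuous_on_diff assms)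
    show "v \<in> closure {s..<v}" unfolding c using assms(3) by simp
  qed (use assms(4) in auto)
  then show ?thesis by simp
qed

text \<open>
  By monotonicity in the starting point, \<open>fast\<close> and \<open>no_climb\<close> together bound all solutions on compact
  subsets of the open half-line of times, although \<open>no_climb\<close> only concerns infinitely many of them.
\<close>

locale coming_down =
  fixes q b :: "real \<Rightarrow> real" and X :: "real \<Rightarrow> real \<Rightarrow> real"
  assumes q: "continuous_on {0..} q" and b: "continuous_on {0..} b" and b0: "b 0 = 0"
    and sol: "\<And>x. 0 \<le> x \<Longrightarrow> stopped_solution q b x (X x)"
    and mono: "\<And>x y t. 0 \<le> x \<Longrightarrow> x \<le> y \<Longrightarrow> 0 \<le> t \<Longrightarrow> X x t \<le> X y t"
    and fast: "\<And>t. 0 < t \<Longrightarrow> \<exists>z::nat. \<forall>n::nat. \<exists>u\<in>{0..t}. X (real n) u \<le> real z"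
    and no_climb: "\<And>z T :: nat. \<exists>K>0. \<forall>N. \<exists>n\<ge>N. \<not> (\<exists>r1 r2. 0 \<le> r1 \<and> r1 \<le> r2 \<and> r2 \<le> real T \<and>
      X (real n) r1 \<le> real z \<and> K \<le> X (real n) r2 \<and> (\<forall>u\<in>{0..r2}. 0 < X (real n) u))"
begin

section \<open>Elementary properties of the solutions\<close>

lemma X_0: "0 \<le> x \<Longrightarrow> X x 0 = x"
  by (rule stopped_solutionD(1)[OF sol])

lemma X_cont: "0 \<le> x \<Longrightarrow> continuous_on {0..} (X x)"
  by (rule stopped_solutionD(2)[OF sol])

lemma X_absorbed: "0 \<le> x \<Longrightarrow> 0 \<le> t \<Longrightarrow> X x t = 0 \<Longrightarrow> t \<le> u \<Longrightarrow> X x u = 0"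
  by (rule stopped_solutionD(4)[OF sol])

lemma X_crosses:
  assumes "z \<le> x" "0 \<le> x" "0 \<le> t" "X x t \<le> z"
  obtains u where "u \<in> {0..t}" "X x u = z"
proof -
  have "continuous_on {0..t} (X x)" by (rule continuous_on_subset[OF X_cont[OF assms(2)]]) auto
  then have "\<exists>u. 0 \<le> u \<and> u \<le> t \<and> X x u = z"
    using assms X_0[OF assms(2)] by (intro IVT2') auto
  then show thesis using that by auto
qed

lemma X_nonneg:
  assumes "0 \<le> x" "0 \<le> t"
  shows "0 \<le> X x t"
proof (rule ccontr)
  assume neg: "\<not> 0 \<le> X x t"
  then obtain u where "u \<in> {0..t}" "X x u = 0"
    using X_crosses[of 0 x t] assms by auto
  then show False using X_absorbed[of x u t] assms neg by auto
qed

lemma X_pos_before: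
  assumes "0 \<le> x" "0 \<le> u" "u \<le> t" "0 < X x t"
  shows "0 < X x u"
  using X_nonneg[of x u] X_absorbed[of x u t] assms by (cases "X x u = 0") auto

text \<open>Solutions are absorbed at 0, so stopping them at the hitting time of 0 changes nothing.
  Limits can thus be studied without the stopping that appears in the theorem.\<close>

lemma X_stopped:
  assumes "0 \<le> x" "0 \<le> t"
  shows "X x (real_of_ereal (min (ereal t) (hit (X x) 0))) = X x t"
proof (cases "ereal t \<le> hit (X x) 0")
  case True
  then show ?thesis by (simp add: min_def)
next
  case False
  then have "hit (X x) 0 \<noteq> \<infinity>" by auto
  then obtain \<tau> where \<tau>: "0 \<le> \<tau>" "hit (X x) 0 = ereal \<tau>" "X x \<tau> = 0"
    using hit_attained[OF X_cont[OF assms(1)]] by metis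
  then have "\<tau> \<le> t" using False by simp
  then show ?thesis using \<tau> X_absorbed[OF assms(1) \<tau>(1,3)] by (simp add: min_def)
qed

section \<open>Bounds and equicontinuity uniform in the starting point\<close>

lemma X_bounded:
  assumes "0 < t0"
  shows "\<exists>K>0. \<forall>x\<ge>0. \<forall>r\<in>{t0..t1}. X x r \<le> K"
proof -
  obtain z :: nat where z: "\<forall>n::nat. \<exists>u\<in>{0..t0}. X (real n) u \<le> real z" using fast[OF assms] by blast
  obtain T :: nat where T: "t1 \<le> real T" using real_arch_simple by blast
  obtain K where K: "K > 0" "\<forall>N. \<exists>n\<ge>N. \<not> (\<exists>r1 r2. 0 \<le> r1 \<and> r1 \<le> r2 \<and> r2 \<le> real T \<and>
      X (real n) r1 \<le> real z \<and> K \<le> X (real n) r2 \<and> (\<forall>u\<in>{0..r2}. 0 < X (real n) u))"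
    using no_climb[of T z] by blast
  have "X x r \<le> K" if x: "0 \<le> x" and r: "r \<in> {t0..t1}" for x r
  proof -
    obtain N :: nat where N: "x \<le> real N" using real_arch_simple by blast
    obtain n where n: "n \<ge> N" "\<not> (\<exists>r1 r2. 0 \<le> r1 \<and> r1 \<le> r2 \<and> r2 \<le> real T \<and>
      X (real n) r1 \<le> real z \<and> K \<le> X (real n) r2 \<and> (\<forall>u\<in>{0..r2}. 0 < X (real n) u))"
      using K(2) by blast
    obtain u where u: "u \<in> {0..t0}" "X (real n) u \<le> real z" using z by blast
    \<comment> \<open>This solution has been below \<open>z\<close> by time \<open>t0\<close>. A
      value above \<open>K\<close> at time \<open>r\<close> would mean a forbidden climb; the
      positivity demanded in \<open>no_climb\<close> is automatic, since an absorbed path cannot be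
      above \<open>K\<close> later.\<close>
    have "X (real n) r \<le> K"
    proof (rule ccontr)
      assume a: "\<not> X (real n) r \<le> K"
      then have "\<forall>v\<in>{0..r}. 0 < X (real n) v"
        using X_pos_before[of "real n" _ r] K(1) by auto
      then have "0 \<le> u \<and> u \<le> r \<and> r \<le> real T \<and> X (real n) u \<le> real z \<and> K \<le> X (real n) r \<and> (\<forall>u\<in>{0..r}. 0 < X (real n) u)"
        using a u r T by auto
      then show False using n(2) by blast
    qed
    moreover have "X x r \<le> X (real n) r" using mono[of x "real n" r] x N n(1) r assms by auto
    ultimately show ?thesis by simp
  qed
  then show ?thesis using K(1) by blast
qed

lemma drift_cont: "0 \<le> x \<Longrightarrow> continuous_on {0..} (\<lambda>u. q (X x u))"
  by (rule continuous_on_compose2[OF q X_cont]) (auto intro: X_nonneg)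

lemma X_eq:
  assumes x: "0 < x" and v: "0 \<le> v" and pos: "\<And>u. 0 \<le> u \<Longrightarrow> u < v \<Longrightarrow> 0 < X x u"
  shows "X x v = x + b v - integral {0..v} (\<lambda>u. q (X x u))"
proof (cases "v = 0")
  case True
  then show ?thesis using X_0[of x] x b0 by simp
next
  case False
  have x0: "0 \<le> x" using x by simp
  have "(\<lambda>u. q (X x u)) integrable_on {0..v}"
    by (intro integrable_continuous_real continuous_on_subset[OF drift_cont[OF x0]]) auto
  then have "continuous_on {0..v} (\<lambda>w. integral {0..w} (\<lambda>u. q (X x u)))"
    by (rule indefinite_integral_continuous_1)
  then have "continuous_on {0..v} (\<lambda>w. x + b w - integral {0..w} (\<lambda>u. q (X x u)))"
    by (intro continuous_intros continuous_on_subset[OF b]) auto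
  moreover have "continuous_on {0..v} (X x)" by (rule continuous_on_subset[OF X_cont[OF x0]]) auto
  moreover have "X x w = x + b w - integral {0..w} (\<lambda>u. q (X x u))" if "w \<in> {0..<v}" for w
    by (rule stopped_solutionD(3)[OF sol[OF x0]]) (use that pos in auto)
  ultimately show ?thesis using v False by (intro agree_at_endpoint[of 0 v "X x"]) auto
qed

lemma X_increment:
  assumes x: "0 < x" and uv: "0 \<le> u" "u \<le> v" and pos: "\<And>w. 0 \<le> w \<Longrightarrow> w < v \<Longrightarrow> 0 < X x w"
  shows "X x v = X x u + b v - b u - integral {u..v} (\<lambda>w. q (X x w))"
proof -
  have int: "(\<lambda>w. q (X x w)) integrable_on {0..v}"
    using x by (intro integrable_continuous_real continuous_on_subset[OF drift_cont]) auto
  have "integral {0..v} (\<lambda>w. q (X x w)) = integral {0..u} (\<lambda>w. q (X x w)) + integral {u..v} (\<lambda>w. q (X x w))"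
    using Henstock_Kurzweil_Integration.integral_combine[OF uv int] by simp
  moreover have "X x u = x + b u - integral {0..u} (\<lambda>w. q (X x w))"
    using uv by (intro X_eq x pos) auto
  moreover have "X x v = x + b v - integral {0..v} (\<lambda>w. q (X x w))"
    using uv by (intro X_eq x pos) auto
  ultimately show ?thesis by simp
qed

text \<open>On \<open>{s..t}\<close> all solutions have values in one compact set, so their drifts
  share a bound, and the noise \<open>b\<close> is common to all of them. Hence one modulus of
  continuity serves every starting point.\<close>

lemma X_equicontinuous:
  assumes s: "0 < s" and e: "0 < e"
  shows "\<exists>\<delta>>0. \<forall>x>0. \<forall>u\<in>{s..t}. \<forall>v\<in>{s..t}. \<bar>u - v\<bar> < \<delta> \<longrightarrow> \<bar>X x u - X x v\<bar> \<le> e"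
proof -
  obtain K where K: "K > 0" "\<forall>x\<ge>0. \<forall>r\<in>{s..t}. X x r \<le> K" using X_bounded[OF s] by blast
  have "bounded (q ` {0..K})"
    by (intro compact_imp_bounded compact_continuous_image compact_Icc continuous_on_subset[OF q]) auto
  then have "\<exists>Q. \<forall>y\<in>q ` {0..K}. norm y \<le> Q" by (subst (asm) bounded_iff)
  then obtain Q where "\<forall>y\<in>q ` {0..K}. norm y \<le> Q" ..
  then have Q: "\<bar>q y\<bar> \<le> \<bar>Q\<bar>" if "y \<in> {0..K}" for y using that by force
  have "uniformly_continuous_on {s..t} b"
    by (rule compact_uniformly_continuous[OF continuous_on_subset[OF b] compact_Icc]) (use s in auto)
  moreover have e2: "0 < e / 2" using e by simp
  ultimately obtain \<delta>1 where \<delta>1: "\<delta>1 > 0" "\<And>u v. u \<in> {s..t} \<Longrightarrow> v \<in> {s..t} \<Longrightarrow> \<bar>v - u\<bar> < \<delta>1 \<Longrightarrow> \<bar>b v - b u\<bar> < e / 2"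
    unfolding uniformly_continuous_on_def dist_real_def by metis
  define \<delta> where "\<delta> = min \<delta>1 (e / (2 * (\<bar>Q\<bar> + 1)))"
  have \<delta>: "0 < \<delta>" "\<delta> \<le> \<delta>1" using \<delta>1(1) e by (auto simp: \<delta>_def)
  have ordered: "\<bar>X x v - X x u\<bar> \<le> e"
    if x: "0 < x" and u: "u \<in> {s..t}" and v: "v \<in> {s..t}" and uv: "u \<le> v" "v - u < \<delta>" for x u v
  proof -
    have x0: "0 \<le> x" using x by simp
    have move: "\<bar>X x w - X x u\<bar> \<le> e" if w: "u \<le> w" "w \<le> v" and pos: "\<And>r. 0 \<le> r \<Longrightarrow> r < w \<Longrightarrow> 0 < X x r" for w
    proof -
      have eq: "X x w = X x u + b w - b u - integral {u..w} (\<lambda>r. q (X x r))"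
        using w u s by (intro X_increment x pos) auto
      have "norm (integral {u..w} (\<lambda>r. q (X x r))) \<le> \<bar>Q\<bar> * (w - u)"
      proof (rule integral_bound[OF w(1)])
        show "continuous_on {u..w} (\<lambda>r. q (X x r))"
          by (rule continuous_on_subset[OF drift_cont[OF x0]]) (use u s in auto)
        fix r assume "r \<in> {u..w}"
        then have "X x r \<in> {0..K}" using K(2) x0 u v w s X_nonneg[of x r] by auto
        then show "norm (q (X x r)) \<le> \<bar>Q\<bar>" using Q by simp
      qed
      also have "\<dots> \<le> (\<bar>Q\<bar> + 1) * \<delta>" using w uv by (intro mult_mono) auto
      also have "\<dots> \<le> (\<bar>Q\<bar> + 1) * (e / (2 * (\<bar>Q\<bar> + 1)))" by (intro mult_left_mono) (auto simp: \<delta>_def)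
      also have "\<dots> = e / 2" by (simp add: field_simps)
      finally have "\<bar>integral {u..w} (\<lambda>r. q (X x r))\<bar> \<le> e / 2" by simp
      moreover have "\<bar>b w - b u\<bar> < e / 2" using w u v uv \<delta> by (intro \<delta>1(2)) auto
      ultimately show ?thesis using eq by linarith
    qed
    show ?thesis
    proof (cases "0 < X x v")
      case True
      then show ?thesis using X_pos_before[of x _ v] x v by (intro move) (use uv in auto)
    next
      case False
      then have Xv: "X x v = 0" using X_nonneg[of x v] x0 v s by auto
      then have "hit (X x) 0 \<le> ereal v" using v s by (intro hit_le) auto
      then have "hit (X x) 0 \<noteq> \<infinity>" by auto
      then obtain \<tau> where \<tau>: "0 \<le> \<tau>" "hit (X x) 0 = ereal \<tau>" "X x \<tau> = 0" "\<And>u. 0 \<le> u \<Longrightarrow> u < \<tau> \<Longrightarrow> X x u \<noteq> 0"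
        using hit_attained[OF X_cont[OF x0]] by metis
      have \<tau>v: "\<tau> \<le> v" using \<tau>(2) \<open>hit (X x) 0 \<le> ereal v\<close> by simp
      show ?thesis
      proof (cases "\<tau> \<le> u")
        case True
        then have "X x u = 0" by (rule X_absorbed[OF x0 \<tau>(1,3)])
        then show ?thesis using Xv e by simp
      next
        case False
        have "\<bar>X x \<tau> - X x u\<bar> \<le> e"
        proof (rule move)
          fix r assume "0 \<le> r" "r < \<tau>"
          then show "0 < X x r" using \<tau>(4)[of r] X_nonneg[of x r] x0 by (simp add: less_le)
        qed (use False \<tau>v in auto)
        then show ?thesis using Xv \<tau>(3) by simp
      qed
    qed
  qed
  have "\<bar>X x u - X x v\<bar> \<le> e" if "0 < x" "u \<in> {s..t}" "v \<in> {s..t}" "\<bar>u - v\<bar> < \<delta>" for x u v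
    using ordered[of x u v] ordered[of x v u] that by (cases "u \<le> v") (auto simp: abs_minus_commute)
  then show ?thesis using \<delta>(1) by blast
qed

section \<open>The limit process\<close>

definition Xinf :: "real \<Rightarrow> ereal" where
  "Xinf t = (SUP n::nat. ereal (X (real n) t))"

text \<open>\<open>real_of_ereal\<close> sends infinity to 0, so \<open>Xi\<close> represents the
  limit only at positive times; at time 0 it has the spurious value 0.\<close>

abbreviation Xi :: "real \<Rightarrow> real" where
  "Xi t \<equiv> real_of_ereal (Xinf t)"

lemma X_le_Xinf:
  assumes "0 \<le> x" "0 \<le> t"
  shows "ereal (X x t) \<le> Xinf t"
proof -
  obtain n :: nat where n: "x \<le> real n" using real_arch_simple by blast
  have "ereal (X x t) \<le> ereal (X (real n) t)" using mono[OF assms(1) n assms(2)] by simp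
  also have "\<dots> \<le> Xinf t" unfolding Xinf_def by (rule SUP_upper) simp
  finally show ?thesis .
qed

lemma Xinf_nonneg: "0 \<le> t \<Longrightarrow> 0 \<le> Xinf t"
  using X_le_Xinf[of 0 t] X_nonneg[of 0 t] by (auto intro: order_trans[rotated])

lemma X_tendsto_Xinf:
  assumes t: "0 \<le> t"
  shows "((\<lambda>x. ereal (X x t)) \<longlongrightarrow> Xinf t) at_top"
proof (rule order_tendstoI)
  fix a assume "a < Xinf t"
  then obtain n :: nat where n: "a < ereal (X (real n) t)" unfolding Xinf_def less_SUP_iff by blast
  show "\<forall>\<^sub>F x in at_top. a < ereal (X x t)"
    using eventually_ge_at_top[of "real n"]
  proof eventually_elim
    case (elim x)
    then have "X (real n) t \<le> X x t" using mono[of "real n" x t] t by simp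
    then show ?case using n by (meson ereal_less_eq(3) less_le_trans)
  qed
next
  fix a assume a: "Xinf t < a"
  show "\<forall>\<^sub>F x in at_top. ereal (X x t) < a"
    using eventually_ge_at_top[of "0::real"]
    by eventually_elim (use X_le_Xinf t a in \<open>auto intro: le_less_trans\<close>)
qed

lemma Xinf_finite:
  assumes "0 < t"
  shows "Xinf t < \<infinity>" "Xinf t = ereal (Xi t)"
proof -
  obtain K where "\<forall>x\<ge>0. \<forall>r\<in>{t..t}. X x r \<le> K" using X_bounded[OF assms] by blast
  then have "Xinf t \<le> ereal K" unfolding Xinf_def by (intro SUP_least) auto
  then show 1: "Xinf t < \<infinity>" by (rule le_less_trans) simp
  show "Xinf t = ereal (Xi t)" using 1 Xinf_nonneg[of t] assms by (cases "Xinf t") auto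
qed

lemma X_tendsto_Xi:
  assumes "0 < t"
  shows "((\<lambda>x. X x t) \<longlongrightarrow> Xi t) at_top"
  using X_tendsto_Xinf[of t] assms Xinf_finite(2)[OF assms] by (metis less_imp_le lim_ereal)

lemma Xi_nonneg: "0 \<le> t \<Longrightarrow> 0 \<le> Xi t"
  by (intro real_of_ereal_pos Xinf_nonneg)

lemma Xi_cont: "continuous_on {0<..} Xi"
  unfolding continuous_on_iff
proof (intro ballI allI impI)
  fix t e :: real assume t: "t \<in> {0<..}" and e: "0 < e"
  have t2: "0 < t / 2" and e2: "0 < e / 2" using t e by auto
  obtain \<delta> where \<delta>: "\<delta> > 0" "\<And>x u v. 0 < x \<Longrightarrow> u \<in> {t/2..t+1} \<Longrightarrow> v \<in> {t/2..t+1} \<Longrightarrow> \<bar>u - v\<bar> < \<delta> \<Longrightarrow> \<bar>X x u - X x v\<bar> \<le> e / 2"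
    using X_equicontinuous[OF t2 e2, of "t + 1"] by blast
  show "\<exists>d>0. \<forall>u\<in>{0<..}. dist u t < d \<longrightarrow> dist (Xi u) (Xi t) < e"
  proof (intro exI[of _ "min \<delta> (min (t / 2) 1)"] conjI ballI impI)
    show "0 < min \<delta> (min (t / 2) 1)" using \<delta>(1) t by auto
    fix u assume u: "u \<in> {0<..}" "dist u t < min \<delta> (min (t / 2) 1)"
    have "u \<in> {t/2..t+1}" "t \<in> {t/2..t+1}" "\<bar>u - t\<bar> < \<delta>"
      using u t unfolding dist_real_def atLeastAtMost_iff greaterThan_iff min_less_iff_conj by linarith+
    then have "\<bar>X x u - X x t\<bar> \<le> e / 2" if "0 < x" for x using that by (intro \<delta>(2))
    then have "\<forall>\<^sub>F x in at_top. \<bar>X x u - X x t\<bar> \<le> e / 2"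
      by (rule eventually_mono[OF eventually_gt_at_top[of "0::real"]])
    moreover have "((\<lambda>x. \<bar>X x u - X x t\<bar>) \<longlongrightarrow> \<bar>Xi u - Xi t\<bar>) at_top"
      using u t by (intro tendsto_intros X_tendsto_Xi) auto
    ultimately have "\<bar>Xi u - Xi t\<bar> \<le> e / 2"
      by (intro tendsto_upperbound[of "\<lambda>x. \<bar>X x u - X x t\<bar>"]) auto
    then show "dist (Xi u) (Xi t) < e" using e by (simp add: dist_real_def)
  qed
qed

lemma Xinf_0: "Xinf 0 = \<infinity>"
  unfolding Xinf_def using X_0 by (intro SUP_PInfty) auto

text \<open>At time 0 the limit lies above every continuous path \<open>X (real n)\<close>, which
  starts at \<open>n\<close>, and is thereby forced to infinity. At positive times it is finite and
  inherits the continuity of \<open>Xi\<close>.\<close>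

lemma Xinf_cont: "continuous_on {0..} Xinf"
  unfolding continuous_on_eq_continuous_within
proof
  fix t :: real assume t: "t \<in> {0..}"
  show "continuous (at t within {0..}) Xinf"
  proof (cases "t = 0")
    case True
    have "(Xinf \<longlongrightarrow> \<infinity>) (at 0 within {0..})"
      unfolding tendsto_PInfty
    proof
      fix r :: real
      obtain n :: nat where n: "r < real n" using reals_Archimedean2 by blast
      have "(X (real n) \<longlongrightarrow> X (real n) 0) (at 0 within {0..})"
        using X_cont[of "real n"] by (simp add: continuous_on_def)
      then have "\<forall>\<^sub>F u in at 0 within {0..}. r < X (real n) u"
        using n X_0[of "real n"] by (intro order_tendstoD(1)) auto
      moreover have "\<forall>\<^sub>F u in at 0 within {0..}. (0::real) \<le> u" by (auto simp: eventually_at_filter)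
      ultimately show "\<forall>\<^sub>F u in at 0 within {0..}. ereal r < Xinf u"
      proof eventually_elim
        case (elim u)
        then have "ereal r < ereal (X (real n) u)" by simp
        also have "\<dots> \<le> Xinf u" using elim by (intro X_le_Xinf) auto
        finally show ?case .
      qed
    qed
    then show ?thesis using True Xinf_0 by (simp add: continuous_within)
  next
    case False
    then have t0: "0 < t" using t by simp
    have "isCont Xi t" using Xi_cont t0 by (simp add: continuous_on_eq_continuous_at)
    then have "((\<lambda>u. ereal (Xi u)) \<longlongrightarrow> ereal (Xi t)) (at t)"
      by (intro tendsto_ereal) (simp add: isCont_def)
    then have "(Xinf \<longlongrightarrow> ereal (Xi t)) (at t)"
    proof (rule Lim_transform_eventually)
      have "\<forall>\<^sub>F u in at t. u \<in> {0<..}" using t0 by (intro eventually_at_in_open') auto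
      then show "\<forall>\<^sub>F u in at t. ereal (Xi u) = Xinf u"
        by eventually_elim (use Xinf_finite(2) in auto)
    qed
    then have "isCont Xinf t" unfolding isCont_def using Xinf_finite(2)[OF t0] by simp
    then show ?thesis by (rule continuous_at_imp_continuous_at_within)
  qed
qed

section \<open>Convergence of hitting times\<close>

lemma hit_X_mono:
  assumes "0 \<le> z" "z < x" "x \<le> y"
  shows "hit (X x) z \<le> hit (X y) z"
proof (cases "hit (X y) z = \<infinity>")
  case False
  have y0: "0 \<le> y" using assms by simp
  obtain \<tau> where \<tau>: "0 \<le> \<tau>" "hit (X y) z = ereal \<tau>" "X y \<tau> = z"
    using hit_attained[OF X_cont[OF y0] False] by metis
  have "X x \<tau> \<le> z" using mono[of x y \<tau>] assms \<tau> by simp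
  then obtain u where "u \<in> {0..\<tau>}" "X x u = z" using X_crosses[of z x \<tau>] assms \<tau> by auto
  then have "hit (X x) z \<le> ereal u" by (intro hit_le) auto
  also have "\<dots> \<le> ereal \<tau>" using \<open>u \<in> {0..\<tau>}\<close> by simp
  finally show ?thesis using \<tau> by simp
qed simp

lemma hit_X_le_hit_Xinf:
  assumes "0 \<le> z" "z < x"
  shows "hit (X x) z \<le> hit Xinf (ereal z)"
proof (cases "hit Xinf (ereal z) = \<infinity>")
  case False
  obtain \<tau> where \<tau>: "0 \<le> \<tau>" "hit Xinf (ereal z) = ereal \<tau>" "Xinf \<tau> = ereal z"
    using hit_attained[OF Xinf_cont False] by metis
  have "X x \<tau> \<le> z" using X_le_Xinf[of x \<tau>] assms \<tau> by simp
  then obtain u where "u \<in> {0..\<tau>}" "X x u = z" using X_crosses[of z x \<tau>] assms \<tau> by auto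
  then have "hit (X x) z \<le> ereal u" by (intro hit_le) auto
  also have "\<dots> \<le> ereal \<tau>" using \<open>u \<in> {0..\<tau>}\<close> by simp
  finally show ?thesis using \<tau> by simp
qed simp

text \<open>This is the inequality that monotonicity alone does not give. If the hitting times
  increase to a finite \<open>T\<close>, the solutions equal \<open>z\<close> at times close to
  \<open>T\<close>, and equicontinuity makes their values at \<open>T\<close> converge to
  \<open>z\<close>.\<close>

lemma hit_Xinf_le_SUP:
  assumes z: "0 \<le> z"
  shows "hit Xinf (ereal z) \<le> (SUP x\<in>{z<..}. hit (X x) z)"
proof (cases "(SUP x\<in>{z<..}. hit (X x) z) = \<infinity>")
  case False
  have up: "hit (X x) z \<le> (SUP x\<in>{z<..}. hit (X x) z)" if "z < x" for x
    using that by (intro SUP_upper) auto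
  have "0 \<le> (SUP x\<in>{z<..}. hit (X x) z)"
    using up[of "z + 1"] hit_nonneg[of "X (z + 1)" z] by (simp add: order_trans)
  then obtain T where T: "(SUP x\<in>{z<..}. hit (X x) z) = ereal T"
    using False by (cases "SUP x\<in>{z<..}. hit (X x) z") auto
  have "\<exists>h. 0 < h \<and> hit (X x) z = ereal h \<and> X x h = z" if x: "z < x" for x
  proof -
    have x0: "0 \<le> x" using x z by simp
    have "hit (X x) z \<noteq> \<infinity>" using up[OF x] T by auto
    then obtain h where h: "0 \<le> h" "hit (X x) z = ereal h" "X x h = z"
      using hit_attained[OF X_cont[OF x0]] by metis
    then show ?thesis using X_0[OF x0] x by (intro exI[of _ h]) (auto simp: less_le)
  qed
  then obtain h where h: "\<And>x. z < x \<Longrightarrow> 0 < h x" "\<And>x. z < x \<Longrightarrow> hit (X x) z = ereal (h x)"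
      "\<And>x. z < x \<Longrightarrow> X x (h x) = z" by metis
  have hT: "h x \<le> T" if "z < x" for x using up[OF that] h(2)[OF that] T by simp
  have hmono: "h x \<le> h y" if "z < x" "x \<le> y" for x y
    using hit_X_mono[OF z that] h(2)[of x] h(2)[of y] that by simp
  \<comment> \<open>From the starting point \<open>z + 1\<close> on, all hitting times lie in
    \<open>{s..T}\<close>, away from time 0, near which no uniform modulus is available.\<close>
  define s where "s = h (z + 1)"
  have s: "0 < s" "s \<le> T" using h(1)[of "z+1"] hT[of "z+1"] by (auto simp: s_def)
  have T0: "0 < T" using s by simp
  have "((\<lambda>x. X x T) \<longlongrightarrow> z) at_top"
  proof (rule tendstoI)
    fix e :: real assume e: "0 < e"
    then have e2: "0 < e / 2" by simp
    obtain \<delta> where \<delta>: "\<delta> > 0" "\<And>x u v. 0 < x \<Longrightarrow> u \<in> {s..T} \<Longrightarrow> v \<in> {s..T} \<Longrightarrow> \<bar>u - v\<bar> < \<delta> \<Longrightarrow> \<bar>X x u - X x v\<bar> \<le> e / 2"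
      using X_equicontinuous[OF s(1) e2, of T] by blast
    have "ereal (T - \<delta>) < (SUP x\<in>{z<..}. hit (X x) z)" using \<delta>(1) T by simp
    then obtain x0 where x0: "z < x0" "ereal (T - \<delta>) < hit (X x0) z" unfolding less_SUP_iff by auto
    show "\<forall>\<^sub>F x in at_top. dist (X x T) z < e"
      using eventually_ge_at_top[of x0] eventually_ge_at_top[of "z + 1"]
    proof eventually_elim
      case (elim x)
      then have zx: "z < x" by simp
      have "T - \<delta> < h x" using x0 h(2)[OF x0(1)] hmono[OF x0(1) elim(1)] by simp
      moreover have "s \<le> h x" using hmono[of "z + 1" x] elim by (simp add: s_def)
      ultimately have "\<bar>X x T - X x (h x)\<bar> \<le> e / 2"
        using hT[OF zx] s zx z by (intro \<delta>(2)) auto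
      then show ?case using h(3)[OF zx] e by (simp add: dist_real_def)
    qed
  qed
  then have "Xi T = z"
    using X_tendsto_Xi[OF T0] by (intro tendsto_unique[of at_top "\<lambda>x. X x T"]) auto
  then have "Xinf T = ereal z" using Xinf_finite(2)[OF T0] by simp
  then have "hit Xinf (ereal z) \<le> ereal T" using T0 by (intro hit_le) auto
  then show ?thesis using T by simp
qed simp

lemma hit_tendsto:
  assumes z: "0 \<le> z"
  shows "((\<lambda>x. hit (X x) z) \<longlongrightarrow> hit Xinf (ereal z)) at_top"
proof (rule order_tendstoI)
  fix a assume "a < hit Xinf (ereal z)"
  then have "a < (SUP x\<in>{z<..}. hit (X x) z)" using hit_Xinf_le_SUP[OF z] by (rule less_le_trans)
  then obtain x0 where x0: "z < x0" "a < hit (X x0) z" unfolding less_SUP_iff by auto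
  show "\<forall>\<^sub>F x in at_top. a < hit (X x) z"
    using eventually_ge_at_top[of x0]
    by eventually_elim (use hit_X_mono[OF z x0(1)] x0(2) in \<open>auto intro: less_le_trans\<close>)
next
  fix a assume a: "hit Xinf (ereal z) < a"
  show "\<forall>\<^sub>F x in at_top. hit (X x) z < a"
    using eventually_gt_at_top[of z]
    by eventually_elim (use hit_X_le_hit_Xinf[OF z] a in \<open>auto intro: le_less_trans\<close>)
qed

text \<open>Reduces the exponential moments for every level to a tail bound for the hitting time of
  0.\<close>

lemma hit_Xinf_le_hit_0:
  assumes z: "0 \<le> z"
  shows "hit Xinf (ereal z) \<le> hit Xinf 0"
proof (rule tendsto_le[OF _ _ hit_tendsto[OF z]])
  show "((\<lambda>x. hit (X x) 0) \<longlongrightarrow> hit Xinf 0) at_top"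
    using hit_tendsto[of 0] by (simp add: zero_ereal_def)
  show "\<forall>\<^sub>F x in at_top. hit (X x) z \<le> hit (X x) 0"
    using eventually_gt_at_top[of z]
  proof eventually_elim
    case (elim x)
    show ?case
    proof (cases "hit (X x) 0 = \<infinity>")
      case False
      have x0: "0 \<le> x" using elim z by simp
      obtain \<tau> where \<tau>: "0 \<le> \<tau>" "hit (X x) 0 = ereal \<tau>" "X x \<tau> = 0"
        using hit_attained[OF X_cont[OF x0] False] by metis
      then obtain u where "u \<in> {0..\<tau>}" "X x u = z" using X_crosses[of z x \<tau>] elim z by auto
      then have "hit (X x) z \<le> ereal u" by (intro hit_le) auto
      also have "\<dots> \<le> ereal \<tau>" using \<open>u \<in> {0..\<tau>}\<close> by simp
      finally show ?thesis using \<tau> by simp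
    qed simp
  qed
qed simp

section \<open>The integral equation in the limit\<close>

lemma eventually_alive:
  assumes t: "0 \<le> t" and "ereal t < hit Xinf 0"
  shows "\<forall>\<^sub>F x in at_top. \<forall>u\<in>{0..t}. 0 < X x u"
proof -
  have "\<forall>\<^sub>F x in at_top. ereal t < hit (X x) 0"
    using hit_tendsto[of 0] assms(2) by (intro order_tendstoD(1)) (auto simp: zero_ereal_def)
  then show ?thesis
    using eventually_gt_at_top[of "0::real"]
  proof eventually_elim
    case (elim x)
    show ?case
    proof
      fix u assume u: "u \<in> {0..t}"
      have "X x u \<noteq> 0"
      proof
        assume "X x u = 0"
        then have "hit (X x) 0 \<le> ereal u" using u by (intro hit_le) auto
        also have "\<dots> \<le> ereal t" using u by simp
        finally show False using elim by simp
      qed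
      then show "0 < X x u" using X_nonneg[of x u] elim u by (simp add: less_le)
    qed
  qed
qed

text \<open>The strict inequality ensures that for large starting points the whole path on
  \<open>{0..t}\<close> is positive and hence obeys the equation.\<close>

lemma Xi_increment_before:
  assumes st: "0 < s" "s \<le> t" and alive: "ereal t < hit Xinf 0"
  shows "Xi t = Xi s + b t - b s - integral {s..t} (\<lambda>u. q (Xi u))"
proof -
  obtain K where K: "K > 0" "\<forall>x\<ge>0. \<forall>r\<in>{s..t}. X x r \<le> K" using X_bounded[OF st(1)] by blast
  have "bounded (q ` {0..K})"
    by (intro compact_imp_bounded compact_continuous_image compact_Icc continuous_on_subset[OF q]) auto
  then have "\<exists>Q. \<forall>y\<in>q ` {0..K}. norm y \<le> Q" by (subst (asm) bounded_iff)
  then obtain Q where Q: "\<forall>y\<in>q ` {0..K}. norm y \<le> Q" ..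
  have seq: "(\<lambda>n. X (real n) u) \<longlonglongrightarrow> Xi u" if "0 < u" for u
    by (rule filterlim_compose[OF X_tendsto_Xi[OF that] filterlim_real_sequentially])
  have "(\<lambda>n. integral {s..t} (\<lambda>u. q (X (real n) u))) \<longlonglongrightarrow> integral {s..t} (\<lambda>u. q (Xi u))"
  proof (rule dominated_convergence(2))
    show "(\<lambda>u. q (X (real n) u)) integrable_on {s..t}" for n
      using st by (intro integrable_continuous_real continuous_on_subset[OF drift_cont]) auto
    show "(\<lambda>_. Q) integrable_on {s..t}" by (rule integrable_const_ivl)
    show "norm (q (X (real n) u)) \<le> Q" if "u \<in> {s..t}" for n u
      using Q K(2) that st X_nonneg[of "real n" u] by auto
    show "(\<lambda>n. q (X (real n) u)) \<longlonglongrightarrow> q (Xi u)" if "u \<in> {s..t}" for u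
    proof (rule continuous_on_tendsto_compose[OF q])
      show "(\<lambda>n. X (real n) u) \<longlonglongrightarrow> Xi u" using that st by (intro seq) auto
    qed (use that st in \<open>auto intro!: Xi_nonneg X_nonneg always_eventually\<close>)
  qed
  then have "(\<lambda>n. X (real n) s + b t - b s - integral {s..t} (\<lambda>u. q (X (real n) u)))
      \<longlonglongrightarrow> Xi s + b t - b s - integral {s..t} (\<lambda>u. q (Xi u))"
    using st by (intro tendsto_intros seq) auto
  moreover have "\<forall>\<^sub>F n in sequentially. X (real n) s + b t - b s - integral {s..t} (\<lambda>u. q (X (real n) u)) = X (real n) t"
  proof -
    have "\<forall>\<^sub>F x in at_top. (\<forall>u\<in>{0..t}. 0 < X x u) \<and> 0 < x"
      using st alive by (intro eventually_conj eventually_alive eventually_gt_at_top) auto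
    then have "\<forall>\<^sub>F n in sequentially. (\<forall>u\<in>{0..t}. 0 < X (real n) u) \<and> 0 < real n"
      by (rule eventually_compose_filterlim[OF _ filterlim_real_sequentially])
    then show ?thesis
      by eventually_elim (use st in \<open>subst X_increment[of _ s t]; auto\<close>)
  qed
  ultimately have "(\<lambda>n. X (real n) t) \<longlonglongrightarrow> Xi s + b t - b s - integral {s..t} (\<lambda>u. q (Xi u))"
    by (rule Lim_transform_eventually)
  then show ?thesis using seq[of t] st by (intro LIMSEQ_unique) auto
qed

text \<open>At the hitting time of the limit the approximating solutions may all have been absorbed
  already, so the endpoint is reached by continuity instead.\<close>

lemma Xi_increment:
  assumes st: "0 < s" "s \<le> t" and alive: "ereal t \<le> hit Xinf 0"
  shows "Xi t = Xi s + b t - b s - integral {s..t} (\<lambda>u. q (Xi u))"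
proof (cases "s = t")
  case True
  then show ?thesis by simp
next
  case False
  have Xic: "continuous_on {s..t} Xi" by (rule continuous_on_subset[OF Xi_cont]) (use st in auto)
  have "continuous_on {s..t} (\<lambda>u. q (Xi u))"
    by (rule continuous_on_compose2[OF q Xic]) (use st in \<open>auto intro: Xi_nonneg\<close>)
  then have "continuous_on {s..t} (\<lambda>w. integral {s..w} (\<lambda>u. q (Xi u)))"
    by (intro indefinite_integral_continuous_1 integrable_continuous_real)
  then have c: "continuous_on {s..t} (\<lambda>w. Xi s + b w - b s - integral {s..w} (\<lambda>u. q (Xi u)))"
    using st by (intro continuous_intros continuous_on_subset[OF b]) auto
  have "s < t" using st False by simp
  then show ?thesis
  proof (rule agree_at_endpoint[OF Xic c])
    fix w assume w: "w \<in> {s..<t}"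
    show "Xi w = Xi s + b w - b s - integral {s..w} (\<lambda>u. q (Xi u))"
    proof (rule Xi_increment_before)
      have "ereal w < ereal t" using w by simp
      then show "ereal w < hit Xinf 0" using alive by (rule less_le_trans)
    qed (use st w in auto)
  qed
qed

end

section \<open>Coming down from infinity\<close>

text \<open>Taking \<open>S\<close> as the supremum, approached but never attained, makes
  \<open>S - U (z / 2)\<close> positive and arbitrarily small for large \<open>z\<close>.\<close>

lemma H1_potential_sup:
  assumes q: "continuous_on {0..} q" and H1: "H1 q"
  obtains U U' W :: "real \<Rightarrow> real" and S where
    "\<And>x. 0 < x \<Longrightarrow> (U has_real_derivative U' x) (at x)"
    "\<And>x. 0 < x \<Longrightarrow> (U' has_real_derivative 2 * q x * U' x - 2) (at x)"
    "\<And>x. 0 < x \<Longrightarrow> 0 < U' x" "\<And>x. 0 < x \<Longrightarrow> 0 \<le> U x" "\<And>x. 0 < x \<Longrightarrow> U x < S"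
    "\<And>e. 0 < e \<Longrightarrow> \<exists>z>0. \<forall>y\<ge>z. S - e < U y"
    "\<And>x. 0 < x \<Longrightarrow> (W has_real_derivative exp (gam q x)) (at x)" "\<And>x. 0 < x \<Longrightarrow> 0 < W x"
    "filterlim W at_top at_top"
proof -
  obtain U U' C and W :: "real \<Rightarrow> real" where
    U: "\<forall>x>0. (U has_real_derivative U' x) (at x)"
    "\<forall>x>0. (U' has_real_derivative 2 * q x * U' x - 2) (at x)"
    "\<forall>x>0. 0 < U' x \<and> 0 \<le> U x \<and> U x \<le> C"
    and W: "\<forall>x>0. 0 < W x \<and> (W has_real_derivative exp (gam q x)) (at x)" "filterlim W at_top at_top"
    using H1_potential[OF q H1] by blast
  define S where "S = Sup (U ` {0<..})"
  have bdd: "bdd_above (U ` {0<..})" using U(3) by (intro bdd_aboveI[of _ C]) auto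
  have le: "U x \<le> S" if "0 < x" for x unfolding S_def using that by (intro cSup_upper bdd) auto
  have mono: "U x \<le> U y" if "0 < x" "x \<le> y" for x y
    by (rule mono_of_deriv[of U U', OF _ _ that]) (use U in \<open>auto intro: less_imp_le\<close>)
  show thesis
  proof (rule that[where U=U and U'=U' and S=S and W=W])
    show "U x < S" if x: "0 < x" for x
    proof -
      have "U x < U (x + 1)"
      proof (rule DERIV_pos_imp_increasing[where f=U and a=x and b="x + 1"])
        fix w assume "x \<le> w"
        then show "\<exists>d. (U has_real_derivative d) (at w) \<and> 0 < d"
          using x U by (intro exI[of _ "U' w"]) auto
      qed simp
      also have "\<dots> \<le> S" using x by (intro le) simp
      finally show ?thesis .
    qed
    show "\<exists>z>0. \<forall>y\<ge>z. S - e < U y" if e: "0 < e" for e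
    proof -
      have "S - e < S" using e by simp
      then have "\<exists>y\<in>U ` {0<..}. S - e < y"
        unfolding S_def by (subst (asm) less_cSup_iff[OF _ bdd]) auto
      then obtain z where "0 < z" "S - e < U z" by auto
      then show ?thesis using mono by (intro exI[of _ z]) (auto intro: less_le_trans)
    qed
  qed (use U W in auto)
qed

section \<open>Removal of the cutoffs and almost sure estimates\<close>

lemma survival_probability:
  fixes U U' q :: "real \<Rightarrow> real"
  assumes BM: "brownian_motion M B" and C1: "C1_on_nonneg q"
    and U: "\<And>x. 0 < x \<Longrightarrow> (U has_real_derivative U' x) (at x)"
    and U': "\<And>x. 0 < x \<Longrightarrow> (U' has_real_derivative 2 * q x * U' x - 2) (at x)"
    and U'_pos: "\<And>x. 0 < x \<Longrightarrow> 0 < U' x" and S: "\<And>x. 0 < x \<Longrightarrow> U x < S"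
    and z: "0 < z" and t: "0 < t"
    and sol: "AE \<omega> in M. \<forall>x\<ge>0. stopped_solution q (\<lambda>t. B t \<omega>) x (\<lambda>t. X x t \<omega>)"
    and mono: "AE \<omega> in M. \<forall>x y t. 0 \<le> x \<and> x \<le> y \<and> 0 \<le> t \<longrightarrow> X x t \<omega> \<le> X y t \<omega>"
  shows "prob_space.outer_le M (\<lambda>\<omega>. \<exists>n::nat. \<forall>u\<in>{0..t}. z < X (real n) u \<omega>) (2 * exp (- t / (4 * (S - U (z / 2)))))"
    (is "prob_space.outer_le M _ ?p")
proof -
  interpret prob_space M using BM by (simp add: brownian_motion_def)
  \<comment> \<open>For a single starting point the cutoff \<open>K\<close> disappears because a
    continuous path is bounded on \<open>{0..t}\<close>.\<close>
  have "outer_le (\<lambda>\<omega>. \<forall>u\<in>{0..t}. z < X (real n) u \<omega>) ?p" for n :: nat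
  proof (rule outer_le_liminf[where P="\<lambda>K \<omega>. \<forall>u\<in>{0..t}. z \<le> X (real n) u \<omega> \<and> X (real n) u \<omega> \<le> real K" and N=0])
    have "AE \<omega> in M. stopped_solution q (\<lambda>t. B t \<omega>) (real n) (\<lambda>t. X (real n) t \<omega>)"
      using sol by eventually_elim simp
    then show "outer_le (\<lambda>\<omega>. \<forall>u\<in>{0..t}. z \<le> X (real n) u \<omega> \<and> X (real n) u \<omega> \<le> real K) ?p" for K
      by (intro stay_probability[where X="X (real n)", OF BM C1 U U' U'_pos S z t])
    show "AE \<omega> in M. (\<forall>u\<in>{0..t}. z < X (real n) u \<omega>) \<longrightarrow>
        (\<exists>m. \<forall>K\<ge>m. \<forall>u\<in>{0..t}. z \<le> X (real n) u \<omega> \<and> X (real n) u \<omega> \<le> real K)"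
      using sol
    proof eventually_elim
      case (elim \<omega>)
      show ?case
      proof
        assume low: "\<forall>u\<in>{0..t}. z < X (real n) u \<omega>"
        have "continuous_on {0..t} (\<lambda>u. X (real n) u \<omega>)"
          using elim by (intro continuous_on_subset[OF stopped_solutionD(2)[of q "\<lambda>t. B t \<omega>" "real n"]]) auto
        then have "\<exists>x\<in>{0..t}. \<forall>y\<in>{0..t}. X (real n) y \<omega> \<le> X (real n) x \<omega>"
          using t by (intro continuous_attains_sup) auto
        then obtain x where x: "\<forall>y\<in>{0..t}. X (real n) y \<omega> \<le> X (real n) x \<omega>" by blast
        obtain m :: nat where "X (real n) x \<omega> \<le> real m" using real_arch_simple by blast
        then have "X (real n) u \<omega> \<le> real K" if "u \<in> {0..t}" "K \<ge> m" for u and K :: nat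
          using bspec[OF x that(1)] that(2) by linarith
        then show "\<exists>m. \<forall>K\<ge>m. \<forall>u\<in>{0..t}. z \<le> X (real n) u \<omega> \<and> X (real n) u \<omega> \<le> real K"
          using low by (meson less_imp_le)
      qed
    qed
  qed
  then show ?thesis
  proof (rule outer_le_liminf[where P="\<lambda>n \<omega>. \<forall>u\<in>{0..t}. z < X (real n) u \<omega>" and N=0])
    \<comment> \<open>The events increase with \<open>n\<close>, so their union is their limit
      inferior and obeys the same bound.\<close>
    show "AE \<omega> in M. (\<exists>n::nat. \<forall>u\<in>{0..t}. z < X (real n) u \<omega>) \<longrightarrow> (\<exists>m::nat. \<forall>n\<ge>m. \<forall>u\<in>{0..t}. z < X (real n) u \<omega>)"
      using mono
    proof eventually_elim
      case (elim \<omega>)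
      have "z < X (real n) u \<omega>" if "m \<le> n" "u \<in> {0..t}" "z < X (real m) u \<omega>" for m n :: nat and u
      proof -
        have "X (real m) u \<omega> \<le> X (real n) u \<omega>" using elim that by simp
        then show ?thesis using that by simp
      qed
      then show ?case by blast
    qed
  qed
qed

text \<open>Letting the level tend to 0 along \<open>1 / (m + 1)\<close>: a positive continuous path
  has a positive minimum on \<open>{0..t}\<close>, and \<open>0 \<le> U\<close> keeps the rate at
  least \<open>1 / (4 * S)\<close>.\<close>

lemma alive_probability:
  fixes U U' q :: "real \<Rightarrow> real"
  assumes BM: "brownian_motion M B" and C1: "C1_on_nonneg q"
    and U: "\<And>x. 0 < x \<Longrightarrow> (U has_real_derivative U' x) (at x)"
    and U': "\<And>x. 0 < x \<Longrightarrow> (U' has_real_derivative 2 * q x * U' x - 2) (at x)"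
    and U'_pos: "\<And>x. 0 < x \<Longrightarrow> 0 < U' x" and S: "\<And>x. 0 < x \<Longrightarrow> U x < S" and U0: "\<And>x. 0 < x \<Longrightarrow> 0 \<le> U x"
    and t: "0 < t"
    and sol: "AE \<omega> in M. \<forall>x\<ge>0. stopped_solution q (\<lambda>t. B t \<omega>) x (\<lambda>t. X x t \<omega>)"
    and mono: "AE \<omega> in M. \<forall>x y t. 0 \<le> x \<and> x \<le> y \<and> 0 \<le> t \<longrightarrow> X x t \<omega> \<le> X y t \<omega>"
  shows "prob_space.outer_le M (\<lambda>\<omega>. \<exists>n::nat. \<forall>u\<in>{0..t}. 0 < X (real n) u \<omega>) (2 * exp (- t / (4 * S)))"
proof -
  interpret prob_space M using BM by (simp add: brownian_motion_def)
  show ?thesis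
  proof (rule outer_le_liminf[where P="\<lambda>m \<omega>. \<exists>n::nat. \<forall>u\<in>{0..t}. inverse (real (Suc m)) < X (real n) u \<omega>" and N=0])
    fix m :: nat
    define z where "z = inverse (real (Suc m))"
    have z: "0 < z" by (simp add: z_def)
    have "0 < S - U (z / 2)" "S - U (z / 2) \<le> S" using S[of "z / 2"] U0[of "z / 2"] z by auto
    then have "t / (4 * S) \<le> t / (4 * (S - U (z / 2)))" using t by (intro divide_left_mono) auto
    then have le: "2 * exp (- t / (4 * (S - U (z / 2)))) \<le> 2 * exp (- t / (4 * S))" by simp
    show "outer_le (\<lambda>\<omega>. \<exists>n::nat. \<forall>u\<in>{0..t}. inverse (real (Suc m)) < X (real n) u \<omega>) (2 * exp (- t / (4 * S)))"
      unfolding z_def[symmetric]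
      by (rule outer_le_mono[OF survival_probability[OF BM C1 U U' U'_pos S z t sol mono] _ le]) simp_all
  next
    show "AE \<omega> in M. (\<exists>n::nat. \<forall>u\<in>{0..t}. 0 < X (real n) u \<omega>) \<longrightarrow>
        (\<exists>k. \<forall>m\<ge>k. \<exists>n::nat. \<forall>u\<in>{0..t}. inverse (real (Suc m)) < X (real n) u \<omega>)"
      using sol
    proof eventually_elim
      case (elim \<omega>)
      show ?case
      proof
        assume "\<exists>n::nat. \<forall>u\<in>{0..t}. 0 < X (real n) u \<omega>"
        then obtain n :: nat where n: "\<forall>u\<in>{0..t}. 0 < X (real n) u \<omega>" by blast
        have "continuous_on {0..t} (\<lambda>u. X (real n) u \<omega>)"
          using elim by (intro continuous_on_subset[OF stopped_solutionD(2)[of q "\<lambda>t. B t \<omega>" "real n"]]) auto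
        then have "\<exists>x\<in>{0..t}. \<forall>y\<in>{0..t}. X (real n) x \<omega> \<le> X (real n) y \<omega>"
          using t by (intro continuous_attains_inf) auto
        then obtain x where x: "x \<in> {0..t}" "\<forall>y\<in>{0..t}. X (real n) x \<omega> \<le> X (real n) y \<omega>" by blast
        obtain k where k: "inverse (real (Suc k)) < X (real n) x \<omega>"
          using reals_Archimedean n x(1) by blast
        have "inverse (real (Suc m)) < X (real n) u \<omega>" if "k \<le> m" "u \<in> {0..t}" for m u
        proof -
          have "inverse (real (Suc m)) \<le> inverse (real (Suc k))" using that by (intro le_imp_inverse_le) auto
          then show ?thesis using k bspec[OF x(2) that(2)] by linarith
        qed
        then show "\<exists>k. \<forall>m\<ge>k. \<exists>n::nat. \<forall>u\<in>{0..t}. inverse (real (Suc m)) < X (real n) u \<omega>" by blast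
      qed
    qed
  qed
qed

lemma fast_descent:
  fixes U U' q :: "real \<Rightarrow> real"
  assumes BM: "brownian_motion M B" and C1: "C1_on_nonneg q"
    and U: "\<And>x. 0 < x \<Longrightarrow> (U has_real_derivative U' x) (at x)"
    and U': "\<And>x. 0 < x \<Longrightarrow> (U' has_real_derivative 2 * q x * U' x - 2) (at x)"
    and U'_pos: "\<And>x. 0 < x \<Longrightarrow> 0 < U' x" and S: "\<And>x. 0 < x \<Longrightarrow> U x < S"
    and S': "\<And>e. 0 < e \<Longrightarrow> \<exists>z>0. \<forall>y\<ge>z. S - e < U y"
    and t: "0 < t"
    and sol: "AE \<omega> in M. \<forall>x\<ge>0. stopped_solution q (\<lambda>t. B t \<omega>) x (\<lambda>t. X x t \<omega>)"
    and mono: "AE \<omega> in M. \<forall>x y t. 0 \<le> x \<and> x \<le> y \<and> 0 \<le> t \<longrightarrow> X x t \<omega> \<le> X y t \<omega>"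
  shows "AE \<omega> in M. \<exists>z::nat. \<forall>n::nat. \<exists>u\<in>{0..t}. X (real n) u \<omega> \<le> real z"
proof -
  interpret prob_space M using BM by (simp add: brownian_motion_def)
  have "AE \<omega> in M. \<not> (\<forall>z::nat. \<exists>n::nat. \<forall>u\<in>{0..t}. real z < X (real n) u \<omega>)"
  proof (rule outer_le_zero)
    fix p :: real assume p: "0 < p"
    \<comment> \<open>With \<open>w = t / (4 * m)\<close>, \<open>exp (- w) \<le> 1 / w\<close>
      bounds the probability by \<open>8 * m / t\<close>; hence the requirement on \<open>m\<close>.
      The factor 2 in the choice of \<open>z\<close> is there because \<open>U\<close> is evaluated
      at \<open>z / 2\<close>.\<close>
    have "0 < p * t / 8" using p t by simp
    from S'[OF this] obtain z0 where z0: "0 < z0" "\<And>y. y \<ge> z0 \<Longrightarrow> S - p * t / 8 < U y" by blast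
    obtain z :: nat where z: "2 * z0 \<le> real z" using real_arch_simple by blast
    have zp: "0 < real z" using z z0 by linarith
    define m where "m = S - U (real z / 2)"
    have m: "0 < m" "m < p * t / 8"
      using S[of "real z / 2"] zp z0(2)[of "real z / 2"] z by (auto simp: m_def)
    define w where "w = t / (4 * m)"
    have w: "0 < w" using t m by (simp add: w_def)
    have "w \<le> exp w" using exp_ge_add_one_self[of w] by linarith
    then have "exp (- w) \<le> 1 / w" using w by (simp add: exp_minus field_simps)
    then have "2 * exp (- w) \<le> 2 * (1 / w)" by simp
    also have "\<dots> = 8 * m / t" by (simp add: w_def)
    also have "\<dots> \<le> p" using m t by (simp add: field_simps)
    finally have le: "2 * exp (- t / (4 * (S - U (real z / 2)))) \<le> p" by (simp add: w_def m_def)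
    show "outer_le (\<lambda>\<omega>. \<forall>z::nat. \<exists>n::nat. \<forall>u\<in>{0..t}. real z < X (real n) u \<omega>) p"
    proof (rule outer_le_mono[OF survival_probability[OF BM C1 U U' U'_pos S zp t sol mono] _ le])
      show "AE \<omega> in M. (\<forall>z::nat. \<exists>n::nat. \<forall>u\<in>{0..t}. real z < X (real n) u \<omega>) \<longrightarrow>
          (\<exists>n::nat. \<forall>u\<in>{0..t}. real z < X (real n) u \<omega>)"
        by (intro AE_I2) blast
    qed
  qed
  then show ?thesis by eventually_elim (auto simp: not_less)
qed

text \<open>A positive continuous path on \<open>{0..r2}\<close> stays between
  \<open>1 / (m + 1)\<close> and \<open>m\<close> for all large \<open>m\<close>. The condition
  \<open>1 \<le> z\<close> places these lower cutoffs below \<open>z\<close>.\<close>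

lemma climb_probability:
  fixes W q :: "real \<Rightarrow> real"
  assumes BM: "brownian_motion M B" and C1: "C1_on_nonneg q"
    and W: "\<And>x. 0 < x \<Longrightarrow> (W has_real_derivative exp (gam q x)) (at x)" and W_pos: "\<And>x. 0 < x \<Longrightarrow> 0 < W x"
    and z: "1 \<le> z" and zK: "z + 1 < K" "z + 1 < x" and t: "0 < t"
    and sol: "AE \<omega> in M. stopped_solution q (\<lambda>t. B t \<omega>) x (\<lambda>t. X t \<omega>)"
  shows "prob_space.outer_le M (\<lambda>\<omega>. \<exists>r1 r2. 0 \<le> r1 \<and> r1 \<le> r2 \<and> r2 \<le> t \<and> X r1 \<omega> \<le> z \<and> K + 1 \<le> X r2 \<omega> \<and>
      (\<forall>u\<in>{0..r2}. 0 < X u \<omega>)) ((W (z + 1) + t) / W K)"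
    (is "prob_space.outer_le M ?ev ?p")
proof -
  interpret prob_space M using BM by (simp add: brownian_motion_def)
  define P where "P m \<omega> \<longleftrightarrow> (\<exists>r1 r2. 0 \<le> r1 \<and> r1 \<le> r2 \<and> r2 \<le> t \<and> X r1 \<omega> \<le> z \<and> K + 1 \<le> X r2 \<omega> \<and>
      (\<forall>u\<in>{0..r2}. inverse (real (Suc m)) \<le> X u \<omega> \<and> X u \<omega> \<le> real m))" for m \<omega>
  show ?thesis
  proof (rule outer_le_liminf[where P=P and N=0])
    fix m :: nat
    have "inverse (real (Suc m)) \<le> 1" by (simp add: inverse_eq_divide)
    then have "0 < inverse (real (Suc m))" "inverse (real (Suc m)) \<le> z" using z by auto
    from climb_probability_bounded[OF BM C1 W W_pos this zK t sol, of "real m"]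
    show "outer_le (P m) ?p" unfolding P_def[abs_def] .
  next
    show "AE \<omega> in M. ?ev \<omega> \<longrightarrow> (\<exists>k. \<forall>m\<ge>k. P m \<omega>)"
      using sol
    proof eventually_elim
      case (elim \<omega>)
      show ?case
      proof
        assume "?ev \<omega>"
        then obtain r1 r2 where r: "0 \<le> r1" "r1 \<le> r2" "r2 \<le> t" "X r1 \<omega> \<le> z" "K + 1 \<le> X r2 \<omega>"
          and pos: "\<forall>u\<in>{0..r2}. 0 < X u \<omega>" by blast
        have c: "continuous_on {0..r2} (\<lambda>u. X u \<omega>)"
          by (rule continuous_on_subset[OF stopped_solutionD(2)[OF elim]]) auto
        have "\<exists>x\<in>{0..r2}. \<forall>y\<in>{0..r2}. X x \<omega> \<le> X y \<omega>"
          using r c by (intro continuous_attains_inf) auto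
        then obtain x where x: "x \<in> {0..r2}" "\<forall>y\<in>{0..r2}. X x \<omega> \<le> X y \<omega>" by blast
        have "\<exists>x\<in>{0..r2}. \<forall>y\<in>{0..r2}. X y \<omega> \<le> X x \<omega>"
          using r c by (intro continuous_attains_sup) auto
        then obtain x' where x': "\<forall>y\<in>{0..r2}. X y \<omega> \<le> X x' \<omega>" by blast
        obtain k1 where k1: "inverse (real (Suc k1)) < X x \<omega>"
          using reals_Archimedean pos x(1) by blast
        obtain k2 :: nat where k2: "X x' \<omega> \<le> real k2" using real_arch_simple by blast
        have "inverse (real (Suc m)) \<le> X u \<omega> \<and> X u \<omega> \<le> real m" if "max k1 k2 \<le> m" "u \<in> {0..r2}" for m u
        proof
          have "inverse (real (Suc m)) \<le> inverse (real (Suc k1))" using that by (intro le_imp_inverse_le) auto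
          then show "inverse (real (Suc m)) \<le> X u \<omega>" using k1 bspec[OF x(2) that(2)] by linarith
          have "real k2 \<le> real m" using that by simp
          then show "X u \<omega> \<le> real m" using k2 bspec[OF x' that(2)] by linarith
        qed
        then have "P m \<omega>" if "max k1 k2 \<le> m" for m unfolding P_def using r that by blast
        then show "\<exists>k. \<forall>m\<ge>k. P m \<omega>" by blast
      qed
    qed
  qed
qed

text \<open>For fixed \<open>K\<close> the climb events for different \<open>n\<close> are not
  nested, so only their limit inferior inherits the bound. Its complement asks for infinitely many
  \<open>n\<close> without a climb, which is the form of \<open>no_climb\<close>. Letting
  \<open>K\<close> grow removes the exceptional set.\<close>

lemma no_explosion:
  fixes W q :: "real \<Rightarrow> real" and z T :: nat
  assumes BM: "brownian_motion M B" and C1: "C1_on_nonneg q"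
    and W: "\<And>x. 0 < x \<Longrightarrow> (W has_real_derivative exp (gam q x)) (at x)" and W_pos: "\<And>x. 0 < x \<Longrightarrow> 0 < W x"
    and W_lim: "filterlim W at_top at_top"
    and sol: "AE \<omega> in M. \<forall>x\<ge>0. stopped_solution q (\<lambda>t. B t \<omega>) x (\<lambda>t. X x t \<omega>)"
  shows "AE \<omega> in M. \<exists>K>0. \<forall>N. \<exists>n\<ge>N. \<not> (\<exists>r1 r2. 0 \<le> r1 \<and> r1 \<le> r2 \<and> r2 \<le> real T \<and>
      X (real n) r1 \<omega> \<le> real z \<and> K \<le> X (real n) r2 \<omega> \<and> (\<forall>u\<in>{0..r2}. 0 < X (real n) u \<omega>))"
proof -
  interpret prob_space M using BM by (simp add: brownian_motion_def)
  define C where "C K n \<omega> \<longleftrightarrow> (\<exists>r1 r2. 0 \<le> r1 \<and> r1 \<le> r2 \<and> r2 \<le> real T \<and>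
      X (real n) r1 \<omega> \<le> real z \<and> K \<le> X (real n) r2 \<omega> \<and> (\<forall>u\<in>{0..r2}. 0 < X (real n) u \<omega>))" for K and n :: nat and \<omega>
  \<comment> \<open>The naturals \<open>z\<close> and \<open>T\<close> may be 0, while
    \<open>climb_probability\<close> asks for a level at least 1 and a positive time.\<close>
  define y where "y = real z + 1"
  define t where "t = real T + 1"
  have y: "1 \<le> y" and t: "0 < t" by (auto simp: y_def t_def)
  have "AE \<omega> in M. \<not> (\<forall>K>0. \<exists>N. \<forall>n\<ge>N. C K n \<omega>)"
  proof (rule outer_le_zero)
    fix p :: real assume p: "0 < p"
    have "\<forall>\<^sub>F K in at_top. (W (y + 1) + t) / p \<le> W K"
      using W_lim unfolding filterlim_at_top by blast
    then have "\<forall>\<^sub>F K in at_top. (W (y + 1) + t) / p \<le> W K \<and> y + 1 < K"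
      using eventually_gt_at_top[of "y + 1"] by (rule eventually_conj)
    then have "\<exists>K. (W (y + 1) + t) / p \<le> W K \<and> y + 1 < K"
      by (rule eventually_happens'[rotated]) simp
    then obtain K where K: "(W (y + 1) + t) / p \<le> W K" "y + 1 < K" by blast
    have K0: "0 < K" using K y by simp
    have pK: "(W (y + 1) + t) / W K \<le> p" using K(1) p W_pos[OF K0] by (simp add: field_simps)
    obtain N :: nat where N: "y + 1 < real N" using reals_Archimedean2 by blast
    show "outer_le (\<lambda>\<omega>. \<forall>K>0. \<exists>N. \<forall>n\<ge>N. C K n \<omega>) p"
    proof (rule outer_le_liminf[where P="C (K + 1)" and N=N])
      fix n assume n: "N \<le> n"
      then have xn: "y + 1 < real n" using N by linarith
      have "AE \<omega> in M. stopped_solution q (\<lambda>t. B t \<omega>) (real n) (\<lambda>t. X (real n) t \<omega>)"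
        using sol by eventually_elim simp
      then have climb: "outer_le (\<lambda>\<omega>. \<exists>r1 r2. 0 \<le> r1 \<and> r1 \<le> r2 \<and> r2 \<le> t \<and> X (real n) r1 \<omega> \<le> y \<and>
          K + 1 \<le> X (real n) r2 \<omega> \<and> (\<forall>u\<in>{0..r2}. 0 < X (real n) u \<omega>)) ((W (y + 1) + t) / W K)"
        by (intro climb_probability[where X="X (real n)", OF BM C1 W W_pos y K(2) xn t])
      show "outer_le (C (K + 1) n) p"
      proof (rule outer_le_mono[OF climb _ pK], intro AE_I2 impI)
        fix \<omega> assume "C (K + 1) n \<omega>"
        then obtain r1 r2 where "0 \<le> r1" "r1 \<le> r2" "r2 \<le> real T" "X (real n) r1 \<omega> \<le> real z"
            "K + 1 \<le> X (real n) r2 \<omega>" "\<forall>u\<in>{0..r2}. 0 < X (real n) u \<omega>"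
          unfolding C_def by blast
        then show "\<exists>r1 r2. 0 \<le> r1 \<and> r1 \<le> r2 \<and> r2 \<le> t \<and> X (real n) r1 \<omega> \<le> y \<and> K + 1 \<le> X (real n) r2 \<omega> \<and>
            (\<forall>u\<in>{0..r2}. 0 < X (real n) u \<omega>)"
          by (intro exI[of _ r1] exI[of _ r2]) (simp add: t_def y_def)
      qed
    next
      show "AE \<omega> in M. (\<forall>K>0. \<exists>N. \<forall>n\<ge>N. C K n \<omega>) \<longrightarrow> (\<exists>m. \<forall>n\<ge>m. C (K + 1) n \<omega>)"
        using K0 by (intro AE_I2) auto
    qed
  qed
  then show ?thesis unfolding C_def by eventually_elim auto
qed

text \<open>Tails of rate \<open>2 * c\<close> outweigh the growth of \<open>exp (c * T)\<close>,
  leaving a geometric series of ratio \<open>exp (- c)\<close>. The integrand is compared with the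
  measurable function \<open>g\<close> built from covers of the tail events.\<close>

lemma (in prob_space) exponential_moment:
  fixes T :: "'a \<Rightarrow> ereal"
  assumes c: "0 < c" and T: "\<And>\<omega>. 0 \<le> T \<omega>"
    and tail: "\<And>k. 0 < k \<Longrightarrow> outer_le (\<lambda>\<omega>. ereal (real k) < T \<omega>) (2 * exp (- 2 * c * real k))"
  shows "AE \<omega> in M. T \<omega> < \<infinity>" "(\<integral>\<^sup>+ \<omega>. ennreal (exp (c * real_of_ereal (T \<omega>))) \<partial>M) < \<infinity>"
proof -
  have "AE \<omega> in M. \<not> T \<omega> = \<infinity>"
  proof (rule outer_le_zero)
    fix p :: real assume p: "0 < p"
    obtain k :: nat where k: "1 / (c * p) < real k" using reals_Archimedean2 by blast
    then have k0: "0 < real k" using c p by (smt (verit) divide_pos_pos mult_pos_pos)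
    have w: "0 < 2 * c * real k" using c k0 by simp
    have "2 * c * real k \<le> exp (2 * c * real k)" using exp_ge_add_one_self[of "2 * c * real k"] by linarith
    then have "2 * exp (- 2 * c * real k) \<le> 2 * (1 / (2 * c * real k))"
      using w by (simp add: exp_minus field_simps)
    also have "\<dots> \<le> p" using k c p k0 by (simp add: field_simps)
    finally show "outer_le (\<lambda>\<omega>. T \<omega> = \<infinity>) p"
      using k0 by (intro outer_le_mono[OF tail[of k]]) auto
  qed
  then show fin: "AE \<omega> in M. T \<omega> < \<infinity>" by eventually_elim simp
  have "\<forall>k. \<exists>A. A \<in> events \<and> prob A \<le> 2 * exp (- 2 * c * real (Suc k)) \<and> (AE \<omega> in M. ereal (real (Suc k)) < T \<omega> \<longrightarrow> \<omega> \<in> A)"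
    using tail unfolding outer_le_def by (metis zero_less_Suc)
  then obtain A where A: "\<And>k. A k \<in> events" "\<And>k. prob (A k) \<le> 2 * exp (- 2 * c * real (Suc k))"
      "\<And>k. AE \<omega> in M. ereal (real (Suc k)) < T \<omega> \<longrightarrow> \<omega> \<in> A k"
    by metis
  have A': "AE \<omega> in M. \<forall>k. ereal (real (Suc k)) < T \<omega> \<longrightarrow> \<omega> \<in> A k"
    by (intro AE_all_countable[THEN iffD2] allI A(3))
  \<comment> \<open>If \<open>k + 1 < T \<le> k + 2\<close>, the integrand is at most
    \<open>exp (c * (k + 2))\<close> and the point lies in \<open>A k\<close>; the summand
    \<open>exp c\<close> takes care of \<open>T \<le> 1\<close>.\<close>
  define g where "g \<omega> = ennreal (exp c) + (\<Sum>k. ennreal (exp (c * real (k + 2))) * indicator (A k) \<omega>)" for \<omega>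
  have "(\<integral>\<^sup>+ \<omega>. ennreal (exp (c * real_of_ereal (T \<omega>))) \<partial>M) \<le> (\<integral>\<^sup>+ \<omega>. g \<omega> \<partial>M)"
  proof (rule nn_integral_mono_AE)
    show "AE \<omega> in M. ennreal (exp (c * real_of_ereal (T \<omega>))) \<le> g \<omega>"
      using fin A'
    proof eventually_elim
      case (elim \<omega>)
      obtain r where r: "T \<omega> = ereal r" "0 \<le> r" using elim(1) T[of \<omega>] by (cases "T \<omega>") auto
      show ?case
      proof (cases "r \<le> 1")
        case True
        then have "ennreal (exp (c * r)) \<le> ennreal (exp c)" using c by (intro ennreal_leI) auto
        then show ?thesis using r by (simp add: g_def add_increasing2)
      next
        case False
        define k where "k = nat (\<lceil>r\<rceil> - 2)"
        have "2 \<le> \<lceil>r\<rceil>" using False by linarith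
        then have "real k = of_int \<lceil>r\<rceil> - 2" by (simp add: k_def)
        then have k: "real (Suc k) < r" "r \<le> real (k + 2)" by simp_all linarith+
        have "\<omega> \<in> A k" using elim(2) k(1) r by auto
        have "ennreal (exp (c * r)) \<le> ennreal (exp (c * real (k + 2)))"
          using c k(2) by (intro ennreal_leI) auto
        also have "\<dots> = ennreal (exp (c * real (k + 2))) * indicator (A k) \<omega>" using \<open>\<omega> \<in> A k\<close> by simp
        also have "\<dots> = (\<Sum>j\<in>{k}. ennreal (exp (c * real (j + 2))) * indicator (A j) \<omega>)"
          by (subst sum.insert) auto
        also have "\<dots> \<le> (\<Sum>j. ennreal (exp (c * real (j + 2))) * indicator (A j) \<omega>)"
          by (rule sum_le_suminf) auto
        finally show ?thesis using r by (simp add: g_def add_increasing)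
      qed
    qed
  qed
  also have "(\<integral>\<^sup>+ \<omega>. g \<omega> \<partial>M) = ennreal (exp c) + (\<Sum>k. ennreal (exp (c * real (k + 2))) * emeasure M (A k))"
    unfolding g_def using A(1)
    by (subst nn_integral_add) (simp_all add: nn_integral_suminf nn_integral_cmult_indicator emeasure_space_1)
  also have "\<dots> \<le> ennreal (exp c) + (\<Sum>k. ennreal (2 * exp (- c) ^ k))"
  proof (intro add_left_mono suminf_le allI)
    fix k
    have "exp (c * real (k + 2)) * prob (A k) \<le> exp (c * real (k + 2)) * (2 * exp (- 2 * c * real (Suc k)))"
      using A(2) by (intro mult_left_mono) auto
    also have "\<dots> = 2 * exp (c * real (k + 2) + - 2 * c * real (Suc k))" by (subst exp_add) simp
    also have "c * real (k + 2) + - 2 * c * real (Suc k) = real k * (- c)" by (simp add: algebra_simps)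
    also have "exp (real k * (- c)) = exp (- c) ^ k" by (rule exp_of_nat_mult)
    finally show "ennreal (exp (c * real (k + 2))) * emeasure M (A k) \<le> ennreal (2 * exp (- c) ^ k)"
      by (simp add: emeasure_eq_measure ennreal_mult'[symmetric] ennreal_leI)
  qed auto
  also have "\<dots> < \<infinity>"
  proof -
    have "summable (\<lambda>k. 2 * exp (- c) ^ k)" using c by (intro summable_mult summable_geometric) auto
    then have "(\<Sum>k. ennreal (2 * exp (- c) ^ k)) \<noteq> \<top>" by (intro ennreal_suminf_neq_top) auto
    then show ?thesis by (simp add: less_top)
  qed
  finally show "(\<integral>\<^sup>+ \<omega>. ennreal (exp (c * real_of_ereal (T \<omega>))) \<partial>M) < \<infinity>" .
qed

section \<open>Assembly of the pathwise and probabilistic statements\<close>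

theorem theorem3p1:
  fixes M :: "'a measure" and B :: "real \<Rightarrow> 'a \<Rightarrow> real"
    and q :: "real \<Rightarrow> real" and X :: "real \<Rightarrow> real \<Rightarrow> 'a \<Rightarrow> real"
  assumes BM: "brownian_motion M B"
    and q_C1: "C1_on_nonneg q"
    and H1: "H1 q"
    and meas: "\<And>x t. X x t \<in> borel_measurable M"
    and sol: "AE \<omega> in M. \<forall>x\<ge>0. stopped_solution q (\<lambda>t. B t \<omega>) x (\<lambda>t. X x t \<omega>)"
    and mono: "AE \<omega> in M. \<forall>x y t. 0 \<le> x \<and> x \<le> y \<and> 0 \<le> t \<longrightarrow> X x t \<omega> \<le> X y t \<omega>"
  shows "\<exists>Xinf :: real \<Rightarrow> 'a \<Rightarrow> ereal.
    (AE \<omega> in M.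
       (\<forall>t\<ge>0. ((\<lambda>x. ereal (X x (real_of_ereal (min (ereal t) (hit (\<lambda>u. X x u \<omega>) 0))) \<omega>))
                 \<longlongrightarrow> Xinf t \<omega>) at_top) \<and>
       (\<forall>t\<ge>0. Xinf t \<omega> \<ge> 0) \<and>
       continuous_on {0..} (\<lambda>t. Xinf t \<omega>) \<and>
       Xinf 0 \<omega> = \<infinity> \<and>
       (\<forall>t>0. Xinf t \<omega> < \<infinity>) \<and>
       (\<forall>z\<ge>0. ((\<lambda>x. hit (\<lambda>t. X x t \<omega>) z) \<longlongrightarrow> hit (\<lambda>t. Xinf t \<omega>) (ereal z)) at_top) \<and>
       (\<forall>s t. 0 < s \<and> s \<le> t \<and> ereal t \<le> hit (\<lambda>u. Xinf u \<omega>) 0 \<longrightarrow>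
          real_of_ereal (Xinf t \<omega>) = real_of_ereal (Xinf s \<omega>) + B t \<omega> - B s \<omega>
             - integral {s..t} (\<lambda>u. q (real_of_ereal (Xinf u \<omega>))))) \<and>
    (\<forall>z\<ge>0. \<exists>c>0. (AE \<omega> in M. hit (\<lambda>t. Xinf t \<omega>) (ereal z) < \<infinity>) \<and>
        (\<integral>\<^sup>+ \<omega>. ennreal (exp (c * real_of_ereal (hit (\<lambda>t. Xinf t \<omega>) (ereal z)))) \<partial>M) < \<infinity>)"
proof -
  interpret prob_space M using BM by (simp add: brownian_motion_def)
  have q: "continuous_on {0..} q" by (rule C1_on_nonneg_continuous[OF q_C1])
  show ?thesis
  proof (rule H1_potential_sup[OF q H1])
    fix U U' W :: "real \<Rightarrow> real" and S :: real
    assume U: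
      "\<And>x. 0 < x \<Longrightarrow> (U has_real_derivative U' x) (at x)"
      "\<And>x. 0 < x \<Longrightarrow> (U' has_real_derivative 2 * q x * U' x - 2) (at x)"
      "\<And>x. 0 < x \<Longrightarrow> 0 < U' x" and U0: "\<And>x. 0 < x \<Longrightarrow> 0 \<le> U x" and S: "\<And>x. 0 < x \<Longrightarrow> U x < S"
      and S': "\<And>e. 0 < e \<Longrightarrow> \<exists>z>0. \<forall>y\<ge>z. S - e < U y"
      and W: "\<And>x. 0 < x \<Longrightarrow> (W has_real_derivative exp (gam q x)) (at x)" "\<And>x. 0 < x \<Longrightarrow> 0 < W x"
        "filterlim W at_top at_top"
    have S0: "0 < S" using U0[of 1] S[of 1] by simp
    \<comment> \<open>The exceptional set of \<open>fast_descent\<close> depends on the time, so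
      countably many times \<open>1 / (k + 1)\<close> are used; descending within a shorter time is
      the stronger statement.\<close>
    have "AE \<omega> in M. \<forall>k::nat. \<exists>z::nat. \<forall>n::nat. \<exists>u\<in>{0..inverse (real (Suc k))}. X (real n) u \<omega> \<le> real z"
      by (intro AE_all_countable[THEN iffD2] allI fast_descent[OF BM q_C1 U S S' _ sol mono]) simp_all
    moreover have "AE \<omega> in M. \<forall>z T :: nat. \<exists>K>0. \<forall>N. \<exists>n\<ge>N. \<not> (\<exists>r1 r2. 0 \<le> r1 \<and> r1 \<le> r2 \<and> r2 \<le> real T \<and>
        X (real n) r1 \<omega> \<le> real z \<and> K \<le> X (real n) r2 \<omega> \<and> (\<forall>u\<in>{0..r2}. 0 < X (real n) u \<omega>))"
      by (intro AE_all_countable[THEN iffD2] allI no_explosion[OF BM q_C1 W sol])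
    ultimately have good: "AE \<omega> in M. coming_down q (\<lambda>t. B t \<omega>) (\<lambda>x t. X x t \<omega>)"
      using sol mono AE_space
    proof eventually_elim
      case (elim \<omega>)
      show ?case
      proof
        show "continuous_on {0..} q" by (rule q)
        show "continuous_on {0..} (\<lambda>t. B t \<omega>)" "B 0 \<omega> = 0"
          using BM elim(5) by (auto simp: brownian_motion_def)
        show "stopped_solution q (\<lambda>t. B t \<omega>) x (\<lambda>t. X x t \<omega>)" if "0 \<le> x" for x using elim(3) that by blast
        show "X x t \<omega> \<le> X y t \<omega>" if "0 \<le> x" "x \<le> y" "0 \<le> t" for x y t using elim(4) that by blast
        show "\<exists>z::nat. \<forall>n::nat. \<exists>u\<in>{0..t}. X (real n) u \<omega> \<le> real z" if t: "0 < t" for t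
        proof -
          obtain k where k: "inverse (real (Suc k)) < t" using reals_Archimedean[OF t] by blast
          obtain z :: nat where z: "\<forall>n::nat. \<exists>u\<in>{0..inverse (real (Suc k))}. X (real n) u \<omega> \<le> real z"
            using elim(1) by blast
          have "{0..inverse (real (Suc k))} \<subseteq> {0..t}" using k by auto
          then show ?thesis using z by blast
        qed
        show "\<exists>K>0. \<forall>N. \<exists>n\<ge>N. \<not> (\<exists>r1 r2. 0 \<le> r1 \<and> r1 \<le> r2 \<and> r2 \<le> real T \<and>
            X (real n) r1 \<omega> \<le> real z \<and> K \<le> X (real n) r2 \<omega> \<and> (\<forall>u\<in>{0..r2}. 0 < X (real n) u \<omega>))" for z T :: nat
          using elim(2) by blast
      qed
    qed
    \<comment> \<open>As a supremum over integer starting points, the limit is defined for every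
      \<open>\<omega>\<close>, even where the locale assumptions fail, so it can serve as the
      witness.\<close>
    define Y where "Y t \<omega> = coming_down.Xinf (\<lambda>x t. X x t \<omega>) t" for t \<omega>
    show ?thesis
    proof (intro exI[of _ Y] conjI allI impI)
      show "AE \<omega> in M.
         (\<forall>t\<ge>0. ((\<lambda>x. ereal (X x (real_of_ereal (min (ereal t) (hit (\<lambda>u. X x u \<omega>) 0))) \<omega>))
                   \<longlongrightarrow> Y t \<omega>) at_top) \<and>
         (\<forall>t\<ge>0. Y t \<omega> \<ge> 0) \<and>
         continuous_on {0..} (\<lambda>t. Y t \<omega>) \<and>
         Y 0 \<omega> = \<infinity> \<and>
         (\<forall>t>0. Y t \<omega> < \<infinity>) \<and>
         (\<forall>z\<ge>0. ((\<lambda>x. hit (\<lambda>t. X x t \<omega>) z) \<longlongrightarrow> hit (\<lambda>t. Y t \<omega>) (ereal z)) at_top) \<and>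
         (\<forall>s t. 0 < s \<and> s \<le> t \<and> ereal t \<le> hit (\<lambda>u. Y u \<omega>) 0 \<longrightarrow>
            real_of_ereal (Y t \<omega>) = real_of_ereal (Y s \<omega>) + B t \<omega> - B s \<omega>
               - integral {s..t} (\<lambda>u. q (real_of_ereal (Y u \<omega>))))"
        using good
      proof eventually_elim
        case (elim \<omega>)
        interpret D: coming_down q "\<lambda>t. B t \<omega>" "\<lambda>x t. X x t \<omega>" by (rule elim)
        have Y: "(\<lambda>t. Y t \<omega>) = D.Xinf" by (simp add: Y_def)
        have Y': "Y t \<omega> = D.Xinf t" for t by (simp add: Y_def)
        have "((\<lambda>x. ereal (X x (real_of_ereal (min (ereal t) (hit (\<lambda>u. X x u \<omega>) 0))) \<omega>)) \<longlongrightarrow> D.Xinf t) at_top"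
          if t: "0 \<le> t" for t
        proof (rule Lim_transform_eventually[OF D.X_tendsto_Xinf[OF t]])
          show "\<forall>\<^sub>F x in at_top. ereal (X x t \<omega>) = ereal (X x (real_of_ereal (min (ereal t) (hit (\<lambda>u. X x u \<omega>) 0))) \<omega>)"
            using eventually_ge_at_top[of "0::real"]
            by eventually_elim (simp add: D.X_stopped[OF _ t])
        qed
        then show ?case
          unfolding Y Y'
          using D.Xinf_nonneg D.Xinf_cont D.Xinf_0 D.Xinf_finite(1) D.hit_tendsto D.Xi_increment by blast
      qed
    next
      fix z :: real assume z: "0 \<le> z"
      \<comment> \<open>The tail rate \<open>1 / (4 * S)\<close> is \<open>2 * c\<close>, twice the
        exponent that is integrated.\<close>
      define c where "c = 1 / (8 * S)"
      have c: "0 < c" using S0 by (simp add: c_def)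
      have tail: "outer_le (\<lambda>\<omega>. ereal (real k) < hit (\<lambda>t. Y t \<omega>) (ereal z)) (2 * exp (- 2 * c * real k))"
        if k: "0 < k" for k :: nat
      proof (rule outer_le_mono)
        have k': "0 < real k" using k by simp
        show "outer_le (\<lambda>\<omega>. \<exists>n::nat. \<forall>u\<in>{0..real k}. 0 < X (real n) u \<omega>) (2 * exp (- real k / (4 * S)))"
          by (rule alive_probability[OF BM q_C1 U S U0 k' sol mono])
        show "2 * exp (- real k / (4 * S)) \<le> 2 * exp (- 2 * c * real k)" by (simp add: c_def)
        show "AE \<omega> in M. ereal (real k) < hit (\<lambda>t. Y t \<omega>) (ereal z) \<longrightarrow> (\<exists>n::nat. \<forall>u\<in>{0..real k}. 0 < X (real n) u \<omega>)"
          using good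
        proof eventually_elim
          case (elim \<omega>)
          interpret D: coming_down q "\<lambda>t. B t \<omega>" "\<lambda>x t. X x t \<omega>" by (rule elim)
          show ?case
          proof
            assume "ereal (real k) < hit (\<lambda>t. Y t \<omega>) (ereal z)"
            then have "ereal (real k) < hit D.Xinf (ereal z)" by (simp add: Y_def[abs_def])
            also have "\<dots> \<le> hit D.Xinf 0" by (rule D.hit_Xinf_le_hit_0[OF z])
            finally have "\<forall>\<^sub>F x in at_top. \<forall>u\<in>{0..real k}. 0 < X x u \<omega>"
              by (intro D.eventually_alive) auto
            then have "\<forall>\<^sub>F n in sequentially. \<forall>u\<in>{0..real k}. 0 < X (real n) u \<omega>"
              by (rule eventually_compose_filterlim[OF _ filterlim_real_sequentially])
            then show "\<exists>n::nat. \<forall>u\<in>{0..real k}. 0 < X (real n) u \<omega>"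
              by (rule eventually_happens'[OF sequentially_bot])
          qed
        qed
      qed
      note moment = exponential_moment[where T="\<lambda>\<omega>. hit (\<lambda>t. Y t \<omega>) (ereal z)", OF c hit_nonneg tail]
      have "AE \<omega> in M. hit (\<lambda>t. Y t \<omega>) (ereal z) < \<infinity>"
        by (rule moment(1))
      moreover have "(\<integral>\<^sup>+ \<omega>. ennreal (exp (c * real_of_ereal (hit (\<lambda>t. Y t \<omega>) (ereal z)))) \<partial>M) < \<infinity>"
        by (rule moment(2))
      ultimately show "\<exists>c>0. (AE \<omega> in M. hit (\<lambda>t. Y t \<omega>) (ereal z) < \<infinity>) \<and>
          (\<integral>\<^sup>+ \<omega>. ennreal (exp (c * real_of_ereal (hit (\<lambda>t. Y t \<omega>) (ereal z)))) \<partial>M) < \<infinity>"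
        using c by (intro exI[of _ c] conjI)
    qed
  qed
qed

end
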